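(* Fix a finite relational schema $\sigma$ and an integer $d\geq 2$, and let $\mathbf{C}$ be a class of $\sigma$-databases of degree at most $d$ that is closed under removing tuples. Let $\mathbf{P}\subseteq\mathbf{C}$ be a property that is hyperfinite on $\mathbf{C}$. If for each $r\in\mathbb{N}$ the set $\operatorname{h}_r(\mathbf{P})$ is semilinear, then $\mathbf{P}$ is uniformly testable on $\mathbf{C}$ in constant time in the $\operatorname{BDRD}_{+/-}$ model.
   Context: A schema $\sigma$ is a finite set of relation names with arities in $\mathbb{N}_{\geq 1}$. A $\sigma$-database $\mathcal{D}$ has a finite domain $D$ (identified with $[n]$, linearly ordered) and a relation $R^{\mathcal{D}}\subseteq D^{\operatorname{ar}(R)}$ for each $R\in\sigma$. The Gaifman graph of $\mathcal{D}$ has vertex set $D$ and an edge between distinct $a,b$ whenever some tuple contains both; distances $\operatorname{dist}_{\mathcal{D}}(a,b)$ and connected components refer to this graph. The degree of an element is the number of tuples (over all relations) containing it; the degree of $\mathcal{D}$ is the maximum over its elements. Classes are closed under isomorphism; a property is an isomorphism-closed class. Hyperfinite: an $(\epsilon,k)$-partition of a database $\mathcal{D}$ on $n$ elements is a database obtained from $\mathcal{D}$ by removing at most $\epsilon n$ tuples such that every connected component has at most $k$ elements. A class $\mathbf{P}\subseteq\mathbf{C}$ is $\rho$-hyperfinite on $\mathbf{C}$ if for every $\epsilon\in(0,1]$ and $\mathcal{D}\in\mathbf{P}$ there is an $(\epsilon,\rho(\epsilon))$-partition of $\mathcal{D}$ lying in $\mathbf{C}$; it is hyperfinite on $\mathbf{C}$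 if it is $\rho$-hyperfinite for some function $\rho$. Neighbourhoods: for $a\in D$, $N_r(a)$ is the set of elements at distance at most $r$ from $a$, and the $r$-neighbourhood of $a$ is $(\mathcal{D}[N_r(a)],a)$ (induced sub-database with distinguished centre $a$). An $r$-type is an isomorphism class (centre-preserving) of $r$-neighbourhoods; there are finitely many, $\operatorname{c}(r)$, $r$-types of degree at most $d$ over $\sigma$. The $r$-histogram $\operatorname{h}_r(\mathcal{D})\in\mathbb{N}^{\operatorname{c}(r)}$ counts, for each $r$-type, the number of elements of that type; $\operatorname{h}_r(\mathbf{P})=\{\operatorname{h}_r(\mathcal{D})\mid\mathcal{D}\in\mathbf{P}\}$. A set $M\subseteq\mathbb{N}^c$ is linear if $M=\{\bar v_0+a_1\bar v_1+\dots+a_k\bar v_k\mid a_i\in\mathbb{N}\}$ for some $\bar v_0,\dots,\bar v_k\in\mathbb{N}^c$, and semilinear if it is a finite union of linear sets. $\operatorname{BDRD}_{+/-}$ distance: $\operatorname{dist}_{+/-}(\mathcal{D},\mathcal{D}')$ is the minimum number of modifications applied to $\mathcal{D}$ and $\mathcal{D}'$ to make them isomorphic, a modification being inserting a new element, deleting an element (with all tuples containing it), inserting a tuple, or deleting a tuple. $\mathcal{D},\mathcal{D}'$ are $\epsilon$-close if $\operatorname{dist}_{+/-}\leq\epsilon d\min\{|D|,|D'|\}$, else $\epsilon$-far; $\mathcal{D}$ is $\epsilon$-far from $\mathbf{P}$ if it is $\epsilon$-far from every member of $\mathbf{P}$. Testing: a tester receives $n=|D|$ and may ask oracle queries $(R,i,j)$,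 answered in constant time by the $j$-th tuple of $R^{\mathcal{D}}$ containing the $i$-th element (or $\bot$). An $\epsilon$-tester for $\mathbf{P}$ on $\mathbf{C}$ is a probabilistic algorithm which on input $\mathcal{D}\in\mathbf{C}$ accepts with probability $\geq 2/3$ if $\mathcal{D}\in\mathbf{P}$ and rejects with probability $\geq 2/3$ if $\mathcal{D}$ is $\epsilon$-far from $\mathbf{P}$. $\mathbf{P}$ is uniformly testable on $\mathbf{C}$ in time $f(n)$ if for every $\epsilon\in(0,1]$ there is such an $\epsilon$-tester, working for all $n$, whose number of oracle queries is bounded independently of $n$ and whose running time on $n$-element inputs is $f(n)$; constant time means $f$ constant. Running time is measured on a RAM with uniform cost. *)

theory Defs
  imports "HOL-Probability.Probability_Mass_Function"
begin

text \<open>A database over a schema (finite set sigma of relation names with arity function ar)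
  has domain {0..<db_size D} (the paper's [n], 0-based) and a relation (set of tuples,
  represented as lists) for every relation name.\<close>

datatype 'r db = DB (db_size: nat) (db_rel: "'r \<Rightarrow> nat list set")

definition wf_db :: "'r set \<Rightarrow> ('r \<Rightarrow> nat) \<Rightarrow> 'r db \<Rightarrow> bool" where
  "wf_db \<sigma> ar D \<longleftrightarrow>
     (\<forall>R. R \<notin> \<sigma> \<longrightarrow> db_rel D R = {}) \<and>
     (\<forall>R t. t \<in> db_rel D R \<longrightarrow> length t = ar R \<and> set t \<subseteq> {0..<db_size D})"

definition schema :: "'r set \<Rightarrow> ('r \<Rightarrow> nat) \<Rightarrow> bool" where
  "schema \<sigma> ar \<longleftrightarrow> finite \<sigma> \<and> (\<forall>R\<in>\<sigma>. ar R \<ge> 1)"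

definition db_iso :: "'r db \<Rightarrow> 'r db \<Rightarrow> bool" where
  "db_iso D D' \<longleftrightarrow> (\<exists>f. bij_betw f {0..<db_size D} {0..<db_size D'} \<and>
                         (\<forall>R. db_rel D' R = map f ` db_rel D R))"

definition elem_degree :: "'r db \<Rightarrow> nat \<Rightarrow> nat" where
  "elem_degree D a = card {(R, t). t \<in> db_rel D R \<and> a \<in> set t}"

definition db_degree_le :: "'r db \<Rightarrow> nat \<Rightarrow> bool" where
  "db_degree_le D d \<longleftrightarrow> (\<forall>a < db_size D. elem_degree D a \<le> d)"

definition iso_closed :: "'r set \<Rightarrow> ('r \<Rightarrow> nat) \<Rightarrow> 'r db set \<Rightarrow> bool" where
  "iso_closed \<sigma> ar K \<longleftrightarrow> (\<forall>D D'. D \<in> K \<longrightarrow> wf_db \<sigma> ar D' \<longrightarrow> db_iso D D' \<longrightarrow> D' \<in> K)"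

definition closed_under_tuple_removal :: "'r db set \<Rightarrow> bool" where
  "closed_under_tuple_removal K \<longleftrightarrow>
     (\<forall>D D'. D \<in> K \<longrightarrow> db_size D' = db_size D \<longrightarrow> (\<forall>R. db_rel D' R \<subseteq> db_rel D R) \<longrightarrow> D' \<in> K)"

definition gadj :: "'r db \<Rightarrow> nat \<Rightarrow> nat \<Rightarrow> bool" where
  "gadj D a b \<longleftrightarrow> a \<noteq> b \<and> (\<exists>R t. t \<in> db_rel D R \<and> a \<in> set t \<and> b \<in> set t)"

definition nbhd :: "nat \<Rightarrow> 'r db \<Rightarrow> nat \<Rightarrow> nat set" where
  "nbhd r D a = {b. b < db_size D \<and> (\<exists>k\<le>r. (gadj D ^^ k) a b)}"

definition component :: "'r db \<Rightarrow> nat \<Rightarrow> nat set" where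
  "component D a = {b. (gadj D)\<^sup>*\<^sup>* a b}"

definition components_le :: "'r db \<Rightarrow> nat \<Rightarrow> bool" where
  "components_le D k \<longleftrightarrow> (\<forall>a < db_size D. card (component D a) \<le> k)"

definition eps_k_partition ::
  "'r set \<Rightarrow> real \<Rightarrow> nat \<Rightarrow> 'r db \<Rightarrow> 'r db \<Rightarrow> bool" where
  "eps_k_partition \<sigma> \<epsilon> k D D' \<longleftrightarrow>
     db_size D' = db_size D \<and> (\<forall>R. db_rel D' R \<subseteq> db_rel D R) \<and>
     real (\<Sum>R\<in>\<sigma>. card (db_rel D R - db_rel D' R)) \<le> \<epsilon> * real (db_size D) \<and>
     components_le D' k"

definition rho_hyperfinite_on ::
  "'r set \<Rightarrow> (real \<Rightarrow> nat) \<Rightarrow> 'r db set \<Rightarrow> 'r db set \<Rightarrow> bool" where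
  "rho_hyperfinite_on \<sigma> \<rho> P C \<longleftrightarrow>
     (\<forall>\<epsilon>. 0 < \<epsilon> \<and> \<epsilon> \<le> 1 \<longrightarrow>
        (\<forall>D\<in>P. \<exists>D'. eps_k_partition \<sigma> \<epsilon> (\<rho> \<epsilon>) D D' \<and> D' \<in> C))"

definition hyperfinite_on :: "'r set \<Rightarrow> 'r db set \<Rightarrow> 'r db set \<Rightarrow> bool" where
  "hyperfinite_on \<sigma> P C \<longleftrightarrow> (\<exists>\<rho>. rho_hyperfinite_on \<sigma> \<rho> P C)"

definition same_rtype :: "nat \<Rightarrow> 'r db \<Rightarrow> nat \<Rightarrow> 'r db \<Rightarrow> nat \<Rightarrow> bool" where
  "same_rtype r D a D' a' \<longleftrightarrow>
     (\<exists>f. bij_betw f (nbhd r D a) (nbhd r D' a') \<and> f a = a' \<and>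
          (\<forall>R t. set t \<subseteq> nbhd r D a \<longrightarrow> (t \<in> db_rel D R \<longleftrightarrow> map f t \<in> db_rel D' R)))"

definition rtype :: "'r set \<Rightarrow> ('r \<Rightarrow> nat) \<Rightarrow> nat \<Rightarrow> 'r db \<Rightarrow> nat \<Rightarrow> ('r db \<times> nat) set" where
  "rtype \<sigma> ar r D a = {(D', a'). wf_db \<sigma> ar D' \<and> a' < db_size D' \<and> same_rtype r D a D' a'}"

text \<open>The r-histogram, as a vector indexed by r-types (zero outside realised types).\<close>
definition histogram :: "'r set \<Rightarrow> ('r \<Rightarrow> nat) \<Rightarrow> nat \<Rightarrow> 'r db \<Rightarrow> (('r db \<times> nat) set \<Rightarrow> nat)" where
  "histogram \<sigma> ar r D = (\<lambda>\<tau>. card {a. a < db_size D \<and> rtype \<sigma> ar r D a = \<tau>})"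

definition linear_set :: "('i \<Rightarrow> nat) set \<Rightarrow> bool" where
  "linear_set M \<longleftrightarrow> (\<exists>v0 vs. M = {(\<lambda>x. v0 x + (\<Sum>i<length vs. c i * (vs ! i) x)) | c. True})"

definition semilinear_set :: "('i \<Rightarrow> nat) set \<Rightarrow> bool" where
  "semilinear_set M \<longleftrightarrow> (\<exists>L. finite L \<and> (\<forall>M'\<in>L. linear_set M') \<and> M = \<Union>L)"

definition del_elem :: "nat \<Rightarrow> 'r db \<Rightarrow> 'r db" where
  "del_elem i D = DB (db_size D - 1)
     (\<lambda>R. map (\<lambda>x. if x < i then x else x - 1) ` {t \<in> db_rel D R. i \<notin> set t})"

definition mod_step :: "'r set \<Rightarrow> ('r \<Rightarrow> nat) \<Rightarrow> 'r db \<Rightarrow> 'r db \<Rightarrow> bool" where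
  "mod_step \<sigma> ar D D' \<longleftrightarrow>
     D' = DB (db_size D + 1) (db_rel D) \<or>
     (\<exists>i < db_size D. D' = del_elem i D) \<or>
     (\<exists>R\<in>\<sigma>. \<exists>t. length t = ar R \<and> set t \<subseteq> {0..<db_size D} \<and> t \<notin> db_rel D R \<and>
        D' = DB (db_size D) ((db_rel D)(R := insert t (db_rel D R)))) \<or>
     (\<exists>R t. t \<in> db_rel D R \<and> D' = DB (db_size D) ((db_rel D)(R := db_rel D R - {t})))"

definition dist_pm :: "'r set \<Rightarrow> ('r \<Rightarrow> nat) \<Rightarrow> 'r db \<Rightarrow> 'r db \<Rightarrow> nat" where
  "dist_pm \<sigma> ar D D' = (LEAST k. \<exists>k1 k2 E E'. k = k1 + k2 \<and>
       (mod_step \<sigma> ar ^^ k1) D E \<and> (mod_step \<sigma> ar ^^ k2) D' E' \<and> db_iso E E')"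

definition eps_far :: "'r set \<Rightarrow> ('r \<Rightarrow> nat) \<Rightarrow> nat \<Rightarrow> real \<Rightarrow> 'r db \<Rightarrow> 'r db \<Rightarrow> bool" where
  "eps_far \<sigma> ar d \<epsilon> D D' \<longleftrightarrow>
     real (dist_pm \<sigma> ar D D') > \<epsilon> * real d * real (min (db_size D) (db_size D'))"

definition eps_far_from :: "'r set \<Rightarrow> ('r \<Rightarrow> nat) \<Rightarrow> nat \<Rightarrow> real \<Rightarrow> 'r db \<Rightarrow> 'r db set \<Rightarrow> bool" where
  "eps_far_from \<sigma> ar d \<epsilon> D P \<longleftrightarrow> (\<forall>D'\<in>P. eps_far \<sigma> ar d \<epsilon> D D')"

text \<open>Oracle: orc R i j = the j-th (0-based) tuple of R containing element i, or None.
  Any enumeration order is allowed; the tester must work for all of them.\<close>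
definition valid_oracle :: "'r db \<Rightarrow> ('r \<Rightarrow> nat \<Rightarrow> nat \<Rightarrow> nat list option) \<Rightarrow> bool" where
  "valid_oracle D orc \<longleftrightarrow>
     (\<forall>R i. \<exists>m. (\<forall>j. orc R i j \<noteq> None \<longleftrightarrow> j < m) \<and>
        bij_betw (\<lambda>j. the (orc R i j)) {0..<m} {t \<in> db_rel D R. i < db_size D \<and> i \<in> set t})"

datatype 'r instr =
    Const nat nat
  | Add nat nat nat
  | Sub nat nat nat        \<comment> \<open>reg r := reg a - reg b (truncated)\<close>
  | Mul nat nat nat
  | Div nat nat nat
  | Load nat nat
  | Store nat nat
  | Jmp nat
  | Jz nat nat
  | Rand nat nat           \<comment> \<open>reg r := uniform random element of {0..<reg a} (0 if reg a = 0)\<close>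
  | Query 'r nat nat nat
  | Accept
  | Reject

datatype config = Run nat "nat \<Rightarrow> nat" | Acc | Rej

definition write_answer :: "nat \<Rightarrow> nat list option \<Rightarrow> (nat \<Rightarrow> nat) \<Rightarrow> (nat \<Rightarrow> nat)" where
  "write_answer q ans s = (case ans of None \<Rightarrow> s(q := 0)
     | Some t \<Rightarrow> (\<lambda>x. if x = q then 1 else if q < x \<and> x \<le> q + length t then t ! (x - q - 1) else s x))"

definition step :: "'r instr list \<Rightarrow> ('r \<Rightarrow> nat \<Rightarrow> nat \<Rightarrow> nat list option) \<Rightarrow> config \<Rightarrow> config pmf" where
  "step prog orc c = (case c of
      Acc \<Rightarrow> return_pmf Acc
    | Rej \<Rightarrow> return_pmf Rej
    | Run pc s \<Rightarrow> (if length prog \<le> pc then return_pmf Rej else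
       (case prog ! pc of
          Const r k \<Rightarrow> return_pmf (Run (Suc pc) (s(r := k)))
        | Add r a b \<Rightarrow> return_pmf (Run (Suc pc) (s(r := s a + s b)))
        | Sub r a b \<Rightarrow> return_pmf (Run (Suc pc) (s(r := s a - s b)))
        | Mul r a b \<Rightarrow> return_pmf (Run (Suc pc) (s(r := s a * s b)))
        | Div r a b \<Rightarrow> return_pmf (Run (Suc pc) (s(r := s a div s b)))
        | Load r a \<Rightarrow> return_pmf (Run (Suc pc) (s(r := s (s a))))
        | Store a b \<Rightarrow> return_pmf (Run (Suc pc) (s(s a := s b)))
        | Jmp l \<Rightarrow> return_pmf (Run l s)
        | Jz r l \<Rightarrow> return_pmf (Run (if s r = 0 then l else Suc pc) s)
        | Rand r a \<Rightarrow> map_pmf (\<lambda>v. Run (Suc pc) (s(r := v)))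
                         (if s a = 0 then return_pmf 0 else pmf_of_set {0..<s a})
        | Query R i j q \<Rightarrow> return_pmf (Run (Suc pc) (write_answer q (orc R (s i) (s j)) s))
        | Accept \<Rightarrow> return_pmf Acc
        | Reject \<Rightarrow> return_pmf Rej)))"

primrec run :: "'r instr list \<Rightarrow> ('r \<Rightarrow> nat \<Rightarrow> nat \<Rightarrow> nat list option) \<Rightarrow> nat \<Rightarrow> config \<Rightarrow> config pmf" where
  "run prog orc 0 c = return_pmf c"
| "run prog orc (Suc k) c = bind_pmf (step prog orc c) (run prog orc k)"

definition init :: "nat \<Rightarrow> config" where
  "init n = Run 0 (\<lambda>x. if x = 0 then n else 0)"

definition eps_tester ::
  "'r set \<Rightarrow> ('r \<Rightarrow> nat) \<Rightarrow> nat \<Rightarrow> 'r db set \<Rightarrow> 'r db set \<Rightarrow> real \<Rightarrow> 'r instr list \<Rightarrow> nat \<Rightarrow> bool" where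
  "eps_tester \<sigma> ar d P C \<epsilon> prog T \<longleftrightarrow>
     (\<forall>D orc. D \<in> C \<longrightarrow> valid_oracle D orc \<longrightarrow>
        (let \<mu> = run prog orc T (init (db_size D)) in
           set_pmf \<mu> \<subseteq> {Acc, Rej} \<and>
           (D \<in> P \<longrightarrow> pmf \<mu> Acc \<ge> 2/3) \<and>
           (eps_far_from \<sigma> ar d \<epsilon> D P \<longrightarrow> pmf \<mu> Rej \<ge> 2/3)))"

definition uniformly_testable_const_time ::
  "'r set \<Rightarrow> ('r \<Rightarrow> nat) \<Rightarrow> nat \<Rightarrow> 'r db set \<Rightarrow> 'r db set \<Rightarrow> bool" where
  "uniformly_testable_const_time \<sigma> ar d P C \<longleftrightarrow>
     (\<forall>\<epsilon>. 0 < \<epsilon> \<and> \<epsilon> \<le> 1 \<longrightarrow> (\<exists>prog T. eps_tester \<sigma> ar d P C \<epsilon> prog T))"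

end

theory Submission
  imports Defs
begin

text \<open>
  The heart of the proof is that a database \<open>D'\<close> whose histogram of \<open>r\<close>-types is similar to that
  of a hyperfinite database \<open>D\<close> is close to \<open>D\<close>. Both databases are cut into small components by
  the same random local procedure. In one round every element is coloured with probability one
  half, and a connected component of coloured elements is cut off if it is small and has a small
  boundary. A piece of a hyperfinite partition appears as such a component with a probability
  bounded from below, so after a bounded number of rounds few elements of \<open>D\<close> lie in large
  components. The \<open>r\<close>-type of an element after a round depends only on its coloured neighbourhood of
  a larger radius, so the expected histograms after the round are still similar; changing one colour
  affects boundedly many types, so the histograms are concentrated by the Efron--Stein inequality and
  Chebyshev's inequality. In the end, the small components of both databases are matched with each
  other up to a small remainder, which is deleted.

  The tester reads small databases completely. On a large database it compares the frequencies of
  the types of randomly sampled elements with those of all large members of \<open>P\<close>; this condition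
  does not depend on the input size. Semilinearity makes this sound: scaling the coefficients of the
  periods turns a member of \<open>P\<close> with similar frequencies into one which in addition has about the
  size of the input. The program evaluates the decision as a function of the equality pattern of its
  registers, which determines the sampled types up to isomorphism.
\<close>

section \<open>Neighbourhoods and their isomorphisms\<close>

text \<open>The colourings of the two databases are chosen separately, without a coupling. What
  links them is that the expected histogram after a round is a fixed linear function of the
  histogram at radius \<open>r + k + 3\<close>, so two concentration statements and the triangle
  inequality suffice. Each round consumes radius and accuracy; both are fixed backwards from the
  last round, so the number of rounds must be known in advance. It comes from the factor
  \<open>1 - carve_prob\<close> by which a round contracts the expected excess of undone elements
  over a floor, which is caused by the pieces whose boundary exceeds the threshold
  \<open>\<delta>\<close>. Removed tuples are charged to the elements that become done, so the cost
  stays below \<open>\<delta>\<close> times the size, however many rounds there are. No partition of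
  \<open>D'\<close> is available; the matching needs few undone elements only in \<open>D\<close>,
  and what remains of \<open>D'\<close> exceeds what remains of \<open>D\<close> just by the
  difference of the sizes. The program sees only equalities between registers; to recognise a small
  database exactly it keeps the numbers below a threshold in registers.\<close>

definition reach :: "nat \<Rightarrow> ('a \<Rightarrow> 'a \<Rightarrow> bool) \<Rightarrow> 'a \<Rightarrow> 'a set" where
  "reach r G a = {b. \<exists>k\<le>r. (G ^^ k) a b}"

lemma reach_0 [simp]: "reach 0 G a = {a}"
  by (auto simp: reach_def)

lemma reach_Suc: "reach (Suc r) G a = reach r G a \<union> {b. \<exists>x\<in>reach r G a. G x b}"
proof
  show "reach (Suc r) G a \<subseteq> reach r G a \<union> {b. \<exists>x\<in>reach r G a. G x b}"
  proof
    fix b assume "b \<in> reach (Suc r) G a"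
    then obtain k where k: "k \<le> Suc r" "(G ^^ k) a b" by (auto simp: reach_def)
    show "b \<in> reach r G a \<union> {b. \<exists>x\<in>reach r G a. G x b}"
    proof (cases k)
      case 0 then show ?thesis using k by (auto simp: reach_def)
    next
      case (Suc j)
      then obtain x where "(G ^^ j) a x" "G x b" using k by auto
      then show ?thesis using Suc k by (auto simp: reach_def)
    qed
  qed
next
  show "reach r G a \<union> {b. \<exists>x\<in>reach r G a. G x b} \<subseteq> reach (Suc r) G a"
  proof
    fix b assume "b \<in> reach r G a \<union> {b. \<exists>x\<in>reach r G a. G x b}"
    then show "b \<in> reach (Suc r) G a"
    proof
      assume "b \<in> reach r G a" then show ?thesis by (auto simp: reach_def intro: le_SucI)
    next
      assume "b \<in> {b. \<exists>x\<in>reach r G a. G x b}"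
      then obtain x k where "k \<le> r" "(G ^^ k) a x" "G x b" by (auto simp: reach_def)
      then have "(G ^^ Suc k) a b" "Suc k \<le> Suc r" by auto
      then show ?thesis unfolding reach_def by blast
    qed
  qed
qed

lemma reach_self [simp]: "a \<in> reach r G a"
  by (induction r) (auto simp: reach_Suc)

lemma reach_mono: "r \<le> r' \<Longrightarrow> reach r G a \<subseteq> reach r' G a"
  by (auto simp: reach_def intro: le_trans)

lemma reach_mono_rel:
  assumes "\<And>x y. G x y \<Longrightarrow> G' x y" shows "reach r G a \<subseteq> reach r G' a"
  using assms by (induction r) (auto simp: reach_Suc)

lemma reach_trans: "b \<in> reach j G a \<Longrightarrow> c \<in> reach k G b \<Longrightarrow> c \<in> reach (j + k) G a"
proof (induction k arbitrary: c)
  case (Suc k)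
  then show ?case by (auto simp: reach_Suc)
qed auto

lemma reach_sym:
  assumes sym: "\<And>x y. G x y \<Longrightarrow> G y x"
  shows "b \<in> reach r G a \<Longrightarrow> a \<in> reach r G b"
proof (induction r arbitrary: b)
  case (Suc r)
  show ?case
  proof (cases "b \<in> reach r G a")
    case True then show ?thesis using Suc.IH by (auto simp: reach_Suc)
  next
    case False
    then obtain x where x: "x \<in> reach r G a" "G x b" using Suc.prems by (auto simp: reach_Suc)
    have "x \<in> reach 1 G b" using sym[OF x(2)] by (auto simp: reach_Suc)
    then show ?thesis using reach_trans[of x 1 G b a r] Suc.IH[OF x(1)] by simp
  qed
qed auto

lemma reach_closed_subset:
  assumes "a \<in> S" "\<And>x y. x \<in> S \<Longrightarrow> G x y \<Longrightarrow> y \<in> S"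
  shows "reach r G a \<subseteq> S"
  using assms by (induction r) (auto simp: reach_Suc)

text \<open>As long as a ball is not closed under \<open>G\<close>, increasing the radius adds an
  element, so a ball of radius \<open>j\<close> that is not closed has more than \<open>j\<close>
  elements. For a symmetric relation a ball of radius \<open>k\<close> with at most \<open>k\<close>
  elements is thus a whole component, and the same \<open>k\<close> can serve as radius and as
  component size.\<close>

lemma reach_small_closed:
  assumes "card (reach k G a) \<le> k" "finite (reach k G a)" "x \<in> reach k G a" "G x y"
  shows "y \<in> reach k G a"
proof -
  have *: "(\<forall>x\<in>reach j G a. \<forall>y. G x y \<longrightarrow> y \<in> reach j G a) \<or> j < card (reach j G a)"
    if "finite (reach j G a)" for j
    using that
  proof (induction j)
    case (Suc j)
    have f: "finite (reach j G a)" using Suc.prems reach_mono[of j "Suc j" G a] finite_subset by auto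
    from Suc.IH[OF f] show ?case
    proof
      assume cl: "\<forall>x\<in>reach j G a. \<forall>y. G x y \<longrightarrow> y \<in> reach j G a"
      then have "reach (Suc j) G a = reach j G a" by (auto simp: reach_Suc)
      then show ?thesis using cl by simp
    next
      assume c: "j < card (reach j G a)"
      show ?thesis
      proof (cases "reach (Suc j) G a = reach j G a")
        case True
        then have "\<forall>x\<in>reach j G a. \<forall>y. G x y \<longrightarrow> y \<in> reach j G a" by (auto simp: reach_Suc)
        then show ?thesis using True by simp
      next
        case False
        then have "reach j G a \<subset> reach (Suc j) G a" using reach_mono[of j "Suc j" G a] by auto
        then have "card (reach j G a) < card (reach (Suc j) G a)" using Suc.prems psubset_card_mono by blast
        then show ?thesis using c by simp
      qed
    qed
  qed simp
  then show ?thesis using assms by (meson not_le)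
qed

lemma reach_card_le:
  assumes "\<And>x. x \<in> S \<Longrightarrow> finite {y. G x y} \<and> card {y. G x y} \<le> m"
    and "a \<in> S" "\<And>x y. x \<in> S \<Longrightarrow> G x y \<Longrightarrow> y \<in> S"
  shows "finite (reach r G a) \<and> card (reach r G a) \<le> (1 + m) ^ r"
proof (induction r)
  case (Suc r)
  have S: "reach r G a \<subseteq> S" using reach_closed_subset[of a S G] assms by blast
  have eq: "reach (Suc r) G a = reach r G a \<union> (\<Union>x\<in>reach r G a. {y. G x y})"
    by (auto simp: reach_Suc)
  have f: "finite (\<Union>x\<in>reach r G a. {y. G x y})" using Suc assms(1) S by blast
  have "card (\<Union>x\<in>reach r G a. {y. G x y}) \<le> (\<Sum>x\<in>reach r G a. card {y. G x y})"
    by (rule card_UN_le) (use Suc in simp)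
  also have "\<dots> \<le> (\<Sum>x\<in>reach r G a. m)" by (rule sum_mono) (use assms(1) S in blast)
  finally have "card (reach (Suc r) G a) \<le> card (reach r G a) + card (reach r G a) * m"
    unfolding eq using card_Un_le[of "reach r G a" "\<Union>x\<in>reach r G a. {y. G x y}"] by simp
  also have "\<dots> = card (reach r G a) * (1 + m)" by (simp add: algebra_simps)
  also have "\<dots> \<le> (1 + m) ^ r * (1 + m)" using Suc by (intro mult_right_mono) auto
  finally show ?case using f Suc eq by (simp add: mult.commute)
qed simp

text \<open>Walks are transported one edge at a time, so edges have to correspond only at starting
  points in \<open>Y\<close>. The last edge of a walk of length \<open>j\<close> starts within
  radius \<open>j - 1\<close>, hence the condition on balls of radius below
  \<open>j\<close>.\<close>

lemma reach_transport:
  assumes inj: "\<And>x b. x \<in> Y \<Longrightarrow> G x b \<Longrightarrow> G' (f x) (f b)"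
    and surj: "\<And>x b'. x \<in> Y \<Longrightarrow> G' (f x) b' \<Longrightarrow> \<exists>b. b' = f b \<and> G x b"
    and Y: "\<And>i. i < j \<Longrightarrow> reach i G u \<subseteq> Y"
  shows "reach j G' (f u) = f ` reach j G u"
  using Y
proof (induction j)
  case (Suc j)
  have IH: "reach j G' (f u) = f ` reach j G u" using Suc by simp
  have Y: "reach j G u \<subseteq> Y" using Suc.prems by simp
  show ?case unfolding reach_Suc IH
  proof (intro equalityI subsetI)
    fix b' assume "b' \<in> f ` reach j G u \<union> {b. \<exists>x\<in>f ` reach j G u. G' x b}"
    then show "b' \<in> f ` (reach j G u \<union> {b. \<exists>x\<in>reach j G u. G x b})"
      using surj Y by fastforce
  next
    fix b' assume "b' \<in> f ` (reach j G u \<union> {b. \<exists>x\<in>reach j G u. G x b})"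
    then show "b' \<in> f ` reach j G u \<union> {b. \<exists>x\<in>f ` reach j G u. G' x b}"
      using inj Y by blast
  qed
qed simp

section \<open>Gaifman balls in databases of bounded degree and their isomorphisms\<close>

lemma gadj_sym: "gadj D a b \<Longrightarrow> gadj D b a"
  by (auto simp: gadj_def)

text \<open>\<open>same_rtype\<close> with its witness made explicit, so that one and the same map
  can be followed into smaller balls, coloured components and carved databases.\<close>

definition ball_iso :: "nat \<Rightarrow> 'r db \<Rightarrow> nat \<Rightarrow> 'r db \<Rightarrow> nat \<Rightarrow> (nat \<Rightarrow> nat) \<Rightarrow> bool" where
  "ball_iso r D a D' a' f \<longleftrightarrow> bij_betw f (nbhd r D a) (nbhd r D' a') \<and> f a = a' \<and>
     (\<forall>R t. set t \<subseteq> nbhd r D a \<longrightarrow> (t \<in> db_rel D R \<longleftrightarrow> map f t \<in> db_rel D' R))"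

lemma same_rtype_iff: "same_rtype r D a D' a' \<longleftrightarrow> (\<exists>f. ball_iso r D a D' a' f)"
  by (simp add: same_rtype_def ball_iso_def)

definition sub_db :: "'r db \<Rightarrow> 'r db \<Rightarrow> bool" where
  "sub_db E D \<longleftrightarrow> db_size E = db_size D \<and> (\<forall>R. db_rel E R \<subseteq> db_rel D R)"

lemma sub_db_refl [simp]: "sub_db D D" by (simp add: sub_db_def)

lemma sub_db_trans: "sub_db E D \<Longrightarrow> sub_db D C \<Longrightarrow> sub_db E C"
  unfolding sub_db_def by fastforce

definition tuples :: "'r db \<Rightarrow> ('r \<times> nat list) set" where
  "tuples D = {(R, t). t \<in> db_rel D R}"

locale bounded_schema =
  fixes \<sigma> :: "'r set" and ar :: "'r \<Rightarrow> nat" and d :: nat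
  assumes schema: "schema \<sigma> ar"
begin

definition bdb :: "'r db \<Rightarrow> bool" where
  "bdb D \<longleftrightarrow> wf_db \<sigma> ar D \<and> db_degree_le D d"

text \<open>A sum rather than a maximum, so that the empty schema needs no separate
  treatment.\<close>

definition amax :: nat where "amax = (\<Sum>R\<in>\<sigma>. ar R)"

lemma finite_sigma: "finite \<sigma>" using schema by (simp add: schema_def)

lemma ar_le_amax: "R \<in> \<sigma> \<Longrightarrow> ar R \<le> amax"
  unfolding amax_def using finite_sigma by (simp add: member_le_sum)

lemma bdb_wf: "bdb D \<Longrightarrow> wf_db \<sigma> ar D" by (simp add: bdb_def)

lemma bdb_tupleD:
  assumes "bdb D" "t \<in> db_rel D R"
  shows "R \<in> \<sigma>" "length t = ar R" "set t \<subseteq> {0..<db_size D}" "set t \<noteq> {}" "card (set t) \<le> amax"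
proof -
  show 1: "R \<in> \<sigma>" "length t = ar R" "set t \<subseteq> {0..<db_size D}"
    using assms by (auto simp: bdb_def wf_db_def)
  then have "length t \<ge> 1" using schema by (auto simp: schema_def)
  then show "set t \<noteq> {}" by auto
  show "card (set t) \<le> amax" using 1 ar_le_amax card_length[of t] by (metis le_trans)
qed

lemma bdb_less: "bdb D \<Longrightarrow> t \<in> db_rel D R \<Longrightarrow> a \<in> set t \<Longrightarrow> a < db_size D"
  using bdb_tupleD(3) by fastforce

lemma finite_tuples: assumes "bdb D" shows "finite (tuples D)"
proof (rule finite_subset)
  show "tuples D \<subseteq> Sigma \<sigma> (\<lambda>R. {t. set t \<subseteq> {0..<db_size D} \<and> length t = ar R})"
    using bdb_tupleD(1-3)[OF assms] bdb_less[OF assms] by (auto simp: tuples_def)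
  show "finite (Sigma \<sigma> (\<lambda>R. {t. set t \<subseteq> {0..<db_size D} \<and> length t = ar R}))"
    using finite_sigma finite_lists_length_eq by blast
qed

lemma bdb_sub: assumes "bdb D" "sub_db E D" shows "bdb E"
proof -
  have "elem_degree E a \<le> elem_degree D a" for a
    unfolding elem_degree_def
  proof (rule card_mono)
    show "finite {(R, t). t \<in> db_rel D R \<and> a \<in> set t}"
      by (rule finite_subset[OF _ finite_tuples[OF assms(1)]]) (auto simp: tuples_def)
  qed (use assms(2) in \<open>auto simp: sub_db_def\<close>)
  then have "db_degree_le E d"
    using assms unfolding bdb_def db_degree_le_def sub_db_def by (metis le_trans)
  moreover have "wf_db \<sigma> ar E"
    using assms unfolding bdb_def wf_db_def sub_db_def by (metis subset_empty subsetD)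
  ultimately show ?thesis by (simp add: bdb_def)
qed

lemma gadj_less: "bdb D \<Longrightarrow> gadj D a b \<Longrightarrow> a < db_size D \<and> b < db_size D"
  unfolding gadj_def using bdb_less by blast

lemma nbhd_reach: assumes "bdb D" "a < db_size D" shows "nbhd r D a = reach r (gadj D) a"
proof -
  have "reach r (gadj D) a \<subseteq> {..<db_size D}"
    by (rule reach_closed_subset) (use assms gadj_less in auto)
  then show ?thesis by (auto simp: nbhd_def reach_def)
qed

lemma nbhd_less: "x \<in> nbhd r D a \<Longrightarrow> x < db_size D" by (simp add: nbhd_def)

lemma finite_nbhd [simp]: "finite (nbhd r D a)"
  by (rule finite_subset[of _ "{..<db_size D}"]) (auto simp: nbhd_def)

lemma tuples_at:
  assumes "bdb D" "a < db_size D"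
  shows "finite {(R, t). t \<in> db_rel D R \<and> a \<in> set t}" "card {(R, t). t \<in> db_rel D R \<and> a \<in> set t} \<le> d"
  using assms finite_subset[OF _ finite_tuples[OF assms(1)], of "{(R, t). t \<in> db_rel D R \<and> a \<in> set t}"]
  by (auto simp: tuples_def bdb_def db_degree_le_def elem_degree_def)

lemma gadj_card:
  assumes "bdb D" "a < db_size D"
  shows "finite {b. gadj D a b} \<and> card {b. gadj D a b} \<le> d * amax"
proof -
  let ?T = "{(R, t). t \<in> db_rel D R \<and> a \<in> set t}"
  have sub: "{b. gadj D a b} \<subseteq> (\<Union>(R,t)\<in>?T. set t)" by (auto simp: gadj_def)
  have fin: "finite (\<Union>(R,t)\<in>?T. set t)" using tuples_at[OF assms] by auto
  have "card {b. gadj D a b} \<le> card (\<Union>(R,t)\<in>?T. set t)" by (rule card_mono[OF fin sub])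
  also have "\<dots> \<le> (\<Sum>(R,t)\<in>?T. card (set t))"
    using card_UN_le[OF tuples_at(1)[OF assms], of "\<lambda>(R,t). set t"] by (simp add: case_prod_unfold)
  also have "\<dots> \<le> (\<Sum>(R,t)\<in>?T. amax)" by (rule sum_mono) (use bdb_tupleD(5)[OF assms(1)] in auto)
  also have "\<dots> = card ?T * amax" by (simp add: case_prod_unfold)
  also have "\<dots> \<le> d * amax" using tuples_at(2)[OF assms] by (simp add: mult_right_mono)
  finally show ?thesis using finite_subset[OF sub fin] by simp
qed

definition ballmax :: "nat \<Rightarrow> nat" where "ballmax r = (1 + d * amax) ^ r"

lemma card_nbhd_le: assumes "bdb D" "a < db_size D" shows "card (nbhd r D a) \<le> ballmax r"
  unfolding nbhd_reach[OF assms] ballmax_def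
  using reach_card_le[of "{..<db_size D}" "gadj D" "d * amax" a r] gadj_card[OF assms(1)] gadj_less[OF assms(1)] assms(2)
  by auto

lemma nbhd_sym:
  assumes "bdb D" "a < db_size D" "b \<in> nbhd r D a" shows "a \<in> nbhd r D b"
proof -
  have "b < db_size D" using assms(3) nbhd_less by blast
  then show ?thesis using reach_sym[of "gadj D" b r a] gadj_sym assms nbhd_reach by metis
qed

lemma nbhd_trans:
  assumes "bdb D" "a < db_size D" "b \<in> nbhd j D a" "c \<in> nbhd k D b" "j + k \<le> r"
  shows "c \<in> nbhd r D a"
proof -
  have "b < db_size D" using assms(3) nbhd_less by blast
  then have "c \<in> reach (j + k) (gadj D) a" using assms nbhd_reach reach_trans by metis
  then show ?thesis unfolding nbhd_reach[OF assms(1,2)] using reach_mono[OF assms(5), of "gadj D" a] by blast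
qed

lemma nbhd_mono: "r \<le> r' \<Longrightarrow> nbhd r D a \<subseteq> nbhd r' D a"
  by (auto simp: nbhd_def intro: le_trans)

lemma nbhd_self [simp]: "a < db_size D \<Longrightarrow> a \<in> nbhd r D a"
  unfolding nbhd_def by (auto intro!: exI[of _ 0])

lemma tuple_in_nbhd:
  assumes "bdb D" "a < db_size D" "t \<in> db_rel D R" "x \<in> set t" "x \<in> nbhd r D a" "Suc r \<le> r'"
  shows "set t \<subseteq> nbhd r' D a"
proof
  fix y assume y: "y \<in> set t"
  have "y \<in> reach (Suc r) (gadj D) a"
  proof (cases "x = y")
    case True
    then show ?thesis using assms(5) nbhd_reach[OF assms(1,2)] by (simp add: reach_Suc)
  next
    case False
    then have "gadj D x y" using assms y by (auto simp: gadj_def)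
    then show ?thesis using assms(5) nbhd_reach[OF assms(1,2)] by (auto simp: reach_Suc)
  qed
  then show "y \<in> nbhd r' D a" unfolding nbhd_reach[OF assms(1,2)] using reach_mono[OF assms(6), of "gadj D" a] by blast
qed

lemma nbhd_sub: assumes "bdb D" "sub_db E D" "a < db_size D" shows "nbhd r E a \<subseteq> nbhd r D a"
proof -
  have "bdb E" "a < db_size E" using assms bdb_sub by (auto simp: sub_db_def)
  moreover have "reach r (gadj E) a \<subseteq> reach r (gadj D) a"
    by (rule reach_mono_rel) (use assms(2) in \<open>auto simp: gadj_def sub_db_def\<close>)
  ultimately show ?thesis using assms nbhd_reach by metis
qed

lemma ball_iso_refl: "ball_iso r D a D a id"
  by (simp add: ball_iso_def)

lemma ball_iso_sym:
  assumes "ball_iso r D a D' a' f" "a < db_size D"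
  shows "ball_iso r D' a' D a (the_inv_into (nbhd r D a) f)"
proof -
  let ?g = "the_inv_into (nbhd r D a) f"
  have b: "bij_betw f (nbhd r D a) (nbhd r D' a')" and fa: "f a = a'" using assms by (auto simp: ball_iso_def)
  have g: "bij_betw ?g (nbhd r D' a') (nbhd r D a)" using b bij_betw_the_inv_into by blast
  have "?g a' = a" using fa b assms(2) by (metis bij_betw_def nbhd_self the_inv_into_f_f)
  moreover have "t \<in> db_rel D' R \<longleftrightarrow> map ?g t \<in> db_rel D R" if "set t \<subseteq> nbhd r D' a'" for R t
  proof -
    have "map f (map ?g t) = t" using that b
      by (simp add: bij_betw_def f_the_inv_into_f map_idI subset_iff)
    moreover have "set (map ?g t) \<subseteq> nbhd r D a" using that g by (auto simp: bij_betw_def)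
    ultimately show ?thesis using assms(1) unfolding ball_iso_def by metis
  qed
  ultimately show ?thesis using g by (simp add: ball_iso_def)
qed

lemma ball_iso_trans:
  assumes "ball_iso r D a D' a' f" "ball_iso r D' a' D'' a'' g"
  shows "ball_iso r D a D'' a'' (g \<circ> f)"
proof -
  have "t \<in> db_rel D R \<longleftrightarrow> map (g \<circ> f) t \<in> db_rel D'' R" if "set t \<subseteq> nbhd r D a" for R t
  proof -
    have "set (map f t) \<subseteq> nbhd r D' a'" using that assms(1) by (auto simp: ball_iso_def bij_betw_def)
    then show ?thesis using assms that unfolding ball_iso_def by (metis map_map)
  qed
  then show ?thesis using assms by (auto simp: ball_iso_def intro: bij_betw_trans)
qed

text \<open>\<open>rtype\<close> is a full class of \<open>same_rtype\<close> among well-formed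
  pointed databases. As \<open>same_rtype\<close> is an equivalence relation and \<open>D'\<close>
  is well-formed, the class of \<open>D'\<close> contains its own representative, which gives the
  forward direction.\<close>

lemma rtype_eq_iff:
  assumes "bdb D" "a < db_size D" "bdb D'" "a' < db_size D'"
  shows "rtype \<sigma> ar r D a = rtype \<sigma> ar r D' a' \<longleftrightarrow> same_rtype r D a D' a'"
proof
  assume eq: "rtype \<sigma> ar r D a = rtype \<sigma> ar r D' a'"
  have "(D', a') \<in> rtype \<sigma> ar r D' a'"
    using assms ball_iso_refl bdb_wf by (auto simp: rtype_def same_rtype_iff)
  then show "same_rtype r D a D' a'" using eq[symmetric] by (auto simp: rtype_def)
next
  assume "same_rtype r D a D' a'"
  then obtain f where f: "ball_iso r D a D' a' f" by (auto simp: same_rtype_iff)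
  have "same_rtype r D a D'' a'' \<longleftrightarrow> same_rtype r D' a' D'' a''" for D'' a''
    using f ball_iso_sym[OF f assms(2)] ball_iso_trans unfolding same_rtype_iff by metis
  then show "rtype \<sigma> ar r D a = rtype \<sigma> ar r D' a'" by (simp add: rtype_def)
qed

text \<open>An isomorphism of balls is only known to be an isomorphism of databases away from the
  boundary sphere, hence the slack in the radii below.\<close>

lemma ball_iso_nbhd_centre:
  assumes D: "bdb D" "a < db_size D" "bdb D'" "a' < db_size D'" and f: "ball_iso r D a D' a' f" and "j \<le> r"
  shows "nbhd j D' a' = f ` nbhd j D a"
  using \<open>j \<le> r\<close>
proof (induction j)
  case 0
  then show ?case using f nbhd_reach[OF D(1,2), of 0] nbhd_reach[OF D(3,4), of 0] by (simp add: ball_iso_def)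
next
  case (Suc j)
  have IH: "nbhd j D' a' = f ` nbhd j D a" using Suc by simp
  have bij: "bij_betw f (nbhd r D a) (nbhd r D' a')" using f by (simp add: ball_iso_def)
  have iff: "t \<in> db_rel D R \<longleftrightarrow> map f t \<in> db_rel D' R" if "set t \<subseteq> nbhd r D a" for R t
    using f that by (simp add: ball_iso_def)
  have N: "nbhd (Suc j) D b = nbhd j D b \<union> {y. \<exists>x\<in>nbhd j D b. gadj D x y}" if "bdb D" "b < db_size D" for D b
    using nbhd_reach[OF that] by (simp add: reach_Suc)
  show ?case
  proof (intro equalityI subsetI)
    fix y' assume y': "y' \<in> nbhd (Suc j) D' a'"
    show "y' \<in> f ` nbhd (Suc j) D a"
    proof (cases "y' \<in> nbhd j D' a'")
      case True then show ?thesis using IH N[OF D(1,2)] by auto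
    next
      case False
      then obtain x where x: "x \<in> nbhd j D a" "gadj D' (f x) y'" using y' N[OF D(3,4)] IH by auto
      then obtain R t' where t': "t' \<in> db_rel D' R" "f x \<in> set t'" "y' \<in> set t'" "f x \<noteq> y'"
        by (auto simp: gadj_def)
      have "set t' \<subseteq> nbhd r D' a'"
        using tuple_in_nbhd[OF D(3,4) t'(1,2)] x IH Suc.prems by blast
      then have "set t' \<subseteq> f ` nbhd r D a" using bij by (simp add: bij_betw_def)
      then have "t' \<in> lists (f ` nbhd r D a)" by (simp add: in_listsI subset_iff)
      then obtain t where t: "t' = map f t" "set t \<subseteq> nbhd r D a"
        by (auto simp: lists_image)
      have xr: "x \<in> nbhd r D a" using x(1) nbhd_mono[of j r] Suc.prems by auto
      have "x \<in> set t" using t'(2) t xr bij by (metis bij_betw_def inj_on_image_mem_iff list.set_map)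
      moreover obtain y where "y \<in> set t" "y' = f y" using t'(3) t by auto
      ultimately have "gadj D x y" using iff[OF t(2)] t t' by (auto simp: gadj_def)
      then show ?thesis using \<open>y' = f y\<close> x N[OF D(1,2)] by auto
    qed
  next
    fix y' assume "y' \<in> f ` nbhd (Suc j) D a"
    then obtain y where y: "y \<in> nbhd (Suc j) D a" "y' = f y" by auto
    show "y' \<in> nbhd (Suc j) D' a'"
    proof (cases "y \<in> nbhd j D a")
      case True then show ?thesis using IH N[OF D(3,4)] y by auto
    next
      case False
      then obtain x where x: "x \<in> nbhd j D a" "gadj D x y" using y N[OF D(1,2)] by auto
      then obtain R t where t: "t \<in> db_rel D R" "x \<in> set t" "y \<in> set t" "x \<noteq> y"
        by (auto simp: gadj_def)
      have s: "set t \<subseteq> nbhd r D a"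
        using tuple_in_nbhd[OF D(1,2) t(1,2)] x Suc.prems by blast
      then have "f x \<noteq> f y" using t bij by (meson bij_betw_def inj_on_eq_iff subsetD)
      then have "gadj D' (f x) (f y)" using iff[OF s] t by (auto simp: gadj_def intro!: exI[of _ R] exI[of _ "map f t"])
      then show ?thesis using y x IH N[OF D(3,4)] by auto
    qed
  qed
qed

text \<open>The condition \<open>Suc j \<le> r\<close> places the whole tuple inside the ball of
  \<open>D'\<close>, where every element has a preimage. A tuple that meets only the boundary sphere
  might leave the ball.\<close>

lemma ball_iso_tuple_back:
  assumes D: "bdb D" "a < db_size D" "bdb D'" "a' < db_size D'" and f: "ball_iso r D a D' a' f"
    and x: "x \<in> nbhd j D a" "Suc j \<le> r" and t': "t' \<in> db_rel D' R" "f x \<in> set t'"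
  obtains t where "t' = map f t" "t \<in> db_rel D R" "x \<in> set t" "set t \<subseteq> nbhd r D a"
proof -
  have bij: "bij_betw f (nbhd r D a) (nbhd r D' a')" using f by (simp add: ball_iso_def)
  have "f x \<in> nbhd j D' a'" using ball_iso_nbhd_centre[OF D f, of j] x by auto
  then have "set t' \<subseteq> nbhd r D' a'" using tuple_in_nbhd[OF D(3,4) t'] x(2) by blast
  then have "set t' \<subseteq> f ` nbhd r D a" using bij by (simp add: bij_betw_def)
  then have "t' \<in> lists (f ` nbhd r D a)" by (simp add: in_listsI subset_iff)
  then obtain t where t: "t' = map f t" "set t \<subseteq> nbhd r D a"
    by (auto simp: lists_image)
  have "x \<in> nbhd r D a" using x nbhd_mono[of j r] by auto
  then have "x \<in> set t" using t' t bij by (metis bij_betw_def inj_on_image_mem_iff list.set_map)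
  moreover have "t \<in> db_rel D R" using f t t' by (simp add: ball_iso_def)
  ultimately show ?thesis using that t by blast
qed

lemma ball_iso_tuple_forth:
  assumes D: "bdb D" "a < db_size D" and f: "ball_iso r D a D' a' f"
    and x: "x \<in> nbhd j D a" "Suc j \<le> r" and t: "t \<in> db_rel D R" "x \<in> set t"
  shows "map f t \<in> db_rel D' R" "set t \<subseteq> nbhd r D a"
  using tuple_in_nbhd[OF D t x] f t by (auto simp: ball_iso_def)

lemma ball_iso_gadj:
  assumes D: "bdb D" "a < db_size D" "bdb D'" "a' < db_size D'" and f: "ball_iso r D a D' a' f"
    and x: "x \<in> nbhd j D a" "Suc j \<le> r"
  shows "gadj D x b \<Longrightarrow> gadj D' (f x) (f b) \<and> b \<in> nbhd r D a"
    and "gadj D' (f x) b' \<Longrightarrow> \<exists>b. b' = f b \<and> gadj D x b \<and> b \<in> nbhd r D a"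
proof -
  have bij: "bij_betw f (nbhd r D a) (nbhd r D' a')" using f by (simp add: ball_iso_def)
  show "gadj D' (f x) (f b) \<and> b \<in> nbhd r D a" if xb: "gadj D x b"
  proof -
    obtain R t where t: "t \<in> db_rel D R" "x \<in> set t" "b \<in> set t" "x \<noteq> b" using xb by (auto simp: gadj_def)
    have s: "map f t \<in> db_rel D' R" "set t \<subseteq> nbhd r D a"
      using ball_iso_tuple_forth[OF D(1,2) f x t(1,2)] by auto
    then have "f x \<noteq> f b" using t bij by (meson bij_betw_def inj_on_eq_iff subsetD)
    then show ?thesis using s t by (auto simp: gadj_def intro!: exI[of _ R] exI[of _ "map f t"])
  qed
  show "\<exists>b. b' = f b \<and> gadj D x b \<and> b \<in> nbhd r D a" if xb: "gadj D' (f x) b'"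
  proof -
    obtain R t' where t': "t' \<in> db_rel D' R" "f x \<in> set t'" "b' \<in> set t'" "f x \<noteq> b'"
      using xb by (auto simp: gadj_def)
    obtain t where "t' = map f t" "t \<in> db_rel D R" "x \<in> set t" "set t \<subseteq> nbhd r D a"
      using ball_iso_tuple_back[OF D f x t'(1,2)] by blast
    then show ?thesis using t' by (auto simp: gadj_def)
  qed
qed

lemma ball_iso_nbhd:
  assumes D: "bdb D" "a < db_size D" "bdb D'" "a' < db_size D'" and f: "ball_iso r D a D' a' f"
    and u: "u \<in> nbhd j D a" "j + k \<le> r"
  shows "nbhd k D' (f u) = f ` nbhd k D u"
proof -
  have un: "u < db_size D" using u nbhd_less by blast
  have fu: "f u \<in> nbhd j D' a'" using ball_iso_nbhd_centre[OF D f, of j] u by auto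
  have "reach k (gadj D') (f u) = f ` reach k (gadj D) u"
  proof (cases k)
    case (Suc k')
    show ?thesis
    proof (rule reach_transport[where Y = "nbhd (j + k') D a"])
      fix i assume "i < k"
      then have "i \<le> k'" using Suc by simp
      have "reach i (gadj D) u = nbhd i D u" using nbhd_reach[OF D(1) un] by simp
      then show "reach i (gadj D) u \<subseteq> nbhd (j + k') D a"
        using nbhd_trans[OF D(1,2) u(1), of _ i "j + k'"] \<open>i \<le> k'\<close> by auto
    next
      fix x b assume "x \<in> nbhd (j + k') D a" "gadj D x b"
      then show "gadj D' (f x) (f b)" using ball_iso_gadj(1)[OF D f] u Suc by (metis add_Suc_right)
    next
      fix x b' assume "x \<in> nbhd (j + k') D a" "gadj D' (f x) b'"
      then show "\<exists>b. b' = f b \<and> gadj D x b" using ball_iso_gadj(2)[OF D f] u Suc by (metis add_Suc_right)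
    qed
  qed simp
  then show ?thesis using nbhd_reach D un fu nbhd_less by metis
qed

end

section \<open>Carving small components\<close>

locale carving = bounded_schema \<sigma> ar d for \<sigma> :: "'r set" and ar :: "'r \<Rightarrow> nat" and d :: nat +
  fixes k :: nat and \<delta> :: real
begin

definition colour_adj :: "'r db \<Rightarrow> nat set \<Rightarrow> nat \<Rightarrow> nat \<Rightarrow> bool" where
  "colour_adj D c x y \<longleftrightarrow> gadj D x y \<and> x \<in> c \<and> y \<in> c"

text \<open>The walk stops at radius \<open>k\<close>, which keeps carving local. By
  \<open>reach_small_closed\<close> this is the whole coloured component as soon as it has at most
  \<open>k\<close> elements, and \<open>carvable\<close> admits no other case.\<close>

definition cell :: "'r db \<Rightarrow> nat set \<Rightarrow> nat \<Rightarrow> nat set" where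
  "cell D c v = reach k (colour_adj D c) v"

definition boundary :: "'r db \<Rightarrow> nat set \<Rightarrow> ('r \<times> nat list) set" where
  "boundary D S = {(R, t). t \<in> db_rel D R \<and> set t \<inter> S \<noteq> {} \<and> \<not> set t \<subseteq> S}"

text \<open>The condition \<open>k < card (nbhd k D v)\<close> excludes elements whose component is
  already small, so that over all rounds an element is charged for a cut at most once.\<close>

definition carvable :: "'r db \<Rightarrow> nat set \<Rightarrow> nat \<Rightarrow> bool" where
  "carvable D c v \<longleftrightarrow> v \<in> c \<and> v < db_size D \<and> k < card (nbhd k D v) \<and> card (cell D c v) \<le> k \<and>
     real (card (boundary D (cell D c v))) \<le> \<delta> * real (card (cell D c v))"

definition carve :: "'r db \<Rightarrow> nat set \<Rightarrow> 'r db" where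
  "carve D c = DB (db_size D)
     (\<lambda>R. {t \<in> db_rel D R. \<forall>v\<in>set t. carvable D c v \<longrightarrow> set t \<subseteq> cell D c v})"

text \<open>By \<open>reach_small_closed\<close> these are exactly the elements of components with more than
  \<open>k\<close> elements.\<close>
definition undone :: "'r db \<Rightarrow> nat set" where
  "undone D = {v. v < db_size D \<and> k < card (nbhd k D v)}"

lemma finite_undone [simp]: "finite (undone D)"
  by (rule finite_subset[of _ "{..<db_size D}"]) (auto simp: undone_def)

lemma db_size_carve [simp]: "db_size (carve D c) = db_size D"
  by (simp add: carve_def)

lemma carve_sub: "sub_db (carve D c) D"
  by (auto simp: sub_db_def carve_def)

lemma carve_rel: "t \<in> db_rel (carve D c) R \<longleftrightarrow>
    t \<in> db_rel D R \<and> (\<forall>v\<in>set t. carvable D c v \<longrightarrow> set t \<subseteq> cell D c v)"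
  by (simp add: carve_def)

lemma bdb_carve: "bdb D \<Longrightarrow> bdb (carve D c)"
  using bdb_sub carve_sub by blast

lemma colour_adj_sym: "colour_adj D c x y \<Longrightarrow> colour_adj D c y x"
  by (auto simp: colour_adj_def gadj_sym)

lemma cell_subset_nbhd: "bdb D \<Longrightarrow> v < db_size D \<Longrightarrow> cell D c v \<subseteq> nbhd k D v"
  unfolding cell_def using nbhd_reach[of D v k] reach_mono_rel[of "colour_adj D c" "gadj D" k v]
  by (auto simp: colour_adj_def)

lemma finite_cell: "bdb D \<Longrightarrow> v < db_size D \<Longrightarrow> finite (cell D c v)"
  using cell_subset_nbhd finite_nbhd finite_subset by metis

lemma cell_self [simp]: "v \<in> cell D c v"
  by (simp add: cell_def)

lemma cell_subset_colour: "v \<in> c \<Longrightarrow> cell D c v \<subseteq> c"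
  unfolding cell_def by (rule reach_closed_subset) (auto simp: colour_adj_def)

text \<open>The small ball is closed, so it contains the ball around each of its points. That ball
  is then small and closed as well, and by symmetry it contains the first one.\<close>

lemma small_reach_eq:
  assumes sym: "\<And>x y. G x y \<Longrightarrow> G y x" and fin: "finite (reach k G v)" and card: "card (reach k G v) \<le> k"
    and u: "u \<in> reach k G v"
  shows "reach k G u = reach k G v"
proof -
  have cl: "y \<in> reach k G v" if "x \<in> reach k G v" "G x y" for x y
    using reach_small_closed[OF card fin that] .
  have 1: "reach k G u \<subseteq> reach k G v"
    by (rule reach_closed_subset[OF u]) (use cl in blast)
  have fin': "finite (reach k G u)" and card': "card (reach k G u) \<le> k"
    using 1 fin card finite_subset card_mono le_trans by (metis, metis)
  have "reach k G v \<subseteq> reach k G u"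
    by (rule reach_closed_subset[OF reach_sym[OF sym u]]) (use reach_small_closed[OF card' fin'] in blast)+
  then show ?thesis using 1 by blast
qed

text \<open>Makes the carvable cells a partition of the carvable elements. The element
  \<open>u\<close> is undone because its ball would otherwise be a small component containing
  \<open>v\<close>.\<close>

lemma carvable_cell:
  assumes D: "bdb D" and v: "carvable D c v" and u: "u \<in> cell D c v"
  shows "cell D c u = cell D c v" "carvable D c u"
proof -
  have vn: "v < db_size D" and vk: "k < card (nbhd k D v)" and vc: "card (cell D c v) \<le> k" and vin: "v \<in> c"
    using v by (auto simp: carvable_def)
  show eq: "cell D c u = cell D c v"
    unfolding cell_def
    by (rule small_reach_eq) (use colour_adj_sym finite_cell[OF D vn] vc u in \<open>auto simp: cell_def\<close>)
  have un: "u \<in> nbhd k D v" using cell_subset_nbhd[OF D vn] u by blast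
  then have ul: "u < db_size D" using nbhd_less by blast
  have "k < card (nbhd k D u)"
  proof (rule ccontr)
    assume a: "\<not> k < card (nbhd k D u)"
    have vu: "v \<in> reach k (gadj D) u"
      using reach_sym[of "gadj D" u k v] gadj_sym un nbhd_reach[OF D vn] by metis
    have "reach k (gadj D) v = reach k (gadj D) u"
      by (rule small_reach_eq[OF gadj_sym _ _ vu]) (use a nbhd_reach[OF D ul] finite_nbhd[of k D u] in auto)
    then show False using a vk nbhd_reach[OF D ul] nbhd_reach[OF D vn] by simp
  qed
  then show "carvable D c u"
    using v eq ul cell_subset_colour[OF vin] u by (auto simp: carvable_def)
qed

lemma carved_done:
  assumes D: "bdb D" and v: "carvable D c v" shows "v \<notin> undone (carve D c)"
proof -
  have vn: "v < db_size D" and vc: "card (cell D c v) \<le> k" using v by (auto simp: carvable_def)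
  have "reach k (gadj (carve D c)) v \<subseteq> cell D c v"
  proof (rule reach_closed_subset)
    fix x y assume x: "x \<in> cell D c v" and "gadj (carve D c) x y"
    then obtain R t where t: "t \<in> db_rel (carve D c) R" "x \<in> set t" "y \<in> set t" by (auto simp: gadj_def)
    then have "set t \<subseteq> cell D c x" using carvable_cell(2)[OF D v x] by (auto simp: carve_rel)
    then show "y \<in> cell D c v" using carvable_cell(1)[OF D v x] t by blast
  qed simp
  then have "card (nbhd k (carve D c) v) \<le> card (cell D c v)"
    using nbhd_reach[OF bdb_carve[OF D], of v c k] vn card_mono[OF finite_cell[OF D vn]] by simp
  then show ?thesis using vc by (simp add: undone_def)
qed

lemma undone_sub: assumes "bdb D" "sub_db E D" shows "undone E \<subseteq> undone D"
proof
  fix v assume v: "v \<in> undone E"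
  then have vn: "v < db_size D" using assms by (auto simp: undone_def sub_db_def)
  have "card (nbhd k E v) \<le> card (nbhd k D v)"
    by (rule card_mono) (use nbhd_sub[OF assms vn] in auto)
  then show "v \<in> undone D" using v vn by (auto simp: undone_def)
qed

text \<open>Removed tuples lie on the boundaries of carvable cells. The cells are disjoint, a cell
  accounts for at most \<open>\<delta>\<close> tuples per element, and all its elements change from
  undone to done. The number of undone elements thus acts as a potential, and the bounds of
  successive rounds telescope.\<close>

lemma carve_cost:
  assumes D: "bdb D" and "\<delta> \<ge> 0"
  shows "real (card (tuples D - tuples (carve D c))) \<le>
    \<delta> * (real (card (undone D)) - real (card (undone (carve D c))))"
proof -
  let ?V = "{v. carvable D c v}"
  let ?S = "cell D c ` ?V"
  have V: "?V \<subseteq> undone D - undone (carve D c)"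
    using carved_done[OF D] by (auto simp: undone_def carvable_def)
  have finV: "finite ?V" using V finite_undone finite_subset by blast
  have fin: "finite S" if "S \<in> ?S" for S
    using that finite_cell[OF D] by (auto simp: carvable_def)
  have un: "\<Union>?S = ?V" using carvable_cell(2)[OF D] by auto
  have disj: "pairwise disjnt ?S"
  proof (rule pairwiseI)
    fix A B assume "A \<in> ?S" "B \<in> ?S" and ne: "A \<noteq> B"
    then obtain v w where v: "carvable D c v" "A = cell D c v" and w: "carvable D c w" "B = cell D c w" by blast
    show "disjnt A B"
      unfolding disjnt_iff using carvable_cell(1)[OF D v(1)] carvable_cell(1)[OF D w(1)] v w ne by metis
  qed
  have finb: "finite (boundary D S)" for S
    by (rule finite_subset[OF _ finite_tuples[OF D]]) (auto simp: boundary_def tuples_def)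
  have "tuples D - tuples (carve D c) \<subseteq> (\<Union>S\<in>?S. boundary D S)"
  proof
    fix x assume x: "x \<in> tuples D - tuples (carve D c)"
    obtain R t where Rt: "x = (R, t)" by fastforce
    then obtain v where "t \<in> db_rel D R" "v \<in> set t" "carvable D c v" "\<not> set t \<subseteq> cell D c v"
      using x by (auto simp: tuples_def carve_rel)
    then have "x \<in> boundary D (cell D c v)" "cell D c v \<in> ?S" using Rt by (auto simp: boundary_def)
    then show "x \<in> (\<Union>S\<in>?S. boundary D S)" by blast
  qed
  then have "card (tuples D - tuples (carve D c)) \<le> card (\<Union>S\<in>?S. boundary D S)"
    by (intro card_mono) (use finV finb in auto)
  also have "\<dots> \<le> (\<Sum>S\<in>?S. card (boundary D S))"
    by (rule card_UN_le) (use finV in simp)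
  finally have "real (card (tuples D - tuples (carve D c))) \<le> (\<Sum>S\<in>?S. real (card (boundary D S)))"
    by (metis of_nat_le_iff of_nat_sum)
  also have "\<dots> \<le> (\<Sum>S\<in>?S. \<delta> * real (card S))"
    by (rule sum_mono) (auto simp: carvable_def)
  also have "\<dots> = \<delta> * real (card (\<Union>?S))"
    using card_Union_disjoint[OF disj fin] by (simp add: sum_distrib_left)
  also have "\<dots> = \<delta> * real (card ?V)" using un by simp
  also have "\<dots> \<le> \<delta> * real (card (undone D - undone (carve D c)))"
    using V \<open>\<delta> \<ge> 0\<close> by (intro mult_left_mono) (simp_all add: card_mono)
  also have "\<dots> = \<delta> * (real (card (undone D)) - real (card (undone (carve D c))))"
    using undone_sub[OF D carve_sub] by (simp add: card_Diff_subset card_mono of_nat_diff)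
  finally show ?thesis .
qed

text \<open>A tuple meeting the \<open>r\<close>-ball stays within radius \<open>r + 1\<close>, the
  cells of its elements within \<open>r + 1 + k\<close>, and the boundary tuples of these cells
  within \<open>r + k + 2\<close>. All of this lies inside the ball of radius
  \<open>r + k + 3\<close>, so the coloured ball shows which of these tuples are removed.\<close>

lemma ball_iso_carve:
  assumes D: "bdb D" "a < db_size D" "bdb D'" "a' < db_size D'" and f: "ball_iso r' D a D' a' f"
    and col: "\<And>x. x \<in> nbhd r' D a \<Longrightarrow> x \<in> c \<longleftrightarrow> f x \<in> c'" and r': "r + k + 3 \<le> r'"
  shows "ball_iso r (carve D c) a (carve D' c') a' f"
proof -
  have bij: "bij_betw f (nbhd r' D a) (nbhd r' D' a')" and fa: "f a = a'" using f by (auto simp: ball_iso_def)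
  then have inj: "inj_on f (nbhd r' D a)" by (simp add: bij_betw_def)
  have cell: "cell D' c' (f v) = f ` cell D c v" if v: "v \<in> nbhd (Suc r) D a" for v
    unfolding cell_def
  proof (rule reach_transport[where Y = "nbhd (Suc r + k) D a"])
    fix i assume "i < k"
    then have "reach i (colour_adj D c) v \<subseteq> cell D c v" unfolding cell_def by (simp add: reach_mono)
    also have "\<dots> \<subseteq> nbhd k D v" using cell_subset_nbhd[OF D(1)] v nbhd_less by blast
    also have "\<dots> \<subseteq> nbhd (Suc r + k) D a" using nbhd_trans[OF D(1,2) v] by blast
    finally show "reach i (colour_adj D c) v \<subseteq> nbhd (Suc r + k) D a" .
  next
    fix x b assume x: "x \<in> nbhd (Suc r + k) D a" "colour_adj D c x b"
    then have "gadj D' (f x) (f b)" "b \<in> nbhd r' D a"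
      using ball_iso_gadj(1)[OF D f x(1)] r' by (auto simp: colour_adj_def)
    then show "colour_adj D' c' (f x) (f b)" using x col nbhd_mono[of "Suc r + k" r' D a] r'
      by (auto simp: colour_adj_def)
  next
    fix x b' assume x: "x \<in> nbhd (Suc r + k) D a" "colour_adj D' c' (f x) b'"
    then obtain b where "b' = f b" "gadj D x b" "b \<in> nbhd r' D a"
      using ball_iso_gadj(2)[OF D f x(1)] r' by (auto simp: colour_adj_def)
    then show "\<exists>b. b' = f b \<and> colour_adj D c x b" using x col nbhd_mono[of "Suc r + k" r' D a] r'
      by (auto simp: colour_adj_def)
  qed
  have cell_sub: "cell D c v \<subseteq> nbhd (Suc r + k) D a" if v: "v \<in> nbhd (Suc r) D a" for v
    using cell_subset_nbhd[OF D(1), of v c] nbhd_trans[OF D(1,2) v, of _ k "Suc r + k"] v nbhd_less by blast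
  \<comment> \<open>The test for carvability compares cardinalities, so boundary tuples have to be
    put in bijection. The map \<open>map f\<close> does this; it is injective on them because they
    stay inside the ball.\<close>
  have bnd: "boundary D' (f ` S) = (\<lambda>(R, t). (R, map f t)) ` boundary D S"
    and bndc: "card (boundary D' (f ` S)) = card (boundary D S)"
    if S: "S \<subseteq> nbhd (Suc r + k) D a" for S
  proof -
    have S': "S \<subseteq> nbhd r' D a" using S nbhd_mono[of "Suc r + k" r' D a] r' by auto
    have in_iff: "f x \<in> f ` S \<longleftrightarrow> x \<in> S" if "x \<in> nbhd r' D a" for x
      using inj S' that by (simp add: inj_on_image_mem_iff)
    have tS: "set t \<subseteq> nbhd r' D a \<and> map f t \<in> db_rel D' R" if t: "t \<in> db_rel D R" "set t \<inter> S \<noteq> {}" for R t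
    proof -
      obtain x where "x \<in> set t" "x \<in> nbhd (Suc r + k) D a" using t S by blast
      then show ?thesis using ball_iso_tuple_forth[OF D(1,2) f _ _ t(1), of x "Suc r + k"] r' by simp
    qed
    show eq: "boundary D' (f ` S) = (\<lambda>(R, t). (R, map f t)) ` boundary D S"
    proof (intro equalityI subsetI)
      fix p assume "p \<in> boundary D' (f ` S)"
      then obtain R t' x where t': "p = (R, t')" "t' \<in> db_rel D' R" "x \<in> S" "f x \<in> set t'" "\<not> set t' \<subseteq> f ` S"
        by (auto simp: boundary_def)
      obtain t where t: "t' = map f t" "t \<in> db_rel D R" "x \<in> set t" "set t \<subseteq> nbhd r' D a"
        using ball_iso_tuple_back[OF D f _ _ t'(2,4), of "Suc r + k"] S t'(3) r' by auto
      have "\<not> set t \<subseteq> S" using t'(5) t(1) by auto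
      then have "(R, t) \<in> boundary D S" using t t' by (auto simp: boundary_def)
      then show "p \<in> (\<lambda>(R, t). (R, map f t)) ` boundary D S" using t'(1) t(1) by (auto intro!: rev_image_eqI)
    next
      fix p assume "p \<in> (\<lambda>(R, t). (R, map f t)) ` boundary D S"
      then obtain R t where t: "p = (R, map f t)" "t \<in> db_rel D R" "set t \<inter> S \<noteq> {}" "\<not> set t \<subseteq> S"
        by (auto simp: boundary_def)
      have ts: "set t \<subseteq> nbhd r' D a" "map f t \<in> db_rel D' R" using tS[OF t(2,3)] by auto
      obtain y where y: "y \<in> set t" "y \<notin> S" using t(4) by blast
      then have "f y \<notin> f ` S" using in_iff[of y] ts by blast
      then show "p \<in> boundary D' (f ` S)" using t ts y by (auto simp: boundary_def)
    qed
    have "inj_on (\<lambda>(R, t). (R, map f t)) (boundary D S)"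
    proof (rule inj_onI)
      fix p q assume p: "p \<in> boundary D S" and q: "q \<in> boundary D S"
        and eq: "(\<lambda>(R, t). (R, map f t)) p = (\<lambda>(R, t). (R, map f t)) q"
      obtain R t R' t' where pq: "p = (R, t)" "q = (R', t')" by fastforce
      then have m: "map f t = map f t'" "R = R'" using eq by auto
      have "set t \<subseteq> nbhd r' D a" "set t' \<subseteq> nbhd r' D a" using tS p q pq by (auto simp: boundary_def)
      then have "t = t'" using map_inj_on[OF m(1)] inj inj_on_subset by (metis Un_least)
      then show "p = q" using pq m by simp
    qed
    then show "card (boundary D' (f ` S)) = card (boundary D S)" using eq card_image by metis
  qed
  have carv: "carvable D' c' (f v) \<longleftrightarrow> carvable D c v" if v: "v \<in> nbhd (Suc r) D a" for v
  proof -
    have vr: "v \<in> nbhd r' D a" using v nbhd_mono[of "Suc r" r' D a] r' by auto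
    have "f v \<in> nbhd r' D' a'" using vr bij by (auto simp: bij_betw_def)
    then have l: "v < db_size D" "f v < db_size D'" using vr nbhd_less by auto
    have n: "nbhd k D' (f v) = f ` nbhd k D v" using ball_iso_nbhd[OF D f v, of k] r' by simp
    have "nbhd k D v \<subseteq> nbhd r' D a" using nbhd_trans[OF D(1,2) v, of _ k r'] r' by auto
    then have 1: "card (nbhd k D' (f v)) = card (nbhd k D v)"
      unfolding n by (intro card_image inj_on_subset[OF inj])
    have "cell D c v \<subseteq> nbhd r' D a" using cell_sub[OF v] nbhd_mono[of "Suc r + k" r' D a] r' by auto
    then have 2: "card (f ` cell D c v) = card (cell D c v)"
      by (intro card_image inj_on_subset[OF inj])
    show ?thesis unfolding carvable_def cell[OF v] 1 2 bndc[OF cell_sub[OF v]] using l col[OF vr] by simp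
  qed
  have tup: "map f t \<in> db_rel (carve D' c') R \<longleftrightarrow> t \<in> db_rel (carve D c) R"
    if t: "t \<in> db_rel D R" and x: "x \<in> set t" "x \<in> nbhd r D a" for R t x
  proof -
    have s: "set t \<subseteq> nbhd (Suc r) D a" using tuple_in_nbhd[OF D(1,2) t x] by simp
    have m: "map f t \<in> db_rel D' R" using ball_iso_tuple_forth(1)[OF D(1,2) f x(2) _ t x(1)] r' by simp
    have sr: "set t \<subseteq> nbhd r' D a" using s nbhd_mono[of "Suc r" r' D a] r' by auto
    have "set (map f t) \<subseteq> cell D' c' (f v) \<longleftrightarrow> set t \<subseteq> cell D c v" if "v \<in> set t" for v
    proof -
      have v: "v \<in> nbhd (Suc r) D a" using that s by blast
      have "cell D c v \<subseteq> nbhd r' D a" using cell_sub[OF v] nbhd_mono[of "Suc r + k" r' D a] r' by auto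
      then show ?thesis using inj_on_image_subset_iff[OF inj sr] by (simp add: cell[OF v])
    qed
    then have "(\<forall>v\<in>set t. carvable D' c' (f v) \<longrightarrow> set (map f t) \<subseteq> cell D' c' (f v)) \<longleftrightarrow>
        (\<forall>v\<in>set t. carvable D c v \<longrightarrow> set t \<subseteq> cell D c v)"
      using carv subsetD[OF s] by blast
    then show ?thesis using t m unfolding carve_rel by simp
  qed
  have E: "bdb (carve D c)" "a < db_size (carve D c)" "bdb (carve D' c')" "a' < db_size (carve D' c')"
    using bdb_carve D by auto
  have sub: "nbhd r (carve D c) a \<subseteq> nbhd r D a" using nbhd_sub[OF D(1) carve_sub D(2)] .
  \<comment> \<open>Distances are now those of the carved databases. Carved balls are contained in
    the balls of \<open>D\<close>, so the comparison \<open>tup\<close> of surviving tuples applies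
    along every walk.\<close>
  have "reach r (gadj (carve D' c')) (f a) = f ` reach r (gadj (carve D c)) a"
  proof (rule reach_transport[where Y = "nbhd r D a"])
    fix i assume "i < r"
    then show "reach i (gadj (carve D c)) a \<subseteq> nbhd r D a"
      using nbhd_reach[OF E(1,2), of r] sub reach_mono[of i r "gadj (carve D c)" a] by auto
  next
    fix x b assume x: "x \<in> nbhd r D a" "gadj (carve D c) x b"
    then obtain R t where t: "t \<in> db_rel (carve D c) R" "x \<in> set t" "b \<in> set t" "x \<noteq> b" by (auto simp: gadj_def)
    then have tD: "t \<in> db_rel D R" by (simp add: carve_rel)
    have "set t \<subseteq> nbhd r' D a" using tuple_in_nbhd[OF D(1,2) tD t(2) x(1)] r' by simp
    then have "f x \<noteq> f b" using t inj by (meson inj_on_eq_iff subsetD)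
    moreover have "map f t \<in> db_rel (carve D' c') R" using tup[OF tD t(2) x(1)] t by simp
    ultimately show "gadj (carve D' c') (f x) (f b)"
      unfolding gadj_def using t by (metis image_eqI list.set_map)
  next
    fix x b' assume x: "x \<in> nbhd r D a" "gadj (carve D' c') (f x) b'"
    then obtain R t' where t': "t' \<in> db_rel (carve D' c') R" "f x \<in> set t'" "b' \<in> set t'" "f x \<noteq> b'"
      by (auto simp: gadj_def)
    then have "t' \<in> db_rel D' R" by (simp add: carve_rel)
    then obtain t where t: "t' = map f t" "t \<in> db_rel D R" "x \<in> set t"
      using ball_iso_tuple_back[OF D f x(1) _ _ t'(2)] r' by auto
    then have "t \<in> db_rel (carve D c) R" using tup[OF t(2,3) x(1)] t' by simp
    then show "\<exists>b. b' = f b \<and> gadj (carve D c) x b" using t t' by (auto simp: gadj_def)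
  qed
  then have img: "nbhd r (carve D' c') a' = f ` nbhd r (carve D c) a"
    using nbhd_reach[OF E(1,2)] nbhd_reach[OF E(3,4)] fa by simp
  have subr': "nbhd r (carve D c) a \<subseteq> nbhd r' D a" using sub nbhd_mono[of r r' D a] r' by auto
  have "bij_betw f (nbhd r (carve D c) a) (nbhd r (carve D' c') a')"
    unfolding bij_betw_def img using inj_on_subset[OF inj subr'] by simp
  moreover have "t \<in> db_rel (carve D c) R \<longleftrightarrow> map f t \<in> db_rel (carve D' c') R"
    if s: "set t \<subseteq> nbhd r (carve D c) a" for R t
  proof -
    have D1: "t \<in> db_rel D R \<longleftrightarrow> map f t \<in> db_rel D' R" using f s subr' by (simp add: ball_iso_def)
    show ?thesis
    proof (cases "t \<in> db_rel D R")
      case True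
      then obtain x where "x \<in> set t" using bdb_tupleD(4)[OF D(1) True] by (metis ex_in_conv)
      then show ?thesis using tup[OF True, of x] s sub by blast
    next
      case False
      then show ?thesis using D1 by (simp add: carve_rel)
    qed
  qed
  ultimately show ?thesis using fa by (simp add: ball_iso_def)
qed

end

section \<open>Uniformly random colourings\<close>

lemma sum_Pow_insert:
  fixes h :: "'a set \<Rightarrow> 'b::comm_monoid_add"
  assumes "finite V" "x \<notin> V"
  shows "(\<Sum>c\<in>Pow (insert x V). h c) = (\<Sum>c\<in>Pow V. h c + h (insert x c))"
proof -
  have inj: "inj_on (insert x) (Pow V)" using assms(2) by (auto simp: inj_on_def)
  have "(\<Sum>c\<in>Pow (insert x V). h c) = (\<Sum>c\<in>Pow V. h c) + (\<Sum>c\<in>insert x ` Pow V. h c)"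
    unfolding Pow_insert by (rule sum.union_disjoint) (use assms in auto)
  also have "(\<Sum>c\<in>insert x ` Pow V. h c) = (\<Sum>c\<in>Pow V. h (insert x c))"
    using sum.reindex[OF inj] by simp
  finally show ?thesis by (simp add: sum.distrib)
qed

text \<open>Probabilities of colourings are expressed by counting subsets of \<open>V\<close>. The
  induction averages out one coordinate \<open>x\<close>: the average \<open>m\<close> has the same
  mean and again changes by at most \<open>B\<close> per coordinate, and the variance lost by
  averaging is at most \<open>B\<^sup>2\<close> per colouring.\<close>

lemma efron_stein_Pow:
  fixes g :: "'a set \<Rightarrow> real"
  assumes "finite V" "\<And>c x. c \<subseteq> V \<Longrightarrow> x \<in> V \<Longrightarrow> \<bar>g (insert x c) - g (c - {x})\<bar> \<le> B"
    and "\<mu> * 2 ^ card V = (\<Sum>c\<in>Pow V. g c)"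
  shows "(\<Sum>c\<in>Pow V. (g c - \<mu>)\<^sup>2) \<le> 2 ^ card V * (real (card V) * B\<^sup>2)"
  using assms
proof (induction V arbitrary: g rule: finite_induct)
  case (insert x V)
  define m where "m c = (g c + g (insert x c)) / 2" for c
  have xc: "x \<notin> c" if "c \<in> Pow V" for c using that insert.hyps by auto
  have d: "\<bar>g (insert x c) - g c\<bar> \<le> B" if "c \<in> Pow V" for c
    using insert.prems(1)[of c x] that xc[OF that] by auto
  have m1: "\<bar>m (insert y c) - m (c - {y})\<bar> \<le> B" if "c \<subseteq> V" "y \<in> V" for c y
  proof -
    have "y \<noteq> x" using that insert.hyps by auto
    have e: "insert x (insert y c) = insert y (insert x c)" "insert x (c - {y}) = insert x c - {y}"
      using \<open>y \<noteq> x\<close> by auto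
    have "\<bar>g (insert y c) - g (c - {y})\<bar> \<le> B"
      using that insert.prems(1)[of c y] by auto
    moreover have "\<bar>g (insert y (insert x c)) - g (insert x c - {y})\<bar> \<le> B"
      using that insert.prems(1)[of "insert x c" y] by auto
    ultimately show ?thesis unfolding m_def e by argo
  qed
  have m2: "\<mu> * 2 ^ card V = (\<Sum>c\<in>Pow V. m c)"
  proof -
    have "\<mu> * 2 ^ card (insert x V) = (\<Sum>c\<in>Pow V. g c + g (insert x c))"
      using insert.prems(2) sum_Pow_insert[OF insert.hyps, of g] by simp
    then show ?thesis using insert.hyps unfolding m_def by (simp add: sum_divide_distrib[symmetric])
  qed
  have IH: "(\<Sum>c\<in>Pow V. (m c - \<mu>)\<^sup>2) \<le> 2 ^ card V * (real (card V) * B\<^sup>2)"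
    using insert.IH[of m] m1 m2 by blast
  have "(\<Sum>c\<in>Pow (insert x V). (g c - \<mu>)\<^sup>2) = (\<Sum>c\<in>Pow V. (g c - \<mu>)\<^sup>2 + (g (insert x c) - \<mu>)\<^sup>2)"
    by (rule sum_Pow_insert[OF insert.hyps])
  also have "\<dots> \<le> (\<Sum>c\<in>Pow V. 2 * (m c - \<mu>)\<^sup>2 + 2 * B\<^sup>2)"
  proof (rule sum_mono)
    fix c assume c: "c \<in> Pow V"
    have "(g (insert x c) - g c)\<^sup>2 \<le> B\<^sup>2" using power_mono[OF d[OF c], of 2] by simp
    \<comment> \<open>The parallelogram identity: the spread of two values about
      \<open>\<mu>\<close> is the spread of their average plus their spread about the
      average.\<close>
    moreover have "(g c - \<mu>)\<^sup>2 + (g (insert x c) - \<mu>)\<^sup>2 = 2 * (m c - \<mu>)\<^sup>2 + (g (insert x c) - g c)\<^sup>2 / 2"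
      unfolding m_def by (simp add: field_simps power2_eq_square)
    ultimately show "(g c - \<mu>)\<^sup>2 + (g (insert x c) - \<mu>)\<^sup>2 \<le> 2 * (m c - \<mu>)\<^sup>2 + 2 * B\<^sup>2"
      using zero_le_power2[of B] by linarith
  qed
  also have "\<dots> = 2 * (\<Sum>c\<in>Pow V. (m c - \<mu>)\<^sup>2) + 2 ^ card V * (2 * B\<^sup>2)"
    using insert.hyps by (simp add: sum.distrib sum_distrib_left card_Pow)
  also have "\<dots> \<le> 2 * (2 ^ card V * (real (card V) * B\<^sup>2)) + 2 ^ card V * (2 * B\<^sup>2)"
    using IH by simp
  also have "\<dots> = 2 ^ card (insert x V) * (real (card (insert x V)) * B\<^sup>2)"
    using insert.hyps by (simp add: algebra_simps)
  finally show ?case .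
qed simp

lemma chebyshev_Pow:
  fixes g :: "'a set \<Rightarrow> real"
  assumes "finite V" "\<And>c x. c \<subseteq> V \<Longrightarrow> x \<in> V \<Longrightarrow> \<bar>g (insert x c) - g (c - {x})\<bar> \<le> B"
    and "\<mu> * 2 ^ card V = (\<Sum>c\<in>Pow V. g c)" and "\<theta> \<ge> 0"
  shows "real (card {c\<in>Pow V. \<theta> \<le> \<bar>g c - \<mu>\<bar>}) * \<theta>\<^sup>2 \<le> 2 ^ card V * (real (card V) * B\<^sup>2)"
proof -
  have "real (card {c\<in>Pow V. \<theta> \<le> \<bar>g c - \<mu>\<bar>}) * \<theta>\<^sup>2 = (\<Sum>c\<in>{c\<in>Pow V. \<theta> \<le> \<bar>g c - \<mu>\<bar>}. \<theta>\<^sup>2)" by simp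
  also have "\<dots> \<le> (\<Sum>c\<in>{c\<in>Pow V. \<theta> \<le> \<bar>g c - \<mu>\<bar>}. (g c - \<mu>)\<^sup>2)"
    by (rule sum_mono) (use \<open>\<theta> \<ge> 0\<close> power_mono[of \<theta> _ 2] in \<open>fastforce\<close>)
  also have "\<dots> \<le> (\<Sum>c\<in>Pow V. (g c - \<mu>)\<^sup>2)"
    by (rule sum_mono2) (use assms(1) in auto)
  finally show ?thesis using efron_stein_Pow[OF assms(1-3)] by simp
qed

text \<open>Colours inside and outside \<open>A\<close> are independent: a subset of
  \<open>V\<close> splits into its traces on \<open>A\<close> and on \<open>V - A\<close>, and
  \<open>Q\<close> looks only at the first.\<close>

lemma card_Pow_local:
  assumes "finite V" "A \<subseteq> V" "\<And>c. c \<subseteq> V \<Longrightarrow> Q c \<longleftrightarrow> Q (c \<inter> A)"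
  shows "card {c\<in>Pow V. Q c} = card {c\<in>Pow A. Q c} * 2 ^ card (V - A)"
proof -
  have "bij_betw (\<lambda>(a, b). a \<union> b) ({c\<in>Pow A. Q c} \<times> Pow (V - A)) {c\<in>Pow V. Q c}"
  proof (rule bij_betwI[where g = "\<lambda>c. (c \<inter> A, c - A)"])
    show "(\<lambda>(a, b). a \<union> b) \<in> {c \<in> Pow A. Q c} \<times> Pow (V - A) \<rightarrow> {c \<in> Pow V. Q c}"
    proof (clarsimp, intro conjI)
      fix a b assume ab: "a \<subseteq> A" "Q a" "b \<subseteq> V - A"
      show aV: "a \<subseteq> V" "b \<subseteq> V" using ab assms(2) by auto
      have "(a \<union> b) \<inter> A = a" using ab by auto
      then show "Q (a \<union> b)" using assms(3)[of "a \<union> b"] ab aV by simp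
    qed
    show "(\<lambda>c. (c \<inter> A, c - A)) \<in> {c \<in> Pow V. Q c} \<rightarrow> {c \<in> Pow A. Q c} \<times> Pow (V - A)"
      using assms(3) by auto
  qed auto
  from bij_betw_same_card[OF this] have "card {c\<in>Pow V. Q c} = card ({c\<in>Pow A. Q c} \<times> Pow (V - A))"
    by (rule sym)
  also have "\<dots> = card {c\<in>Pow A. Q c} * 2 ^ card (V - A)"
    using assms(1) by (simp only: card_cartesian_product card_Pow finite_Diff)
  finally show ?thesis .
qed

section \<open>The chance that an element is carved\<close>

context carving begin

text \<open>It suffices that \<open>S\<close> is coloured while its neighbours outside
  \<open>S\<close> are not: then the cell of \<open>v\<close> is exactly \<open>S\<close>. This
  prescribes the colours on a set \<open>A\<close> of at most \<open>k + k * (d * amax)\<close>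
  elements, and one pattern on \<open>A\<close> has a share of \<open>1 / 2 ^ card A\<close> of all
  colourings.\<close>

lemma carvable_probability:
  assumes D: "bdb D" and v: "v \<in> undone D" "v \<in> S" and S: "S \<subseteq> {..<db_size D}" "card S \<le> k"
    and conn: "S \<subseteq> reach k (\<lambda>x y. gadj D x y \<and> x \<in> S \<and> y \<in> S) v"
    and bd: "real (card (boundary D S)) \<le> \<delta> * real (card S)"
  shows "2 ^ db_size D \<le> card {c\<in>Pow {..<db_size D}. carvable D c v} * 2 ^ (k + k * (d * amax))"
proof -
  let ?V = "{..<db_size D}"
  define A where "A = S \<union> (\<Union>x\<in>S. {y. gadj D x y})"
  have finS: "finite S" using S finite_subset by blast
  have AV: "A \<subseteq> ?V" using S gadj_less[OF D] by (auto simp: A_def)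
  have finA: "finite A" using AV finite_subset by blast
  have "card A \<le> card S + card (\<Union>x\<in>S. {y. gadj D x y})" unfolding A_def by (rule card_Un_le)
  also have "card (\<Union>x\<in>S. {y. gadj D x y}) \<le> (\<Sum>x\<in>S. card {y. gadj D x y})"
    by (rule card_UN_le[OF finS])
  also have "\<dots> \<le> (\<Sum>x\<in>S. d * amax)" by (rule sum_mono) (use gadj_card[OF D] S in blast)
  finally have cA: "card A \<le> k + k * (d * amax)" using S(2) by (simp add: order_trans[OF _ add_mono] mult_right_mono)
  have carv: "carvable D c v" if "c \<inter> A = S" for c
  proof -
    have Sc: "S \<subseteq> c" using that by (auto simp: A_def)
    have "cell D c v \<subseteq> S"
      unfolding cell_def by (rule reach_closed_subset) (use v that in \<open>auto simp: colour_adj_def A_def\<close>)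
    moreover have "S \<subseteq> cell D c v"
      unfolding cell_def using conn reach_mono_rel[of "\<lambda>x y. gadj D x y \<and> x \<in> S \<and> y \<in> S" "colour_adj D c" k v] Sc
      by (auto simp: colour_adj_def)
    ultimately have "cell D c v = S" by blast
    then show ?thesis using v Sc S bd by (auto simp: carvable_def undone_def)
  qed
  have "card {c\<in>Pow ?V. c \<inter> A = S} = card {c\<in>Pow A. c \<inter> A = S} * 2 ^ card (?V - A)"
    by (rule card_Pow_local) (use AV in auto)
  also have "{c\<in>Pow A. c \<inter> A = S} = {S}" by (auto simp: A_def)
  finally have e: "card {c\<in>Pow ?V. c \<inter> A = S} = 2 ^ card (?V - A)" by simp
  have "(2::nat) ^ db_size D = 2 ^ (card (?V - A) + card A)"
    using card_Diff_subset[OF finA AV] card_mono[OF _ AV] by simp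
  also have "\<dots> \<le> 2 ^ (card (?V - A) + (k + k * (d * amax)))"
    using cA by (intro power_increasing) auto
  also have "\<dots> = card {c\<in>Pow ?V. c \<inter> A = S} * 2 ^ (k + k * (d * amax))"
    unfolding e by (simp add: power_add)
  also have "\<dots> \<le> card {c\<in>Pow ?V. carvable D c v} * 2 ^ (k + k * (d * amax))"
    by (intro mult_right_mono card_mono) (use carv in auto)
  finally show ?thesis .
qed

text \<open>Applied to the database \<open>H\<close> of the tuples common to the current database
  and the partition \<open>F\<close>: its components refine those of \<open>F\<close> and are no
  larger.\<close>

lemma components_le_reach:
  assumes F: "bdb F" "components_le F k" and v: "v < db_size F" and H: "sub_db H F"
  shows "card (reach k (gadj H) v) \<le> k" "reach k (gadj H) v \<subseteq> {..<db_size F}" "finite (reach k (gadj H) v)"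
proof -
  have HF: "gadj F x y" if "gadj H x y" for x y using that H by (auto simp: gadj_def sub_db_def)
  have fin: "component F v \<subseteq> {..<db_size F}"
  proof
    fix b assume "b \<in> component F v"
    then have "(gadj F)\<^sup>*\<^sup>* v b" by (simp add: component_def)
    then show "b \<in> {..<db_size F}" by induction (use v gadj_less[OF F(1)] in auto)
  qed
  have sub: "reach k (gadj H) v \<subseteq> component F v"
    by (rule reach_closed_subset) (use HF in \<open>auto simp: component_def intro: rtranclp.rtrancl_into_rtrancl\<close>)
  show "reach k (gadj H) v \<subseteq> {..<db_size F}" using sub fin by blast
  then show "finite (reach k (gadj H) v)" using finite_subset by blast
  have "card (reach k (gadj H) v) \<le> card (component F v)"
    by (rule card_mono[OF finite_subset[OF fin] sub]) simp
  then show "card (reach k (gadj H) v) \<le> k" using F(2) v unfolding components_le_def by (meson le_trans)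
qed

text \<open>The partition \<open>F\<close> belongs to \<open>D0\<close>, and \<open>D\<close> may
  have lost tuples since; so the pieces are taken in the intersection of \<open>D\<close> and
  \<open>F\<close>. A piece is bad if its boundary exceeds \<open>\<delta>\<close> times its size.
  Boundary tuples are among the at most \<open>m\<close> tuples missing from \<open>F\<close>, and
  each of these meets at most \<open>amax\<close> pieces, so bad pieces contain at most
  \<open>amax * m / \<delta>\<close> elements altogether. Every other undone element is carved with
  probability at least \<open>p\<close>.\<close>

lemma carve_expected_progress:
  assumes D0: "bdb D0" "sub_db D D0" "sub_db F D0" "components_le F k" and \<delta>: "\<delta> > 0"
    and m: "real (card (tuples D0 - tuples F)) \<le> m"
  defines "p \<equiv> 1 / 2 ^ (k + k * (d * amax))"
  shows "(\<Sum>c\<in>Pow {..<db_size D}. real (card (undone (carve D c)))) \<le>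
    2 ^ db_size D * (real (card (undone D)) - p * (real (card (undone D)) - real amax * m / \<delta>))"
proof -
  have D: "bdb D" and F: "bdb F" using bdb_sub D0 by auto
  have sz: "db_size F = db_size D" "db_size D0 = db_size D" using D0 by (auto simp: sub_db_def)
  define H where "H = DB (db_size D) (\<lambda>R. db_rel D R \<inter> db_rel F R)"
  have HF: "sub_db H F" and HD: "sub_db H D" using sz by (auto simp: H_def sub_db_def)
  define S where "S v = reach k (gadj H) v" for v
  have S: "card (S v) \<le> k" "S v \<subseteq> {..<db_size D}" "finite (S v)" if "v < db_size D" for v
    using components_le_reach[OF F D0(4) _ HF, of v] that sz by (auto simp: S_def)
  have Scl: "y \<in> S v" if "v < db_size D" "x \<in> S v" "gadj H x y" for v x y
    using reach_small_closed[of k "gadj H" v x y] S[OF that(1)] that by (auto simp: S_def)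
  have Seq: "S u = S v" if "v < db_size D" "u \<in> S v" for u v
    unfolding S_def by (rule small_reach_eq) (use gadj_sym S[OF that(1)] that in \<open>auto simp: S_def\<close>)
  have Sself: "v \<in> S v" for v by (simp add: S_def)
  define bad where "bad = {v. v < db_size D \<and> \<delta> * real (card (S v)) < real (card (boundary D (S v)))}"
  have finbad: "finite bad" by (rule finite_subset[of _ "{..<db_size D}"]) (auto simp: bad_def)
  let ?X = "tuples D0 - tuples F"
  have finX: "finite ?X" using finite_tuples[OF D0(1)] by simp
  have bdX: "boundary D (S v) \<subseteq> {x\<in>?X. set (snd x) \<inter> S v \<noteq> {}}" if v: "v < db_size D" for v
  proof
    fix x assume "x \<in> boundary D (S v)"
    then obtain R t e y where x: "x = (R, t)" "t \<in> db_rel D R" "e \<in> set t" "e \<in> S v" "y \<in> set t" "y \<notin> S v"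
      by (auto simp: boundary_def)
    have "t \<notin> db_rel F R"
    proof
      assume "t \<in> db_rel F R"
      then have "gadj H e y" using x by (auto simp: gadj_def H_def)
      then show False using Scl[OF v x(4)] x by blast
    qed
    then show "x \<in> {x\<in>?X. set (snd x) \<inter> S v \<noteq> {}}"
      using x D0(2) by (auto simp: tuples_def sub_db_def)
  qed
  have cardbad: "\<delta> * real (card bad) \<le> real amax * m"
  proof -
    let ?S = "S ` bad"
    have b: "v < db_size D" if "v \<in> bad" for v using that by (simp add: bad_def)
    have disj: "pairwise disjnt ?S"
    proof (rule pairwiseI)
      fix A B assume "A \<in> ?S" "B \<in> ?S" and ne: "A \<noteq> B"
      then obtain v w where v: "v \<in> bad" "A = S v" and w: "w \<in> bad" "B = S w" by blast
      show "disjnt A B" unfolding disjnt_iff using Seq[OF b[OF v(1)]] Seq[OF b[OF w(1)]] v w ne by metis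
    qed
    have un: "\<Union>?S = bad"
    proof
      show "bad \<subseteq> \<Union>?S" using Sself by blast
      show "\<Union>?S \<subseteq> bad"
      proof
        fix u assume "u \<in> \<Union>?S"
        then obtain v where v: "v \<in> bad" "u \<in> S v" by blast
        then show "u \<in> bad" using Seq[OF b[OF v(1)] v(2)] S(2)[OF b[OF v(1)]] unfolding bad_def by auto
      qed
    qed
    have fin: "finite A" if "A \<in> ?S" for A using that S(3) b by blast
    have "\<delta> * real (card bad) = \<delta> * real (card (\<Union>?S))" using un by simp
    also have "\<dots> = (\<Sum>A\<in>?S. \<delta> * real (card A))"
      using card_Union_disjoint[OF disj fin] by (simp add: sum_distrib_left)
    also have "\<dots> \<le> (\<Sum>A\<in>?S. real (card {x\<in>?X. set (snd x) \<inter> A \<noteq> {}}))"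
    proof (rule sum_mono)
      fix A assume "A \<in> ?S"
      then obtain v where v: "v \<in> bad" "A = S v" by blast
      have "card (boundary D (S v)) \<le> card {x\<in>?X. set (snd x) \<inter> S v \<noteq> {}}"
        by (rule card_mono[OF finite_subset[OF _ finX] bdX[OF b[OF v(1)]]]) blast
      then show "\<delta> * real (card A) \<le> real (card {x\<in>?X. set (snd x) \<inter> A \<noteq> {}})"
        using v by (auto simp: bad_def)
    qed
    also have "\<dots> = real (\<Sum>A\<in>?S. card {x\<in>?X. set (snd x) \<inter> A \<noteq> {}})" by (rule of_nat_sum[symmetric])
    \<comment> \<open>Double counting of the pairs of a bad piece and a removed tuple that meets
      it.\<close>
    also have "(\<Sum>A\<in>?S. card {x\<in>?X. set (snd x) \<inter> A \<noteq> {}}) = (\<Sum>x\<in>?X. card {A\<in>?S. set (snd x) \<inter> A \<noteq> {}})"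
      by (rule sum_multicount_gen) (use finbad finX in auto)
    also have "real \<dots> \<le> real (\<Sum>x\<in>?X. amax)"
    proof (intro of_nat_mono sum_mono)
      fix x assume x: "x \<in> ?X"
      obtain R t where Rt: "x = (R, t)" by fastforce
      have "{A\<in>?S. set (snd x) \<inter> A \<noteq> {}} \<subseteq> S ` set t"
      proof
        fix A assume "A \<in> {A\<in>?S. set (snd x) \<inter> A \<noteq> {}}"
        then obtain v e where v: "v \<in> bad" "A = S v" "e \<in> set t" "e \<in> S v" using Rt by auto
        then have "A = S e" using Seq[OF b[OF v(1)] v(4)] by simp
        then show "A \<in> S ` set t" using v by blast
      qed
      then have "card {A\<in>?S. set (snd x) \<inter> A \<noteq> {}} \<le> card (S ` set t)" by (intro card_mono) auto
      also have "\<dots> \<le> card (set t)" by (rule card_image_le) simp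
      also have "\<dots> \<le> amax" using bdb_tupleD(5)[OF D0(1), of t R] x Rt by (simp add: tuples_def)
      finally show "card {A\<in>?S. set (snd x) \<inter> A \<noteq> {}} \<le> amax" .
    qed
    also have "\<dots> = real amax * real (card ?X)" by simp
    also have "\<dots> \<le> real amax * m" using m by (intro mult_left_mono) auto
    finally show ?thesis .
  qed
  let ?g = "undone D - bad"
  have good: "2 ^ db_size D * p \<le> real (card {c\<in>Pow {..<db_size D}. carvable D c v})" if v: "v \<in> ?g" for v
  proof -
    have vn: "v < db_size D" using v by (auto simp: undone_def)
    have "(2::nat) ^ db_size D \<le> card {c\<in>Pow {..<db_size D}. carvable D c v} * 2 ^ (k + k * (d * amax))"
    proof (rule carvable_probability[OF D, where S = "S v"])
      \<comment> \<open>Everything reached from \<open>v\<close> in \<open>H\<close> within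
        \<open>k\<close> steps belongs to \<open>S v\<close>, so the piece is connected by walks of
        \<open>D\<close> that do not leave it.\<close>
      have "reach j (gadj H) v \<subseteq> reach j (\<lambda>x y. gadj D x y \<and> x \<in> S v \<and> y \<in> S v) v" if "j \<le> k" for j
        using that
      proof (induction j)
        case (Suc j)
        show ?case
        proof
          fix y assume y: "y \<in> reach (Suc j) (gadj H) v"
          show "y \<in> reach (Suc j) (\<lambda>x y. gadj D x y \<and> x \<in> S v \<and> y \<in> S v) v"
          proof (cases "y \<in> reach j (gadj H) v")
            case True then show ?thesis using Suc by (auto simp: reach_Suc)
          next
            case False
            then obtain x where x: "x \<in> reach j (gadj H) v" "gadj H x y" using y by (auto simp: reach_Suc)
            have "x \<in> S v" using x reach_mono[of j k "gadj H" v] Suc.prems by (auto simp: S_def)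
            moreover have "y \<in> S v" using Scl[OF vn \<open>x \<in> S v\<close> x(2)] .
            moreover have "gadj D x y" using x(2) HD by (auto simp: gadj_def sub_db_def)
            ultimately show ?thesis using Suc x by (auto simp: reach_Suc)
          qed
        qed
      qed simp
      then show "S v \<subseteq> reach k (\<lambda>x y. gadj D x y \<and> x \<in> S v \<and> y \<in> S v) v" by (auto simp: S_def)
      show "real (card (boundary D (S v))) \<le> \<delta> * real (card (S v))" using v vn by (auto simp: bad_def)
    qed (use v vn S[OF vn] Sself in auto)
    then have "real (2 ^ db_size D) \<le> real (card {c\<in>Pow {..<db_size D}. carvable D c v} * 2 ^ (k + k * (d * amax)))"
      using of_nat_le_iff by blast
    then show ?thesis unfolding p_def by (simp add: field_simps)
  qed
  have "real (card (undone (carve D c))) \<le> real (card (undone D)) - real (card {v\<in>?g. carvable D c v})" for c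
  proof -
    have "undone (carve D c) \<union> {v\<in>?g. carvable D c v} \<subseteq> undone D"
      using undone_sub[OF D carve_sub] by auto
    then have "card (undone (carve D c) \<union> {v\<in>?g. carvable D c v}) \<le> card (undone D)"
      by (intro card_mono) auto
    moreover have "card (undone (carve D c) \<union> {v\<in>?g. carvable D c v}) =
        card (undone (carve D c)) + card {v\<in>?g. carvable D c v}"
      by (rule card_Un_disjoint) (use carved_done[OF D] in auto)
    ultimately show ?thesis by linarith
  qed
  then have "(\<Sum>c\<in>Pow {..<db_size D}. real (card (undone (carve D c)))) \<le>
      (\<Sum>c\<in>Pow {..<db_size D}. real (card (undone D)) - real (card {v\<in>?g. carvable D c v}))"
    by (intro sum_mono)
  also have "\<dots> = 2 ^ db_size D * real (card (undone D)) - real (\<Sum>c\<in>Pow {..<db_size D}. card {v\<in>?g. carvable D c v})"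
    by (simp add: sum_subtractf card_Pow)
  \<comment> \<open>Exchanging the sums turns the expected number of carved elements into a sum of
    probabilities.\<close>
  also have "(\<Sum>c\<in>Pow {..<db_size D}. card {v\<in>?g. carvable D c v}) = (\<Sum>v\<in>?g. card {c\<in>Pow {..<db_size D}. carvable D c v})"
    by (rule sum_multicount_gen) auto
  also have "real \<dots> = (\<Sum>v\<in>?g. real (card {c\<in>Pow {..<db_size D}. carvable D c v}))" by simp
  finally have 1: "(\<Sum>c\<in>Pow {..<db_size D}. real (card (undone (carve D c)))) \<le>
     2 ^ db_size D * real (card (undone D)) - (\<Sum>v\<in>?g. real (card {c\<in>Pow {..<db_size D}. carvable D c v}))" .
  have "(\<Sum>v\<in>?g. 2 ^ db_size D * p) \<le> (\<Sum>v\<in>?g. real (card {c\<in>Pow {..<db_size D}. carvable D c v}))"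
    by (rule sum_mono) (use good in blast)
  then have 2: "real (card ?g) * (2 ^ db_size D * p) \<le> (\<Sum>v\<in>?g. real (card {c\<in>Pow {..<db_size D}. carvable D c v}))"
    by simp
  have "real (card bad) \<le> real amax * m / \<delta>" using cardbad \<delta> by (simp add: field_simps)
  moreover have "card (undone D) \<le> card ?g + card bad"
    using finbad card_Un_le[of ?g bad] card_mono[of "?g \<union> bad" "undone D"] by fastforce
  ultimately have 3: "real (card (undone D)) - real amax * m / \<delta> \<le> real (card ?g)" by linarith
  have "p \<ge> 0" by (simp add: p_def)
  then have "(real (card (undone D)) - real amax * m / \<delta>) * (2 ^ db_size D * p) \<le> real (card ?g) * (2 ^ db_size D * p)"
    using 3 by (intro mult_right_mono) auto
  then show ?thesis using 1 2 by (simp add: algebra_simps)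
qed

end

section \<open>Programs exploring neighbourhoods\<close>

text \<open>The two kinds of deterministic instructions that precede the final decision; both just
  advance the program counter by one.\<close>

fun straight :: "'r instr \<Rightarrow> bool" where
  "straight (Const _ _) = True"
| "straight (Query _ _ _ _) = True"
| "straight _ = False"

fun exec1 :: "('r \<Rightarrow> nat \<Rightarrow> nat \<Rightarrow> nat list option) \<Rightarrow> 'r instr \<Rightarrow> (nat \<Rightarrow> nat) \<Rightarrow> nat \<Rightarrow> nat" where
  "exec1 orc (Const x c) st = st(x := c)"
| "exec1 orc (Query R i j q) st = write_answer q (orc R (st i) (st j)) st"
| "exec1 orc _ st = st"

lemma run_straight:
  assumes "list_all straight p" "prog = pre @ p @ post"
  shows "run prog orc (length p + T) (Run (length pre) st) =
    run prog orc T (Run (length pre + length p) (fold (exec1 orc) p st))"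
  using assms
proof (induction p arbitrary: pre st)
  case (Cons i p)
  have "step prog orc (Run (length pre) st) = return_pmf (Run (Suc (length pre)) (exec1 orc i st))"
    using Cons.prems by (cases i) (auto simp: step_def)
  moreover have "run prog orc (length p + T) (Run (length (pre @ [i])) (exec1 orc i st)) =
      run prog orc T (Run (length (pre @ [i]) + length p) (fold (exec1 orc) p (exec1 orc i st)))"
    by (rule Cons.IH) (use Cons.prems in auto)
  ultimately show ?case by (simp add: bind_return_pmf)
qed simp

definition put :: "nat \<Rightarrow> nat list \<Rightarrow> (nat \<Rightarrow> nat) \<Rightarrow> nat \<Rightarrow> nat" where
  "put b xs st = (\<lambda>x. if b \<le> x \<and> x < b + length xs then xs ! (x - b) else st x)"

lemma put_Cons: "put (Suc b) xs (st(b := v)) = put b (v # xs) st"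
proof
  fix x
  show "put (Suc b) xs (st(b := v)) x = put b (v # xs) st x"
  proof (cases "b < x")
    case True
    then obtain e where "x = Suc (b + e)" using less_iff_Suc_add by blast
    then show ?thesis by (auto simp: put_def)
  qed (auto simp: put_def)
qed

text \<open>The value \<open>0\<close> for an empty domain is the one that \<open>Rand\<close>
  delivers there.\<close>

definition unif :: "nat \<Rightarrow> nat pmf" where
  "unif n = (if n = 0 then return_pmf 0 else pmf_of_set {0..<n})"

lemma run_rand:
  assumes "prog = pre @ map (\<lambda>i. Rand i 0) [b..<b + s] @ post" "b > 0" "st 0 = n"
  shows "run prog orc (s + T) (Run (length pre) st) =
    bind_pmf (replicate_pmf s (unif n)) (\<lambda>xs. run prog orc T (Run (length pre + s) (put b xs st)))"
  using assms
proof (induction s arbitrary: pre st b)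
  case 0
  have "put b [] st = st" by (auto simp: put_def)
  then show ?case by (simp add: bind_return_pmf)
next
  case (Suc s)
  have eq: "[b..<b + Suc s] = b # [Suc b..<Suc b + s]" by (simp add: upt_rec)
  have "step prog orc (Run (length pre) st) = map_pmf (\<lambda>v. Run (Suc (length pre)) (st(b := v))) (unif n)"
    using Suc.prems unfolding eq by (auto simp: step_def unif_def)
  moreover have "run prog orc (s + T) (Run (length (pre @ [Rand b 0])) (st(b := v))) =
    bind_pmf (replicate_pmf s (unif n))
      (\<lambda>xs. run prog orc T (Run (length (pre @ [Rand b 0]) + s) (put (Suc b) xs (st(b := v)))))" for v
    by (rule Suc.IH) (use Suc.prems eq in auto)
  ultimately show ?case
    by (simp add: bind_map_pmf put_Cons bind_assoc_pmf bind_return_pmf)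
qed

text \<open>Jump targets are absolute, hence the parameter \<open>off\<close>, the position of the code; the
  registers \<open>w\<close> and \<open>Suc w\<close> are scratch space.\<close>
fun dtree :: "nat \<Rightarrow> nat \<Rightarrow> (nat \<times> nat) list \<Rightarrow> (bool list \<Rightarrow> bool) \<Rightarrow> 'r instr list" where
  "dtree w off [] G = [if G [] then Accept else Reject]"
| "dtree w off ((x, y) # ts) G =
     (let p = dtree w (off + 4) ts (\<lambda>bs. G (False # bs)) in
      [Sub w x y, Sub (Suc w) y x, Add w w (Suc w), Jz w (off + 4 + length p)] @ p @
      dtree w (off + 4 + length p) ts (\<lambda>bs. G (True # bs)))"

lemma run_final: "run prog orc T Acc = return_pmf Acc" "run prog orc T Rej = return_pmf Rej"
  by (induction T) (auto simp: step_def bind_return_pmf)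

text \<open>The two truncated differences of a pair of registers add up to zero exactly when the
  registers agree. A comparison takes four steps on either branch, and one more step accepts or
  rejects, so the time does not depend on the outcome; the additional \<open>T\<close> steps are
  spent in the final configuration.\<close>

lemma run_dtree:
  assumes "prog = pre @ dtree w (length pre) ts G @ post" "\<forall>(x, y)\<in>set ts. x < w \<and> y < w"
  shows "run prog orc (4 * length ts + Suc T) (Run (length pre) st) =
    return_pmf (if G (map (\<lambda>(x, y). st x = st y) ts) then Acc else Rej)"
  using assms
proof (induction ts arbitrary: G pre post st)
  case Nil
  then show ?case by (auto simp: step_def bind_return_pmf run_final)
next
  case (Cons xy ts)
  obtain x y where xy: "xy = (x, y)" by fastforce
  define p where "p = (dtree w (length pre + 4) ts (\<lambda>bs. G (False # bs)) :: 'a instr list)"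
  define p' where "p' = (dtree w (length pre + 4 + length p) ts (\<lambda>bs. G (True # bs)) :: 'a instr list)"
  define I where "I = ([Sub w x y, Sub (Suc w) y x, Add w w (Suc w), Jz w (length pre + 4 + length p)] :: 'a instr list)"
  have prog: "prog = pre @ I @ p @ p' @ post"
    using Cons.prems(1) unfolding xy p'_def p_def I_def by (simp add: Let_def)
  have lI: "length I = 4" by (simp add: I_def)
  have nth: "prog ! (length pre + i) = I ! i" if "i < 4" for i
    unfolding prog using that lI by (simp add: nth_append)
  have len: "\<not> length prog \<le> length pre + i" if "i < 4" for i
    unfolding prog using that lI by simp
  have w: "x < w" "y < w" using Cons.prems(2) xy by auto
  let ?st = "st(w := st x - st y, Suc w := st y - st x)"
  let ?st' = "?st(w := (st x - st y) + (st y - st x))"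
  have s0: "step prog orc (Run (length pre) st) = return_pmf (Run (length pre + 1) (st(w := st x - st y)))"
    using nth[of 0] len[of 0] by (simp add: step_def I_def)
  have s1: "step prog orc (Run (length pre + 1) (st(w := st x - st y))) = return_pmf (Run (length pre + 2) ?st)"
    using nth[of 1] len[of 1] w by (simp add: step_def I_def)
  have s2: "step prog orc (Run (length pre + 2) ?st) = return_pmf (Run (length pre + 3) ?st')"
    using nth[of 2] len[of 2] by (simp add: step_def I_def)
  have s3: "step prog orc (Run (length pre + 3) ?st') =
      return_pmf (Run (if st x = st y then length pre + 4 + length p else length pre + 4) ?st')"
    using nth[of 3] len[of 3] by (auto simp: step_def I_def)
  have "4 * length (xy # ts) + Suc T = Suc (Suc (Suc (Suc (4 * length ts + Suc T))))" by simp
  then have r: "run prog orc (4 * length (xy # ts) + Suc T) (Run (length pre) st) =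
     run prog orc (4 * length ts + Suc T) (Run (if st x = st y then length pre + 4 + length p else length pre + 4) ?st')"
    by (simp only: run.simps s0 s1 s2 s3 bind_return_pmf)
  have same: "map (\<lambda>(x, y). ?st' x = ?st' y) ts = map (\<lambda>(x, y). st x = st y) ts"
    using Cons.prems(2) by (auto simp: xy)
  have ws: "\<forall>(x, y)\<in>set ts. x < w \<and> y < w" using Cons.prems(2) by simp
  show ?case
  proof (cases "st x = st y")
    case True
    have "run prog orc (4 * length ts + Suc T) (Run (length (pre @ I @ p)) ?st') =
       return_pmf (if G (True # map (\<lambda>(x, y). ?st' x = ?st' y) ts) then Acc else Rej)"
      by (rule Cons.IH[where post = post]) (use ws lI in \<open>auto simp: prog p'_def add.assoc\<close>)
    then show ?thesis unfolding r same using True lI xy by (simp add: add.assoc)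
  next
    case False
    have "run prog orc (4 * length ts + Suc T) (Run (length (pre @ I)) ?st') =
       return_pmf (if G (False # map (\<lambda>(x, y). ?st' x = ?st' y) ts) then Acc else Rej)"
      by (rule Cons.IH[where post = "p' @ post"]) (use ws lI in \<open>auto simp: prog p_def add.assoc\<close>)
    then show ?thesis unfolding r same using False lI xy by (simp add: add.assoc)
  qed
qed

text \<open>For a missing tuple only the flag is prescribed, as \<open>write_answer\<close> leaves
  the other registers of the block unchanged; tuples are read off only behind a flag
  \<open>1\<close>.\<close>

definition answered :: "('r \<Rightarrow> nat \<Rightarrow> nat \<Rightarrow> nat list option) \<Rightarrow> (nat \<Rightarrow> nat) \<Rightarrow> 'r \<Rightarrow> nat \<Rightarrow> nat \<Rightarrow> nat \<Rightarrow> bool" where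
  "answered orc st R i j q \<longleftrightarrow> (case orc R i j of None \<Rightarrow> st q = 0
     | Some t \<Rightarrow> st q = 1 \<and> (\<forall>e<length t. st (q + 1 + e) = t ! e))"

definition block :: "nat \<Rightarrow> nat \<Rightarrow> nat list" where "block q a = [q + 1..<q + 1 + a]"

lemma length_block [simp]: "length (block q a) = a"
  by (simp add: block_def)

lemma nth_block [simp]: "i < a \<Longrightarrow> block q a ! i = q + 1 + i"
  unfolding block_def by (subst nth_upt) auto

lemma set_block [simp]: "y \<in> set (block q a) \<longleftrightarrow> q < y \<and> y \<le> q + a"
  by (auto simp: block_def)

lemma valid_oracle_SomeD:
  assumes "valid_oracle D orc" "orc R i j = Some t" shows "t \<in> db_rel D R" "i \<in> set t" "i < db_size D"
proof -
  obtain m where m: "\<forall>j. orc R i j \<noteq> None \<longleftrightarrow> j < m"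
    "bij_betw (\<lambda>j. the (orc R i j)) {0..<m} {t \<in> db_rel D R. i < db_size D \<and> i \<in> set t}"
    using assms(1) unfolding valid_oracle_def by meson
  have "j < m" using m(1) assms(2) by auto
  then have "the (orc R i j) \<in> {t \<in> db_rel D R. i < db_size D \<and> i \<in> set t}"
    using bij_betw_apply[OF m(2), of j] by simp
  then show "t \<in> db_rel D R" "i \<in> set t" "i < db_size D" using assms(2) by auto
qed

section \<open>What the equality pattern of the explored registers determines\<close>

context bounded_schema begin

text \<open>Allows the exploring program to be run on an arbitrary database, which is how the types
  are shown to be finite in number.\<close>

lemma valid_oracle_exists:
  assumes "bdb D" shows "\<exists>orc. valid_oracle D orc"
proof -
  have "\<exists>xs. set xs = {t \<in> db_rel D R. i < db_size D \<and> i \<in> set t} \<and> distinct xs" for R i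
  proof (rule finite_distinct_list)
    have "finite ((\<lambda>t. (R, t)) ` {t \<in> db_rel D R. i < db_size D \<and> i \<in> set t})"
      by (rule finite_subset[OF _ finite_tuples[OF assms]]) (auto simp: tuples_def)
    then show "finite {t \<in> db_rel D R. i < db_size D \<and> i \<in> set t}"
      by (rule finite_imageD) (auto simp: inj_on_def)
  qed
  then obtain l where l: "\<And>R i. set (l R i) = {t \<in> db_rel D R. i < db_size D \<and> i \<in> set t}" "\<And>R i. distinct (l R i)"
    by metis
  define orc where "orc R i j = (if j < length (l R i) then Some (l R i ! j) else None)" for R i j
  have "bij_betw (\<lambda>j. the (orc R i j)) {0..<length (l R i)} {t \<in> db_rel D R. i < db_size D \<and> i \<in> set t}" for R i
  proof -
    have "bij_betw (\<lambda>j. l R i ! j) {0..<length (l R i)} (set (l R i))"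
      using l(2) by (intro bij_betw_nth) auto
    then show ?thesis unfolding l(1) by (rule bij_betw_cong[THEN iffD1, rotated]) (simp add: orc_def)
  qed
  moreover have "\<forall>j. orc R i j \<noteq> None \<longleftrightarrow> j < length (l R i)" for R i by (simp add: orc_def)
  ultimately show ?thesis unfolding valid_oracle_def by blast
qed

text \<open>At most \<open>d\<close> tuples contain \<open>i\<close>, counted over all relations,
  and the oracle lists those of \<open>R\<close> without gaps or repetitions, so the indices below
  \<open>d\<close> exhaust them.\<close>

lemma valid_oracle_find:
  assumes D: "bdb D" and v: "valid_oracle D orc" and t: "t \<in> db_rel D R" "i \<in> set t"
  obtains j where "j < d" "orc R i j = Some t"
proof -
  have i: "i < db_size D" using bdb_less[OF D t] .
  obtain m where m: "\<forall>j. orc R i j \<noteq> None \<longleftrightarrow> j < m"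
    "bij_betw (\<lambda>j. the (orc R i j)) {0..<m} {t \<in> db_rel D R. i < db_size D \<and> i \<in> set t}"
    using v unfolding valid_oracle_def by meson
  have "m = card {t \<in> db_rel D R. i < db_size D \<and> i \<in> set t}" using bij_betw_same_card[OF m(2)] by simp
  also have "\<dots> = card (Pair R ` {t \<in> db_rel D R. i < db_size D \<and> i \<in> set t})"
    by (rule card_image[symmetric]) (auto simp: inj_on_def)
  also have "\<dots> \<le> card {(R, t). t \<in> db_rel D R \<and> i \<in> set t}"
    by (rule card_mono[OF tuples_at(1)[OF D i]]) auto
  also have "\<dots> \<le> d" using tuples_at(2)[OF D i] .
  finally have md: "m \<le> d" .
  have "t \<in> (\<lambda>j. the (orc R i j)) ` {0..<m}" using m(2) t i unfolding bij_betw_def by auto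
  then obtain j where j: "j < m" "the (orc R i j) = t" by auto
  then have "orc R i j = Some t" using m(1) by (metis option.collapse)
  then show ?thesis using that[of j] j md by simp
qed

text \<open>The registers below \<open>N l\<close> hold in particular all elements at distance at most \<open>l\<close>
  from the explored element.\<close>
definition transcript ::
  "nat \<Rightarrow> (nat \<Rightarrow> nat) \<Rightarrow> ('r \<Rightarrow> nat \<Rightarrow> nat \<Rightarrow> nat) \<Rightarrow> 'r db \<Rightarrow> ('r \<Rightarrow> nat \<Rightarrow> nat \<Rightarrow> nat list option) \<Rightarrow> (nat \<Rightarrow> nat) \<Rightarrow> bool" where
  "transcript r N tgt D orc st \<longleftrightarrow> bdb D \<and> valid_oracle D orc \<and> st 1 = 0 \<and> 1 < N 0 \<and>
     (\<forall>l. N l \<le> N (Suc l)) \<and>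
     (\<forall>l\<le>r. \<forall>x<N l. \<forall>R\<in>\<sigma>. \<forall>j<d. tgt R x j + amax < N (Suc l) \<and> answered orc st R (st x) j (tgt R x j))"

definition same_pattern :: "nat \<Rightarrow> (nat \<Rightarrow> nat) \<Rightarrow> (nat \<Rightarrow> nat) \<Rightarrow> bool" where
  "same_pattern n st st' \<longleftrightarrow> (\<forall>x<n. \<forall>y<n. st x = st y \<longleftrightarrow> st' x = st' y)"

lemma transcript_mono: "transcript r N tgt D orc st \<Longrightarrow> l \<le> l' \<Longrightarrow> N l \<le> N l'"
  unfolding transcript_def using lift_Suc_mono_le[of N] by blast

text \<open>Register \<open>1\<close> holds \<open>0\<close>, so the pattern shows which flags are
  nonzero. A tuple found in \<open>D\<close> therefore forces the same query in \<open>D'\<close> to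
  have returned a tuple too, and both sit in the same block of registers.\<close>

lemma transcript_tuple:
  assumes T: "transcript r N tgt D orc st" "transcript r N tgt D' orc' st'" "same_pattern (N (Suc r)) st st'"
    and l: "l \<le> r" "x < N l" and t: "t \<in> db_rel D R" "st x \<in> set t"
  obtains q where "q + amax < N (Suc l)" "ar R \<le> amax" "t = map st (block q (ar R))"
    "map st' (block q (ar R)) \<in> db_rel D' R" "st' x \<in> set (map st' (block q (ar R)))"
proof -
  have D: "bdb D" "valid_oracle D orc" "bdb D'" "valid_oracle D' orc'" using T by (auto simp: transcript_def)
  have R: "R \<in> \<sigma>" "length t = ar R" using bdb_tupleD[OF D(1) t(1)] by auto
  obtain j where j: "j < d" "orc R (st x) j = Some t" using valid_oracle_find[OF D(1,2) t] .
  define q where "q = tgt R x j"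
  have q: "q + amax < N (Suc l)" "answered orc st R (st x) j q" "answered orc' st' R (st' x) j q"
    using T l R j unfolding transcript_def q_def by auto
  have lt: "q < N (Suc r)" "1 < N (Suc r)"
    using q(1) transcript_mono[OF T(1), of "Suc l" "Suc r"] transcript_mono[OF T(1), of 0 "Suc r"] l T(1)
    by (auto simp: transcript_def)
  have "st q = 1" using q(2) j by (simp add: answered_def)
  then have "st q \<noteq> st 1" using T(1) by (simp add: transcript_def)
  then have "st' q \<noteq> 0" using T lt unfolding same_pattern_def transcript_def by metis
  then obtain t' where t': "orc' R (st' x) j = Some t'" using q(3) by (auto simp: answered_def split: option.splits)
  have tt: "t' \<in> db_rel D' R" "st' x \<in> set t'" using valid_oracle_SomeD[OF D(4) t'] by auto
  have lt': "length t' = ar R" using bdb_tupleD[OF D(3) tt(1)] by auto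
  have "t = map st (block q (ar R))"
    by (rule nth_equalityI) (use q(2) j R in \<open>auto simp: answered_def\<close>)
  moreover have "t' = map st' (block q (ar R))"
    by (rule nth_equalityI) (use q(3) t' lt' in \<open>auto simp: answered_def\<close>)
  ultimately show ?thesis using that q(1) tt ar_le_amax[OF R(1)] by metis
qed

text \<open>All tuples at the content of a register below \<open>N l\<close> are stored below
  \<open>N (Suc l)\<close>, so one step in the Gaifman graph leads from a register of one level to a
  register of the next, simultaneously in both runs.\<close>

lemma transcript_nbhd:
  assumes T: "transcript r N tgt D orc st" "transcript r N tgt D' orc' st'" "same_pattern (N (Suc r)) st st'"
    and x0: "x0 < N 0" "st x0 < db_size D" "st' x0 < db_size D'" and "l \<le> r" "v \<in> nbhd l D (st x0)"
  shows "\<exists>x<N l. st x = v \<and> st' x \<in> nbhd l D' (st' x0)"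
  using \<open>l \<le> r\<close> \<open>v \<in> nbhd l D (st x0)\<close>
proof (induction l arbitrary: v)
  have D: "bdb D" "bdb D'" using T by (auto simp: transcript_def)
  case 0
  then have "v = st x0" using nbhd_reach[OF D(1) x0(2), of 0] by simp
  then show ?case using x0 by auto
next
  have D: "bdb D" "bdb D'" using T by (auto simp: transcript_def)
  case (Suc l)
  show ?case
  proof (cases "v \<in> nbhd l D (st x0)")
    case True
    then obtain x where "x < N l" "st x = v" "st' x \<in> nbhd l D' (st' x0)"
      using Suc.IH[OF _ True] Suc.prems(1) by auto
    moreover have "x < N (Suc l)" using \<open>x < N l\<close> transcript_mono[OF T(1), of l "Suc l"] by simp
    ultimately show ?thesis using nbhd_mono[of l "Suc l" D' "st' x0"] by auto
  next
    case False
    then obtain u where u: "u \<in> nbhd l D (st x0)" "gadj D u v"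
      using Suc.prems nbhd_reach[OF D(1) x0(2)] by (auto simp: reach_Suc)
    obtain x where x: "x < N l" "st x = u" "st' x \<in> nbhd l D' (st' x0)"
      using Suc.IH[OF _ u(1)] Suc.prems(1) by auto
    obtain R t where t: "t \<in> db_rel D R" "u \<in> set t" "v \<in> set t" using u by (auto simp: gadj_def)
    have t2: "st x \<in> set t" using t x by simp
    have "l \<le> r" using Suc.prems by simp
    then obtain q where q: "q + amax < N (Suc l)" "ar R \<le> amax" "t = map st (block q (ar R))"
      "map st' (block q (ar R)) \<in> db_rel D' R" "st' x \<in> set (map st' (block q (ar R)))"
      using transcript_tuple[OF T _ x(1) t(1) t2] by blast
    obtain y where y: "y \<in> set (block q (ar R))" "v = st y" using t(3) q(3) by auto
    have "st' y \<in> nbhd (Suc l) D' (st' x0)"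
      using tuple_in_nbhd[OF D(2) x0(3) q(4,5) x(3), of "Suc l"] y(1) by auto
    moreover have "y < N (Suc l)" using y q by auto
    ultimately show ?thesis using y by auto
  qed
qed

lemma same_pattern_sym: "same_pattern n st st' \<Longrightarrow> same_pattern n st' st"
  by (auto simp: same_pattern_def)

text \<open>The isomorphism sends the content of a register in one run to the content of the same
  register in the other. Agreement of the equalities makes it well defined and injective;
  surjectivity and the backward transfer of tuples use the symmetry between the runs.\<close>

lemma transcript_same_rtype:
  assumes T: "transcript r N tgt D orc st" "transcript r N tgt D' orc' st'" "same_pattern (N (Suc r)) st st'"
    and x0: "x0 < N 0" "st x0 < db_size D" "st' x0 < db_size D'"
  shows "same_rtype r D (st x0) D' (st' x0)"
proof -
  have D: "bdb D" "bdb D'" using T by (auto simp: transcript_def)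
  have pat: "st x = st y \<longleftrightarrow> st' x = st' y" if "x < N (Suc r)" "y < N (Suc r)" for x y
    using T(3) that by (auto simp: same_pattern_def)
  have Nr: "x < N (Suc r)" if "x < N r" for x using that transcript_mono[OF T(1), of r "Suc r"] by simp
  define f where "f v = st' (SOME x. x < N (Suc r) \<and> st x = v)" for v
  have f: "f (st x) = st' x" if "x < N (Suc r)" for x
  proof -
    have "(SOME y. y < N (Suc r) \<and> st y = st x) < N (Suc r) \<and> st (SOME y. y < N (Suc r) \<and> st y = st x) = st x"
      by (rule someI[where x = x]) (use that in simp)
    then show ?thesis unfolding f_def using pat that by blast
  qed
  have fwd: "\<exists>x<N (Suc r). x < N r \<and> st x = v \<and> st' x = f v \<and> f v \<in> nbhd r D' (st' x0)" if "v \<in> nbhd r D (st x0)" for v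
    using transcript_nbhd[OF T x0 order_refl that] f Nr by metis
  have bwd: "\<exists>x<N (Suc r). x < N r \<and> st' x = v \<and> v = f (st x) \<and> st x \<in> nbhd r D (st x0)" if "v \<in> nbhd r D' (st' x0)" for v
    using transcript_nbhd[OF T(2,1) same_pattern_sym[OF T(3)] x0(1,3,2) order_refl that] f Nr by metis
  have "bij_betw f (nbhd r D (st x0)) (nbhd r D' (st' x0))"
    unfolding bij_betw_def
  proof
    show "inj_on f (nbhd r D (st x0))"
    proof (rule inj_onI)
      fix u v assume "u \<in> nbhd r D (st x0)" "v \<in> nbhd r D (st x0)" "f u = f v"
      then show "u = v" using fwd[of u] fwd[of v] pat by metis
    qed
    show "f ` nbhd r D (st x0) = nbhd r D' (st' x0)"
      using fwd bwd by blast
  qed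
  moreover have "f (st x0) = st' x0" using f x0(1) transcript_mono[OF T(1), of 0 "Suc r"] by simp
  moreover have "t \<in> db_rel D R \<longleftrightarrow> map f t \<in> db_rel D' R" if s: "set t \<subseteq> nbhd r D (st x0)" for R t
  proof
    assume t: "t \<in> db_rel D R"
    then obtain u where u: "u \<in> set t" using bdb_tupleD(4)[OF D(1) t] by (metis ex_in_conv)
    then obtain x where x: "x < N r" "st x = u" using fwd s by blast
    have u': "st x \<in> set t" using u x by simp
    obtain q where q: "q + amax < N (Suc r)" "ar R \<le> amax" "t = map st (block q (ar R))"
      "map st' (block q (ar R)) \<in> db_rel D' R"
      using transcript_tuple[OF T order_refl x(1) t u'] by blast
    have "map f t = map st' (block q (ar R))"
      unfolding q(3) using q(1,2) f by auto
    then show "map f t \<in> db_rel D' R" using q(4) by simp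
  next
    assume t: "map f t \<in> db_rel D' R"
    then obtain u where u: "u \<in> set t" using bdb_tupleD(4)[OF D(2) t] by fastforce
    then obtain x where x: "x < N r" "st x = u" "st' x = f u" using fwd s by blast
    have u': "st' x \<in> set (map f t)" using u x by simp
    obtain q where q: "q + amax < N (Suc r)" "ar R \<le> amax" "map f t = map st' (block q (ar R))"
      "map st (block q (ar R)) \<in> db_rel D R"
      using transcript_tuple[OF T(2,1) same_pattern_sym[OF T(3)] order_refl x(1) t u'] by blast
    have len: "length t = ar R" using arg_cong[OF q(3), of length] by simp
    \<comment> \<open>The tuple was located through its image in \<open>D'\<close>. Entries are
      compared there, and the pattern carries each equality of registers back to
      \<open>D\<close>.\<close>
    have "t = map st (block q (ar R))"
    proof (rule nth_equalityI)
      fix i assume i: "i < length t"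
      have y: "q + 1 + i < N (Suc r)" using i len q(1,2) by simp
      obtain z where z: "z < N (Suc r)" "st z = t ! i" "st' z = f (t ! i)" using fwd[of "t ! i"] s i by (meson nth_mem subsetD)
      have "st' z = st' (q + 1 + i)" using arg_cong[OF q(3), of "\<lambda>l. l ! i"] i len z by simp
      then have "st z = st (q + 1 + i)" using pat[OF z(1) y] by simp
      then show "t ! i = map st (block q (ar R)) ! i" using z i len by simp
    qed (use len in simp)
    then show "t \<in> db_rel D R" using q(4) by simp
  qed
  ultimately show ?thesis unfolding same_rtype_def by blast
qed

text \<open>The numbers below \<open>m\<close> occupy known registers, so equality with one of them
  fixes the actual content of a register. For a database with fewer than \<open>m\<close> elements
  the pattern determines the tuples themselves, not just their isomorphism type.\<close>

lemma transcript_small_rel: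
  assumes T: "transcript r N tgt D orc st" "transcript r N tgt D' orc' st'" "same_pattern (N (Suc r)) st st'"
    and m: "\<And>i. i < m \<Longrightarrow> st (Suc i) = i \<and> st' (Suc i) = i" "m < N 0" and sz: "db_size D < m"
  shows "db_rel D R \<subseteq> db_rel D' R"
proof
  fix t assume t: "t \<in> db_rel D R"
  have D: "bdb D" "bdb D'" using T by (auto simp: transcript_def)
  obtain u where u: "u \<in> set t" using bdb_tupleD(4)[OF D(1) t] by (metis ex_in_conv)
  have tm: "i < m" if "i \<in> set t" for i using bdb_less[OF D(1) t that] sz by simp
  have x: "Suc u < N 0" "st (Suc u) \<in> set t" using m tm[OF u] u by auto
  obtain q where q: "q + amax < N (Suc 0)" "ar R \<le> amax" "t = map st (block q (ar R))"
      "map st' (block q (ar R)) \<in> db_rel D' R"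
    using transcript_tuple[OF T le0 x(1) t x(2)] by blast
  have "st y = st' y" if y: "y \<in> set (block q (ar R))" for y
  proof -
    have sy: "st y < m" using tm q(3) y by auto
    have "y < N (Suc r)" using y q(1,2) transcript_mono[OF T(1), of "Suc 0" "Suc r"] by auto
    moreover have "Suc (st y) < N (Suc r)" using sy m(2) transcript_mono[OF T(1), of 0 "Suc r"] by simp
    moreover have "st y = st (Suc (st y))" using m(1)[OF sy] by simp
    ultimately have "st' y = st' (Suc (st y))" using T(3) unfolding same_pattern_def by blast
    then show ?thesis using m(1)[OF sy] by simp
  qed
  then have "map st (block q (ar R)) = map st' (block q (ar R))" by (intro map_cong) auto
  then show "t \<in> db_rel D' R" using q(3,4) by metis
qed

text \<open>Register \<open>0\<close> holds the size; since \<open>db_size D < m\<close>, some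
  constant register equals it, and the pattern transfers this equality to \<open>D'\<close>.\<close>

lemma transcript_small:
  assumes T: "transcript r N tgt D orc st" "transcript r N tgt D' orc' st'" "same_pattern (N (Suc r)) st st'"
    and m: "\<And>i. i < m \<Longrightarrow> st (Suc i) = i \<and> st' (Suc i) = i" "m < N 0"
    and sz: "db_size D < m" "st 0 = db_size D" "st' 0 = db_size D'"
  shows "D = D'"
proof -
  have N: "0 < N (Suc r)" "Suc (db_size D) < N (Suc r)"
    using transcript_mono[OF T(1), of 0 "Suc r"] m(2) sz(1) by auto
  have "st 0 = st (Suc (db_size D))" using m sz by simp
  then have "st' 0 = st' (Suc (db_size D))" using T(3) N unfolding same_pattern_def by blast
  then have eq: "db_size D' = db_size D" using m sz by simp
  have "db_rel D R = db_rel D' R" for R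
    using transcript_small_rel[OF T m sz(1)] transcript_small_rel[OF T(2,1) same_pattern_sym[OF T(3)], of m R] m sz(1) eq
    by (metis subset_antisym)
  then show ?thesis using eq by (intro db.expand) auto
qed

end

section \<open>The exploring program, finiteness of the types, and the program of the tester\<close>

context bounded_schema begin

text \<open>Register \<open>Suc j\<close> holds the number \<open>j\<close> and serves as the index
  operand. Each answer is given \<open>Suc amax\<close> registers: one for the flag, and enough for
  a tuple of any relation.\<close>

fun queries :: "nat \<Rightarrow> ('r \<times> nat \<times> nat) list \<Rightarrow> 'r instr list" where
  "queries N [] = []"
| "queries N ((R, x, j) # qs) = Query R x (Suc j) N # queries (N + Suc amax) qs"

lemma straight_queries: "list_all straight (queries N qs)"
  by (induction N qs rule: queries.induct) auto

lemma answered_cong: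
  assumes "bdb D" "valid_oracle D orc" "R \<in> \<sigma>" "\<And>y. q \<le> y \<Longrightarrow> y \<le> q + amax \<Longrightarrow> st' y = st y"
    and "answered orc st R i j q"
  shows "answered orc st' R i j q"
proof (cases "orc R i j")
  case None
  then show ?thesis using assms(4)[of q] assms(5) by (simp add: answered_def)
next
  case (Some t)
  have "length t \<le> amax"
    using valid_oracle_SomeD(1)[OF assms(2) Some] bdb_tupleD(2)[OF assms(1)] ar_le_amax[OF assms(3)] by metis
  then show ?thesis using assms(4) assms(5) Some by (simp add: answered_def)
qed

lemma exec_queries:
  assumes D: "bdb D" "valid_oracle D orc"
    and qs: "\<And>R x j. (R, x, j) \<in> set qs \<Longrightarrow> R \<in> \<sigma> \<and> x < N \<and> Suc j < N \<and> st (Suc j) = j"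
  shows "(\<forall>y<N. fold (exec1 orc) (queries N qs) st y = st y) \<and>
    (\<forall>i<length qs. case qs ! i of (R, x, j) \<Rightarrow>
       answered orc (fold (exec1 orc) (queries N qs) st) R (st x) j (N + i * Suc amax))"
  using qs
proof (induction N qs arbitrary: st rule: queries.induct)
  case (2 N R x j qs)
  define st1 where "st1 = write_answer N (orc R (st x) (st (Suc j))) st"
  let ?st' = "fold (exec1 orc) (queries (N + Suc amax) qs) st1"
  have q: "R \<in> \<sigma>" "x < N" "Suc j < N" "st (Suc j) = j" using "2.prems"[of R x j] by auto
  have st1: "st1 y = st y" if "y < N" for y
    using that by (auto simp: st1_def write_answer_def split: option.splits)
  have "answered orc st1 R (st x) j N"
    unfolding answered_def st1_def write_answer_def q(4) by (auto split: option.splits)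
  moreover have IH: "(\<forall>y<N + Suc amax. ?st' y = st1 y) \<and>
    (\<forall>i<length qs. case qs ! i of (R, x, j) \<Rightarrow> answered orc ?st' R (st1 x) j (N + Suc amax + i * Suc amax))"
  proof (rule "2.IH")
    fix R x j assume "(R, x, j) \<in> set qs"
    then have "R \<in> \<sigma> \<and> x < N \<and> Suc j < N \<and> st (Suc j) = j" using "2.prems"[of R x j] by simp
    then show "R \<in> \<sigma> \<and> x < N + Suc amax \<and> Suc j < N + Suc amax \<and> st1 (Suc j) = j" using st1 by simp
  qed
  ultimately have a: "answered orc ?st' R (st x) j N"
    by (intro answered_cong[OF D q(1), of N ?st' st1]) auto
  have fold: "fold (exec1 orc) (queries N ((R, x, j) # qs)) st = ?st'" by (simp add: st1_def)
  show ?case unfolding fold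
  proof (intro conjI allI impI)
    fix y assume "y < N" then show "?st' y = st y" using IH st1 by simp
  next
    fix i assume i: "i < length ((R, x, j) # qs)"
    show "case ((R, x, j) # qs) ! i of (R, x, j) \<Rightarrow> answered orc ?st' R (st x) j (N + i * Suc amax)"
    proof (cases i)
      case 0 then show ?thesis using a by simp
    next
      case (Suc i')
      obtain R' x' j' where e: "qs ! i' = (R', x', j')" by (metis prod_cases3)
      have "(R', x', j') \<in> set qs" using e i Suc by (metis Suc_less_eq length_Cons nth_mem)
      then have "x' < N" using "2.prems"[of R' x' j'] by simp
      then show ?thesis using IH Suc i e st1[of x'] by (auto simp: algebra_simps)
    qed
  qed
qed simp

text \<open>Every register is used in queries only once: the first of \<open>L\<close> rounds treats those in
  \<open>{lo..<hi}\<close>, and each later round those written by the round before it.\<close>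
definition explores ::
  "nat \<Rightarrow> nat \<Rightarrow> nat \<Rightarrow> 'r instr list \<Rightarrow> (nat \<Rightarrow> nat) \<Rightarrow> ('r \<Rightarrow> nat \<Rightarrow> nat \<Rightarrow> nat) \<Rightarrow> bool" where
  "explores L lo hi p N tgt \<longleftrightarrow> list_all straight p \<and> N 0 = hi \<and> (\<forall>l. N l \<le> N (Suc l)) \<and>
     (\<forall>D orc st. bdb D \<longrightarrow> valid_oracle D orc \<longrightarrow> (\<forall>j<d. Suc j < hi \<and> st (Suc j) = j) \<longrightarrow>
       (\<forall>y<hi. fold (exec1 orc) p st y = st y) \<and>
       (\<forall>l<L. \<forall>x<N l. lo \<le> x \<longrightarrow> (\<forall>R\<in>\<sigma>. \<forall>j<d. tgt R x j + amax < N (Suc l) \<and>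
          answered orc (fold (exec1 orc) p st) R (fold (exec1 orc) p st x) j (tgt R x j))))"

text \<open>The window of registers is generalised in the induction: after all queries for
  \<open>{lo..<hi}\<close>, the induction hypothesis is applied to the registers
  \<open>{hi..<hi'}\<close> just reserved for the answers. Flags and constants are explored as if
  they were elements, which is possible because the oracle answers for every number.\<close>

lemma explore_exists: "\<exists>p N tgt. explores L lo hi p N tgt"
proof (induction L arbitrary: lo hi)
  case 0
  have "explores 0 lo hi [] (\<lambda>_. hi) (\<lambda>_ _ _. 0)" by (simp add: explores_def)
  then show ?case by blast
next
  case (Suc L)
  obtain sl where sl: "set sl = \<sigma>" using finite_list[OF finite_sigma] by blast
  define qs where "qs = List.product sl (List.product [lo..<hi] [0..<d])"
  define hi' where "hi' = hi + length qs * Suc amax"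
  define idx where "idx R x j = (SOME i. i < length qs \<and> qs ! i = (R, x, j))" for R x j
  define tgt1 where "tgt1 R x j = hi + idx R x j * Suc amax" for R x j
  have idx: "idx R x j < length qs \<and> qs ! idx R x j = (R, x, j)" if "R \<in> \<sigma>" "lo \<le> x" "x < hi" "j < d" for R x j
  proof -
    have "(R, x, j) \<in> set qs" using that sl by (simp add: qs_def)
    then have "\<exists>i. i < length qs \<and> qs ! i = (R, x, j)" by (simp add: in_set_conv_nth)
    then show ?thesis unfolding idx_def by (rule someI_ex)
  qed
  obtain p2 N2 tgt2 where "explores L hi hi' p2 N2 tgt2" using Suc by blast
  note IH = this[unfolded explores_def, THEN conjunct1] this[unfolded explores_def, THEN conjunct2, THEN conjunct1]
    this[unfolded explores_def, THEN conjunct2, THEN conjunct2, THEN conjunct1, THEN spec]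
    this[unfolded explores_def, THEN conjunct2, THEN conjunct2, THEN conjunct2, THEN spec, THEN spec, THEN spec, THEN mp, THEN mp, THEN mp]
  define p where "p = queries hi qs @ p2"
  define N where "N l = (case l of 0 \<Rightarrow> hi | Suc l' \<Rightarrow> N2 l')" for l
  define tgt where "tgt R x j = (if x < hi then tgt1 R x j else tgt2 R x j)" for R x j
  have Nm: "N l \<le> N (Suc l)" for l using IH(2,3) by (cases l) (auto simp: N_def hi'_def)
  have N2m: "hi' \<le> N2 l" for l using lift_Suc_mono_le[of N2 0 l] IH(2,3) by simp
  have t1: "tgt1 R x j + amax < hi'" if "R \<in> \<sigma>" "lo \<le> x" "x < hi" "j < d" for R x j
  proof -
    have "idx R x j * Suc amax + Suc amax \<le> length qs * Suc amax"
      using idx[OF that] mult_le_mono1[of "Suc (idx R x j)" "length qs" "Suc amax"] by simp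
    then show ?thesis by (simp add: tgt1_def hi'_def)
  qed
  have "explores (Suc L) lo hi p N tgt"
    unfolding explores_def
  proof (intro conjI)
    show "list_all straight p" using IH(1) straight_queries by (simp add: p_def)
    show "N 0 = hi" by (simp add: N_def)
    show "\<forall>l. N l \<le> N (Suc l)" using Nm by blast
    show "\<forall>D orc st. bdb D \<longrightarrow> valid_oracle D orc \<longrightarrow> (\<forall>j<d. Suc j < hi \<and> st (Suc j) = j) \<longrightarrow>
       (\<forall>y<hi. fold (exec1 orc) p st y = st y) \<and>
       (\<forall>l<Suc L. \<forall>x<N l. lo \<le> x \<longrightarrow> (\<forall>R\<in>\<sigma>. \<forall>j<d. tgt R x j + amax < N (Suc l) \<and>
          answered orc (fold (exec1 orc) p st) R (fold (exec1 orc) p st x) j (tgt R x j)))"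
    proof (intro allI impI)
      fix D orc and st :: "nat \<Rightarrow> nat"
      assume D: "bdb D" "valid_oracle D orc" and st: "\<forall>j<d. Suc j < hi \<and> st (Suc j) = j"
      define st1 where "st1 = fold (exec1 orc) (queries hi qs) st"
      define st2 where "st2 = fold (exec1 orc) p2 st1"
      have st2: "fold (exec1 orc) p st = st2" by (simp add: p_def st2_def st1_def)
      have e: "(\<forall>y<hi. st1 y = st y) \<and> (\<forall>i<length qs. case qs ! i of (R, x, j) \<Rightarrow>
          answered orc st1 R (st x) j (hi + i * Suc amax))"
        unfolding st1_def by (rule exec_queries[OF D]) (use sl st in \<open>auto simp: qs_def\<close>)
      have "\<forall>j<d. Suc j < hi' \<and> st1 (Suc j) = j" using e st by (auto simp: hi'_def)
      from IH(4)[OF D this] have i: "\<forall>y<hi'. st2 y = st1 y"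
        "\<And>l x R j. l < L \<Longrightarrow> x < N2 l \<Longrightarrow> hi \<le> x \<Longrightarrow> R \<in> \<sigma> \<Longrightarrow> j < d \<Longrightarrow> tgt2 R x j + amax < N2 (Suc l) \<and>
          answered orc st2 R (st2 x) j (tgt2 R x j)"
        by (auto simp: st2_def)
      show "(\<forall>y<hi. fold (exec1 orc) p st y = st y) \<and>
       (\<forall>l<Suc L. \<forall>x<N l. lo \<le> x \<longrightarrow> (\<forall>R\<in>\<sigma>. \<forall>j<d. tgt R x j + amax < N (Suc l) \<and>
          answered orc (fold (exec1 orc) p st) R (fold (exec1 orc) p st x) j (tgt R x j)))"
        unfolding st2
      proof (intro conjI allI impI ballI)
        fix y assume "y < hi" then show "st2 y = st y" using i e by (simp add: hi'_def)
      next
        fix l x R j assume l: "l < Suc L" "x < N l" "lo \<le> x" "R \<in> \<sigma>" "j < d"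
        have "tgt R x j + amax < N (Suc l) \<and> answered orc st2 R (st2 x) j (tgt R x j)"
        proof (cases "x < hi")
          case True
          note t = t1[OF l(4,3) True l(5)]
          have "case qs ! idx R x j of (R', x', j') \<Rightarrow> answered orc st1 R' (st x') j' (hi + idx R x j * Suc amax)"
            by (rule conjunct2[OF e, THEN spec, THEN mp, OF conjunct1[OF idx[OF l(4,3) True l(5)]]])
          then have "answered orc st1 R (st x) j (tgt1 R x j)"
            using idx[OF l(4,3) True l(5)] by (simp add: tgt1_def)
          then have "answered orc st2 R (st x) j (tgt1 R x j)"
            using answered_cong[OF D l(4), of "tgt1 R x j" st2 st1] i(1) t by simp
          moreover have "st2 x = st x" using True i e by (simp add: hi'_def)
          moreover have "tgt1 R x j + amax < N (Suc l)" using t N2m[of l] by (simp add: N_def)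
          ultimately show ?thesis using True by (simp add: tgt_def)
        next
          case False
          then obtain l' where l': "l = Suc l'" using l(2) by (cases l) (auto simp: N_def)
          show ?thesis using i(2)[of l' x R j] l l' False by (simp add: tgt_def N_def)
        qed
        then show "tgt R x j + amax < N (Suc l)" "answered orc st2 R (st2 x) j (tgt R x j)" by auto
      qed
    qed
  qed
  then show ?case by blast
qed

lemma exploresD:
  assumes ex: "explores (Suc r) 0 hi p N tgt"
  shows "list_all straight p" "N 0 = hi"
    "bdb D \<Longrightarrow> valid_oracle D orc \<Longrightarrow> \<forall>j<d. Suc j < hi \<and> st (Suc j) = j \<Longrightarrow> st 1 = 0 \<Longrightarrow> 1 < hi \<Longrightarrow>
       transcript r N tgt D orc (fold (exec1 orc) p st)"
    "bdb D \<Longrightarrow> valid_oracle D orc \<Longrightarrow> \<forall>j<d. Suc j < hi \<and> st (Suc j) = j \<Longrightarrow> y < hi \<Longrightarrow>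
       fold (exec1 orc) p st y = st y"
proof -
  note p = ex[unfolded explores_def, THEN conjunct1] ex[unfolded explores_def, THEN conjunct2, THEN conjunct1]
    ex[unfolded explores_def, THEN conjunct2, THEN conjunct2, THEN conjunct1, THEN spec]
    ex[unfolded explores_def, THEN conjunct2, THEN conjunct2, THEN conjunct2, THEN spec, THEN spec, THEN spec, THEN mp, THEN mp, THEN mp]
  show "list_all straight p" "N 0 = hi" using p(1,2) by auto
  show "transcript r N tgt D orc (fold (exec1 orc) p st)"
    if D: "bdb D" "valid_oracle D orc" "\<forall>j<d. Suc j < hi \<and> st (Suc j) = j" and st: "st 1 = 0" "1 < hi"
  proof -
    have "fold (exec1 orc) p st 1 = 0" using p(4)[OF D] st by simp
    then show ?thesis unfolding transcript_def using D st p(2,3) p(4)[OF D] by (simp add: less_Suc_eq_le)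
  qed
  show "fold (exec1 orc) p st y = st y"
    if "bdb D" "valid_oracle D orc" "\<forall>j<d. Suc j < hi \<and> st (Suc j) = j" "y < hi"
    using p(4)[OF that(1-3)] that(4) by simp
qed

definition types :: "nat \<Rightarrow> ('r db \<times> nat) set set" where
  "types r = {rtype \<sigma> ar r D a | D a. bdb D \<and> a < db_size D}"

lemma rtype_in_types: "bdb D \<Longrightarrow> a < db_size D \<Longrightarrow> rtype \<sigma> ar r D a \<in> types r"
  by (auto simp: types_def)

text \<open>The exploration of \<open>(D, a)\<close> has an equality pattern on a number of
  registers that depends only on \<open>r\<close>, and equal patterns imply equal types. Choosing
  one pattern for each type embeds the types into the finite set of such patterns.\<close>

lemma finite_types: "finite (types r)"
proof -
  define hi where "hi = d + 3"
  obtain p N tgt where "explores (Suc r) 0 hi p N tgt" using explore_exists by blast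
  note p = exploresD[OF this]
  \<comment> \<open>Registers \<open>1\<close> to \<open>d + 1\<close> hold the numbers
    \<open>0\<close> to \<open>d\<close>, which serve as query indices and as the zero for testing
    flags; register \<open>d + 2\<close> holds the explored element.\<close>
  define st0 where "st0 a = (\<lambda>x. if x = d + 2 then a else x - 1)" for a :: nat
  define orc where "orc D = (SOME orc. valid_oracle D orc)" for D :: "'r db"
  define st where "st D a = fold (exec1 (orc D)) p (st0 a)" for D a
  define pat where "pat D a = {(x, y). x < N (Suc r) \<and> y < N (Suc r) \<and> st D a x = st D a y}" for D a
  have o: "valid_oracle D (orc D)" if "bdb D" for D
    unfolding orc_def using valid_oracle_exists[OF that] by (rule someI_ex)
  have c: "\<forall>j<d. Suc j < hi \<and> st0 a (Suc j) = j" "st0 a 1 = 0" "1 < hi" for a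
    by (auto simp: st0_def hi_def)
  have T: "transcript r N tgt D (orc D) (st D a)" "st D a (d + 2) = a" if "bdb D" for D a
  proof -
    show "transcript r N tgt D (orc D) (st D a)" unfolding st_def by (rule p(3)[OF that o[OF that] c])
    have "st D a (d + 2) = st0 a (d + 2)" unfolding st_def
      by (rule p(4)[OF that o[OF that] c(1)]) (simp add: hi_def)
    then show "st D a (d + 2) = a" by (simp add: st0_def)
  qed
  have "rtype \<sigma> ar r D a = rtype \<sigma> ar r D' a'"
    if D: "bdb D" "a < db_size D" "bdb D'" "a' < db_size D'" and e: "pat D a = pat D' a'" for D a D' a'
  proof -
    have "(x, y) \<in> pat D a \<longleftrightarrow> (x, y) \<in> pat D' a'" for x y using e by simp
    then have "same_pattern (N (Suc r)) (st D a) (st D' a')" by (auto simp: same_pattern_def pat_def)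
    then have "same_rtype r D (st D a (d + 2)) D' (st D' a' (d + 2))"
      by (rule transcript_same_rtype[OF T(1)[OF D(1)] T(1)[OF D(3)]]) (use D T(2) p(2) in \<open>auto simp: hi_def\<close>)
    then show ?thesis using T(2) D rtype_eq_iff by simp
  qed
  note inj = this
  define g where "g \<tau> = (SOME Q. \<exists>D a. bdb D \<and> a < db_size D \<and> rtype \<sigma> ar r D a = \<tau> \<and> Q = pat D a)" for \<tau>
  have g: "\<exists>D a. bdb D \<and> a < db_size D \<and> rtype \<sigma> ar r D a = \<tau> \<and> g \<tau> = pat D a" if "\<tau> \<in> types r" for \<tau>
  proof -
    have "\<exists>Q D a. bdb D \<and> a < db_size D \<and> rtype \<sigma> ar r D a = \<tau> \<and> Q = pat D a"
      using that unfolding types_def by blast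
    then show ?thesis unfolding g_def by (rule someI_ex)
  qed
  have "inj_on g (types r)"
  proof (rule inj_onI)
    fix \<tau> \<tau>' assume t: "\<tau> \<in> types r" "\<tau>' \<in> types r" "g \<tau> = g \<tau>'"
    obtain D a where 1: "bdb D" "a < db_size D" "rtype \<sigma> ar r D a = \<tau>" "g \<tau> = pat D a" using g[OF t(1)] by blast
    obtain D' a' where 2: "bdb D'" "a' < db_size D'" "rtype \<sigma> ar r D' a' = \<tau>'" "g \<tau>' = pat D' a'" using g[OF t(2)] by blast
    show "\<tau> = \<tau>'" using inj[OF 1(1,2) 2(1,2)] 1 2 t(3) by simp
  qed
  moreover have "g ` types r \<subseteq> Pow ({..<N (Suc r)} \<times> {..<N (Suc r)})"
    using g by (fastforce simp: pat_def)
  ultimately show ?thesis by (meson finite_imageD finite_subset finite_Pow_iff finite_SigmaI finite_lessThan)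
qed

lemma fold_const:
  "fold (exec1 orc) (map (\<lambda>i. Const (Suc i) i) [0..<m]) st =
    (\<lambda>x. if 0 < x \<and> x \<le> m then x - 1 else st x)"
proof (induction m)
  case (Suc m)
  show ?case by (rule ext) (auto simp: Suc)
qed auto

text \<open>The equality pattern of finitely many registers determines the sampled types and, below
  size \<open>m\<close>, the database itself. A decision that depends on these alone can be stored
  in a finite decision tree, whatever \<open>P\<close> and \<open>\<Phi>\<close> are.\<close>

lemma tester_program:
  assumes C: "\<forall>D\<in>C. bdb D" and m: "1 \<le> m" "d \<le> m"
  shows "\<exists>prog T. \<forall>D orc. D \<in> C \<longrightarrow> valid_oracle D orc \<longrightarrow>
    run prog orc T (init (db_size D)) =
      map_pmf (\<lambda>xs. if (if db_size D < m then D \<in> P else \<Phi> (map (rtype \<sigma> ar r D) xs)) then Acc else Rej)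
        (replicate_pmf s (unif (db_size D)))"
proof -
  \<comment> \<open>Layout: register \<open>0\<close> holds the size, registers \<open>1\<close> to
    \<open>m\<close> the numbers below \<open>m\<close>, and the next \<open>s\<close> registers the
    samples.\<close>
  define hi where "hi = Suc m + s"
  obtain p N tgt where "explores (Suc r) 0 hi p N tgt" using explore_exists by blast
  note p = exploresD[OF this]
  define st1 where "st1 n = (\<lambda>x::nat. if 0 < x \<and> x \<le> m then x - 1 else if x = 0 then n else 0)" for n :: nat
  define fin where "fin D orc xs = fold (exec1 orc) p (put (Suc m) xs (st1 (db_size D)))" for D :: "'r db" and orc xs
  define acc where "acc D xs \<longleftrightarrow> (if db_size D < m then D \<in> P else \<Phi> (map (rtype \<sigma> ar r D) xs))" for D xs
  define ts where "ts = List.product [0..<N (Suc r)] [0..<N (Suc r)]"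
  define pat where "pat st = map (\<lambda>(x, y). st x = st y) ts" for st :: "nat \<Rightarrow> nat"
  \<comment> \<open>On an empty domain the samples are the default \<open>0\<close>, which is not an
    element, hence the guard.\<close>
  define ok where "ok D orc xs \<longleftrightarrow> D \<in> C \<and> valid_oracle D orc \<and> length xs = s \<and>
    (0 < db_size D \<longrightarrow> set xs \<subseteq> {..<db_size D})" for D orc xs
  \<comment> \<open>The table accepts a pattern if some accepted input produces it. This is
    consistent because two inputs with the same pattern receive the same decision.\<close>
  define G where "G bs \<longleftrightarrow> (\<exists>D orc xs. ok D orc xs \<and> pat (fin D orc xs) = bs \<and> acc D xs)" for bs
  have init_regs: "\<forall>j<d. Suc j < hi \<and> put (Suc m) xs (st1 n) (Suc j) = j" "put (Suc m) xs (st1 n) 1 = 0" "1 < hi"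
    for xs n using m by (auto simp: hi_def put_def st1_def)
  have fin_trans: "transcript r N tgt D orc (fin D orc xs)" if "ok D orc xs" for D orc xs
    using p(3)[OF _ _ init_regs] that C unfolding fin_def ok_def by blast
  have fin_low: "fin D orc xs y = put (Suc m) xs (st1 (db_size D)) y" if "ok D orc xs" "y < hi" for D orc xs y
    using p(4)[OF _ _ init_regs(1)] that C unfolding fin_def ok_def by blast
  have fin_const: "fin D orc xs (Suc i) = i" "fin D orc xs 0 = db_size D" if "ok D orc xs" "i < m" for D orc xs i
    using fin_low[OF that(1), of "Suc i"] fin_low[OF that(1), of 0] that by (auto simp: put_def st1_def hi_def)
  have fin_samp: "fin D orc xs (Suc m + i) = xs ! i" if "ok D orc xs" "i < s" for D orc xs i
    using fin_low[OF that(1), of "Suc m + i"] that by (auto simp: put_def hi_def ok_def)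
  have G: "G (pat (fin D orc xs)) \<longleftrightarrow> acc D xs" if ok: "ok D orc xs" for D orc xs
  proof
    assume "acc D xs" then show "G (pat (fin D orc xs))" using ok unfolding G_def by blast
  next
    assume "G (pat (fin D orc xs))"
    then obtain D' orc' xs' where ok': "ok D' orc' xs'" and pe: "pat (fin D' orc' xs') = pat (fin D orc xs)" and acc': "acc D' xs'"
      unfolding G_def by blast
    have sp: "same_pattern (N (Suc r)) (fin D orc xs) (fin D' orc' xs')"
      unfolding same_pattern_def
    proof (intro allI impI)
      fix x y assume "x < N (Suc r)" "y < N (Suc r)"
      then have "(x, y) \<in> set ts" by (simp add: ts_def)
      then show "(fin D orc xs x = fin D orc xs y) = (fin D' orc' xs' x = fin D' orc' xs' y)"
        using pe unfolding pat_def map_eq_conv by fastforce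
    qed
    note T = fin_trans[OF ok] fin_trans[OF ok']
    have mN: "m < N 0" using p(2) by (simp add: hi_def)
    have cst: "fin D orc xs (Suc i) = i \<and> fin D' orc' xs' (Suc i) = i" if "i < m" for i
      using fin_const(1) ok ok' that by blast
    have m0: "0 < m" using m by simp
    have small: "D = D'" if "db_size D < m \<or> db_size D' < m"
      using that
    proof
      assume "db_size D < m"
      then show ?thesis using transcript_small[OF T sp cst mN] fin_const(2)[OF ok m0] fin_const(2)[OF ok' m0] by blast
    next
      assume "db_size D' < m"
      then have "D' = D" using transcript_small[OF T(2,1) same_pattern_sym[OF sp] _ mN] cst fin_const(2)[OF ok m0] fin_const(2)[OF ok' m0] by blast
      then show ?thesis by simp
    qed
    show "acc D xs"
    proof (cases "db_size D < m \<or> db_size D' < m")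
      case True
      then show ?thesis using small acc' by (auto simp: acc_def)
    next
      case False
      have l: "length xs = s" "length xs' = s" using ok ok' by (auto simp: ok_def)
      have lt: "xs ! i < db_size D" "xs' ! i < db_size D'" if "i < s" for i
        using ok ok' False m l that nth_mem[of i xs] nth_mem[of i xs'] by (auto simp: ok_def subset_iff)
      have "map (rtype \<sigma> ar r D) xs = map (rtype \<sigma> ar r D') xs'"
      proof (rule nth_equalityI)
        fix i assume "i < length (map (rtype \<sigma> ar r D) xs)"
        then have i: "i < s" using l by simp
        have "same_rtype r D (fin D orc xs (Suc m + i)) D' (fin D' orc' xs' (Suc m + i))"
          by (rule transcript_same_rtype[OF T sp])
            (use i lt[OF i] p(2) fin_samp[OF ok i] fin_samp[OF ok' i] in \<open>auto simp: hi_def\<close>)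
        then have "rtype \<sigma> ar r D (xs ! i) = rtype \<sigma> ar r D' (xs' ! i)"
          using rtype_eq_iff[of D "xs ! i" D' "xs' ! i"] C ok ok' lt[OF i] fin_samp[OF ok i] fin_samp[OF ok' i]
          by (auto simp: ok_def)
        then show "map (rtype \<sigma> ar r D) xs ! i = map (rtype \<sigma> ar r D') xs' ! i" using i l by simp
      qed (use l in simp)
      then show ?thesis using False acc' by (auto simp: acc_def)
    qed
  qed
  define c where "c = map (\<lambda>i. Const (Suc i) i :: 'r instr) [0..<m]"
  define rnd where "rnd = map (\<lambda>i. Rand i 0 :: 'r instr) [Suc m..<Suc m + s]"
  have lr: "length rnd = s" unfolding rnd_def by (simp only: length_map length_upt diff_add_inverse)
  define dt where "dt = (dtree (N (Suc r)) (length (c @ rnd @ p)) ts G :: 'r instr list)"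
  define prog where "prog = c @ rnd @ p @ dt"
  define T where "T = length c + (s + (length p + (4 * length ts + Suc 0)))"
  have "run prog orc T (init (db_size D)) =
      map_pmf (\<lambda>xs. if acc D xs then Acc else Rej) (replicate_pmf s (unif (db_size D)))"
    if D: "D \<in> C" and orc: "valid_oracle D orc" for D orc
  proof -
    let ?n = "db_size D"
    have "run prog orc T (init ?n) =
        run prog orc (s + (length p + (4 * length ts + Suc 0))) (Run (length ([]::'r instr list) + length c) (fold (exec1 orc) c (\<lambda>x. if x = 0 then ?n else 0)))"
      using run_straight[of c prog "[]" "rnd @ p @ dt" orc "s + (length p + (4 * length ts + Suc 0))" "\<lambda>x. if x = 0 then ?n else 0"]
      by (auto simp: T_def init_def prog_def c_def list_all_iff)
    also have "fold (exec1 orc) c (\<lambda>x. if x = 0 then ?n else 0) = st1 ?n"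
      unfolding c_def fold_const st1_def by auto
    also have "run prog orc (s + (length p + (4 * length ts + Suc 0))) (Run (length ([]::'r instr list) + length c) (st1 ?n)) =
       bind_pmf (replicate_pmf s (unif ?n)) (\<lambda>xs. run prog orc (length p + (4 * length ts + Suc 0)) (Run (length c + s) (put (Suc m) xs (st1 ?n))))"
      using run_rand[of prog c "Suc m" s "p @ dt" "st1 ?n" ?n orc "length p + (4 * length ts + Suc 0)"]
      by (simp add: prog_def rnd_def st1_def)
    also have "\<dots> = bind_pmf (replicate_pmf s (unif ?n)) (\<lambda>xs. return_pmf (if acc D xs then Acc else Rej))"
    proof (rule bind_pmf_cong[OF refl])
      fix xs assume xs: "xs \<in> set_pmf (replicate_pmf s (unif ?n))"
      have ok: "ok D orc xs"
        using xs D orc unfolding set_replicate_pmf ok_def unif_def by (auto simp: in_lists_conv_set subset_iff)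
      have "run prog orc (length p + (4 * length ts + Suc 0)) (Run (length c + s) (put (Suc m) xs (st1 ?n))) =
          run prog orc (4 * length ts + Suc 0) (Run (length c + s + length p) (fin D orc xs))"
        using run_straight[of p prog "c @ rnd" dt orc "4 * length ts + Suc 0" "put (Suc m) xs (st1 ?n)"] p(1)
        by (simp only: fin_def length_append lr prog_def append_assoc simp_thms)
      also have "\<dots> = return_pmf (if G (pat (fin D orc xs)) then Acc else Rej)"
        using run_dtree[of prog "c @ rnd @ p" "N (Suc r)" ts G "[]" orc 0 "fin D orc xs"]
        by (auto simp: prog_def dt_def pat_def ts_def lr add.assoc simp del: run.simps)
      finally show "run prog orc (length p + (4 * length ts + Suc 0)) (Run (length c + s) (put (Suc m) xs (st1 ?n))) =
          return_pmf (if acc D xs then Acc else Rej)" using G[OF ok] by simp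
    qed
    finally show ?thesis by (simp add: map_pmf_def)
  qed
  then show ?thesis unfolding acc_def by blast
qed

end

section \<open>Histograms under carving\<close>

lemma card_diff_le:
  assumes "finite W" "A - B \<subseteq> W" "B - A \<subseteq> W" "finite A" "finite B"
  shows "\<bar>real (card A) - real (card B)\<bar> \<le> real (card W)"
proof -
  have "card A \<le> card (B \<union> W)" by (rule card_mono) (use assms in auto)
  moreover have "card B \<le> card (A \<union> W)" by (rule card_mono) (use assms in auto)
  moreover have "card (B \<union> W) \<le> card B + card W" "card (A \<union> W) \<le> card A + card W" by (rule card_Un_le)+
  ultimately show ?thesis by linarith
qed

context bounded_schema begin

lemma sum_by_type:
  fixes g :: "('r db \<times> nat) set \<Rightarrow> real"
  assumes "bdb D"
  shows "(\<Sum>v<db_size D. g (rtype \<sigma> ar r D v)) = (\<Sum>\<tau>\<in>types r. real (histogram \<sigma> ar r D \<tau>) * g \<tau>)"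
proof -
  have "(\<Sum>v<db_size D. g (rtype \<sigma> ar r D v)) =
      (\<Sum>\<tau>\<in>types r. \<Sum>v\<in>{v\<in>{..<db_size D}. rtype \<sigma> ar r D v = \<tau>}. g (rtype \<sigma> ar r D v))"
    by (rule sum.group[symmetric]) (use finite_types rtype_in_types[OF assms] in auto)
  also have "\<dots> = (\<Sum>\<tau>\<in>types r. real (histogram \<sigma> ar r D \<tau>) * g \<tau>)"
    by (rule sum.cong) (auto simp: histogram_def lessThan_def)
  finally show ?thesis .
qed

lemma sum_histogram:
  assumes "bdb D" shows "(\<Sum>\<tau>\<in>types r. real (histogram \<sigma> ar r D \<tau>)) = real (db_size D)"
  using sum_by_type[OF assms, of "\<lambda>_. 1" r] by simp

definition close :: "nat \<Rightarrow> real \<Rightarrow> 'r db \<Rightarrow> 'r db \<Rightarrow> bool" where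
  "close r \<theta> D D' \<longleftrightarrow>
    (\<forall>\<tau>\<in>types r. \<bar>real (histogram \<sigma> ar r D \<tau>) - real (histogram \<sigma> ar r D' \<tau>)\<bar> \<le> \<theta>)"

end

section \<open>Expectation and concentration of the histogram after one round\<close>

context carving begin

lemma carve_same_rtype:
  assumes D: "bdb D" "v < db_size D" "bdb D'" "v' < db_size D'" and f: "ball_iso (r + k + 3) D v D' v' f"
    and col: "\<And>x. x \<in> nbhd (r + k + 3) D v \<Longrightarrow> x \<in> c \<longleftrightarrow> f x \<in> c'"
  shows "rtype \<sigma> ar r (carve D c) v = rtype \<sigma> ar r (carve D' c') v'"
proof -
  have "ball_iso r (carve D c) v (carve D' c') v' f" by (rule ball_iso_carve[OF D f col]) auto
  then have "same_rtype r (carve D c) v (carve D' c') v'" by (auto simp: same_rtype_iff)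
  then show ?thesis using rtype_eq_iff[of "carve D c" v "carve D' c'" v' r] bdb_carve D by simp
qed

lemma carve_rtype_local:
  assumes D: "bdb D" "v < db_size D" and "c \<inter> nbhd (r + k + 3) D v = c' \<inter> nbhd (r + k + 3) D v"
  shows "rtype \<sigma> ar r (carve D c) v = rtype \<sigma> ar r (carve D c') v"
  by (rule carve_same_rtype[OF D D ball_iso_refl]) (use assms(3) in auto)

definition carve_freq :: "nat \<Rightarrow> 'r db \<Rightarrow> nat \<Rightarrow> ('r db \<times> nat) set \<Rightarrow> real" where
  "carve_freq r D v \<tau> = real (card {c\<in>Pow {..<db_size D}. rtype \<sigma> ar r (carve D c) v = \<tau>}) / 2 ^ db_size D"

text \<open>The colours beyond radius \<open>r + k + 3\<close> cancel out, which makes databases of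
  different sizes comparable.\<close>

lemma carve_freq_local:
  fixes r :: nat
  assumes D: "bdb D" "v < db_size D"
  defines "A \<equiv> nbhd (r + k + 3) D v"
  shows "carve_freq r D v \<tau> = real (card {c\<in>Pow A. rtype \<sigma> ar r (carve D c) v = \<tau>}) / 2 ^ card A"
proof -
  have AV: "A \<subseteq> {..<db_size D}" using nbhd_less by (auto simp: A_def)
  have finA: "finite A" by (simp add: A_def)
  have "card {c\<in>Pow {..<db_size D}. rtype \<sigma> ar r (carve D c) v = \<tau>} =
      card {c\<in>Pow A. rtype \<sigma> ar r (carve D c) v = \<tau>} * 2 ^ card ({..<db_size D} - A)"
  proof (rule card_Pow_local[OF _ AV])
    fix c
    show "rtype \<sigma> ar r (carve D c) v = \<tau> \<longleftrightarrow> rtype \<sigma> ar r (carve D (c \<inter> A)) v = \<tau>"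
      using carve_rtype_local[OF D, of c r "c \<inter> A"] by (simp add: A_def inf_assoc)
  qed simp
  moreover have "db_size D = card ({..<db_size D} - A) + card A"
    using card_Diff_subset[OF finA AV] card_mono[OF _ AV] by simp
  then have "(2::real) ^ db_size D = 2 ^ card ({..<db_size D} - A) * 2 ^ card A"
    by (metis power_add)
  ultimately show ?thesis by (simp add: carve_freq_def)
qed

text \<open>Images under a ball isomorphism match the colourings of the two balls, and by
  \<open>carve_same_rtype\<close> matched colourings lead to the same type.\<close>

lemma carve_freq_cong:
  assumes D: "bdb D" "v < db_size D" "bdb D'" "v' < db_size D'"
    and eq: "rtype \<sigma> ar (r + k + 3) D v = rtype \<sigma> ar (r + k + 3) D' v'"
  shows "carve_freq r D v \<tau> = carve_freq r D' v' \<tau>"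
proof -
  let ?A = "nbhd (r + k + 3) D v" and ?A' = "nbhd (r + k + 3) D' v'"
  obtain f where f: "ball_iso (r + k + 3) D v D' v' f"
    using eq rtype_eq_iff[OF D] by (auto simp: same_rtype_iff)
  then have bij: "bij_betw f ?A ?A'" by (simp add: ball_iso_def)
  then have inj: "inj_on f ?A" and img: "f ` ?A = ?A'" by (auto simp: bij_betw_def)
  have ty: "rtype \<sigma> ar r (carve D c) v = rtype \<sigma> ar r (carve D' (f ` c)) v'" if "c \<subseteq> ?A" for c
    by (rule carve_same_rtype[OF D f]) (use inj that in \<open>auto simp: inj_on_image_mem_iff\<close>)
  have "bij_betw ((`) f) {c\<in>Pow ?A. rtype \<sigma> ar r (carve D c) v = \<tau>} {c\<in>Pow ?A'. rtype \<sigma> ar r (carve D' c) v' = \<tau>}"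
    unfolding bij_betw_def
  proof
    show "inj_on ((`) f) {c\<in>Pow ?A. rtype \<sigma> ar r (carve D c) v = \<tau>}"
      by (rule inj_on_subset[OF inj_on_image_Pow[OF inj]]) auto
    show "(`) f ` {c\<in>Pow ?A. rtype \<sigma> ar r (carve D c) v = \<tau>} = {c\<in>Pow ?A'. rtype \<sigma> ar r (carve D' c) v' = \<tau>}"
    proof (intro equalityI subsetI)
      fix c' assume "c' \<in> (`) f ` {c\<in>Pow ?A. rtype \<sigma> ar r (carve D c) v = \<tau>}"
      then obtain c where c: "c \<subseteq> ?A" "c' = f ` c" "rtype \<sigma> ar r (carve D c) v = \<tau>" by auto
      then show "c' \<in> {c\<in>Pow ?A'. rtype \<sigma> ar r (carve D' c) v' = \<tau>}"
        using ty[OF c(1)] image_mono[OF c(1), of f] img by simp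
    next
      fix c' assume c': "c' \<in> {c\<in>Pow ?A'. rtype \<sigma> ar r (carve D' c) v' = \<tau>}"
      then have "c' \<subseteq> f ` ?A" using img by simp
      then obtain c where c: "c \<subseteq> ?A" "c' = f ` c" by (rule subset_imageE)
      then show "c' \<in> (`) f ` {c\<in>Pow ?A. rtype \<sigma> ar r (carve D c) v = \<tau>}" using ty[OF c(1)] c' by auto
    qed
  qed
  then have "card {c\<in>Pow ?A. rtype \<sigma> ar r (carve D c) v = \<tau>} = card {c\<in>Pow ?A'. rtype \<sigma> ar r (carve D' c) v' = \<tau>}"
    by (rule bij_betw_same_card)
  moreover have "card ?A = card ?A'" using bij by (rule bij_betw_same_card)
  ultimately show ?thesis using carve_freq_local[OF D(1,2)] carve_freq_local[OF D(3,4)] by simp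
qed

text \<open>By \<open>carve_freq_cong\<close> the chosen representative does not matter. These
  numbers are the entries of the matrix that maps histograms of radius \<open>r + k + 3\<close> to
  expected histograms of radius \<open>r\<close>.\<close>

definition type_freq :: "nat \<Rightarrow> ('r db \<times> nat) set \<Rightarrow> ('r db \<times> nat) set \<Rightarrow> real" where
  "type_freq r \<tau>' \<tau> = (SOME x. \<exists>D v. bdb D \<and> v < db_size D \<and> rtype \<sigma> ar (r + k + 3) D v = \<tau>' \<and> x = carve_freq r D v \<tau>)"

lemma type_freq_eq:
  assumes "bdb D" "v < db_size D"
  shows "type_freq r (rtype \<sigma> ar (r + k + 3) D v) \<tau> = carve_freq r D v \<tau>"
proof -
  have "\<exists>D' v'. bdb D' \<and> v' < db_size D' \<and> rtype \<sigma> ar (r + k + 3) D' v' = rtype \<sigma> ar (r + k + 3) D v \<and>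
     type_freq r (rtype \<sigma> ar (r + k + 3) D v) \<tau> = carve_freq r D' v' \<tau>"
    unfolding type_freq_def by (rule someI_ex) (use assms in blast)
  then show ?thesis using carve_freq_cong[OF _ _ assms] by metis
qed

lemma type_freq_bounds:
  assumes "\<tau>' \<in> types (r + k + 3)" shows "0 \<le> type_freq r \<tau>' \<tau>" "type_freq r \<tau>' \<tau> \<le> 1"
proof -
  obtain D v where D: "bdb D" "v < db_size D" "\<tau>' = rtype \<sigma> ar (r + k + 3) D v" using assms by (auto simp: types_def)
  have e: "type_freq r \<tau>' \<tau> = carve_freq r D v \<tau>" using type_freq_eq[OF D(1,2)] D(3) by simp
  have "card {c\<in>Pow {..<db_size D}. rtype \<sigma> ar r (carve D c) v = \<tau>} \<le> card (Pow {..<db_size D})"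
    by (rule card_mono) auto
  then have "real (card {c\<in>Pow {..<db_size D}. rtype \<sigma> ar r (carve D c) v = \<tau>}) \<le> real (2 ^ db_size D)"
    by (simp only: card_Pow finite_lessThan card_lessThan of_nat_le_iff)
  then show "0 \<le> type_freq r \<tau>' \<tau>" "type_freq r \<tau>' \<tau> \<le> 1" unfolding e carve_freq_def by auto
qed

text \<open>Introduced as a linear function of the histogram, the form in which closeness of
  histograms passes to expectations; \<open>expected_eq\<close> identifies it with the average over
  all colourings.\<close>

definition expected :: "nat \<Rightarrow> 'r db \<Rightarrow> ('r db \<times> nat) set \<Rightarrow> real" where
  "expected r D \<tau> = (\<Sum>\<tau>'\<in>types (r + k + 3). real (histogram \<sigma> ar (r + k + 3) D \<tau>') * type_freq r \<tau>' \<tau>)"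

lemma expected_eq:
  assumes D: "bdb D"
  shows "expected r D \<tau> * 2 ^ card {..<db_size D} = (\<Sum>c\<in>Pow {..<db_size D}. real (histogram \<sigma> ar r (carve D c) \<tau>))"
proof -
  have "expected r D \<tau> = (\<Sum>v<db_size D. type_freq r (rtype \<sigma> ar (r + k + 3) D v) \<tau>)"
    unfolding expected_def using sum_by_type[OF D, of "\<lambda>\<tau>'. type_freq r \<tau>' \<tau>"] by simp
  also have "\<dots> = (\<Sum>v<db_size D. carve_freq r D v \<tau>)"
    by (rule sum.cong) (use type_freq_eq[OF D] in auto)
  also have "\<dots> = real (\<Sum>v<db_size D. card {c\<in>Pow {..<db_size D}. rtype \<sigma> ar r (carve D c) v = \<tau>}) / 2 ^ db_size D"
    by (simp add: carve_freq_def sum_divide_distrib)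
  also have "(\<Sum>v<db_size D. card {c\<in>Pow {..<db_size D}. rtype \<sigma> ar r (carve D c) v = \<tau>}) =
      (\<Sum>c\<in>Pow {..<db_size D}. card {v\<in>{..<db_size D}. rtype \<sigma> ar r (carve D c) v = \<tau>})"
    by (rule sum_multicount_gen) auto
  also have "\<dots> = (\<Sum>c\<in>Pow {..<db_size D}. histogram \<sigma> ar r (carve D c) \<tau>)"
    by (simp add: histogram_def)
  finally show ?thesis by simp
qed

text \<open>By locality and the symmetry of distance, changing the colour of \<open>x\<close> can
  affect only the types of elements in the ball around \<open>x\<close>.\<close>

lemma histogram_carve_diff:
  assumes D: "bdb D" and x: "x < db_size D"
  shows "\<bar>real (histogram \<sigma> ar r (carve D (insert x c)) \<tau>) - real (histogram \<sigma> ar r (carve D (c - {x})) \<tau>)\<bar>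
    \<le> real (ballmax (r + k + 3))"
proof -
  let ?S = "\<lambda>c. {v. v < db_size D \<and> rtype \<sigma> ar r (carve D c) v = \<tau>}"
  let ?W = "nbhd (r + k + 3) D x"
  have eq: "rtype \<sigma> ar r (carve D (insert x c)) v = rtype \<sigma> ar r (carve D (c - {x})) v"
    if v: "v < db_size D" "v \<notin> ?W" for v
  proof (rule carve_rtype_local[OF D v(1)])
    have "x \<notin> nbhd (r + k + 3) D v" using nbhd_sym[OF D v(1)] v(2) by blast
    then show "insert x c \<inter> nbhd (r + k + 3) D v = (c - {x}) \<inter> nbhd (r + k + 3) D v" by auto
  qed
  have "\<bar>real (card (?S (insert x c))) - real (card (?S (c - {x})))\<bar> \<le> real (card ?W)"
    by (rule card_diff_le) (use eq in auto)
  also have "\<dots> \<le> real (ballmax (r + k + 3))" using card_nbhd_le[OF D x] by simp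
  finally show ?thesis by (simp add: histogram_def)
qed

text \<open>A union bound: by Chebyshev's inequality each type is off by \<open>\<eta> * n\<close>,
  where \<open>n\<close> is the size of \<open>D\<close>, for at most a fraction
  \<open>B\<^sup>2 / (\<eta>\<^sup>2 * n)\<close> of the colourings, with
  \<open>B = ballmax (r + k + 3)\<close>. The lower bound on the size makes these fractions sum to
  less than one.\<close>

lemma concentrated_colouring:
  assumes D: "bdb D" and \<eta>: "\<eta> > 0"
    and n: "real (card (types r)) * (real (ballmax (r + k + 3)))\<^sup>2 / \<eta>\<^sup>2 < real (db_size D)"
  shows "\<exists>c. \<forall>\<tau>\<in>types r. \<bar>real (histogram \<sigma> ar r (carve D c) \<tau>) - expected r D \<tau>\<bar> \<le> \<eta> * real (db_size D)"
proof (rule ccontr)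
  assume none: "\<not> ?thesis"
  let ?n = "db_size D" and ?B = "real (ballmax (r + k + 3))"
  let ?bad = "\<lambda>\<tau>. {c\<in>Pow {..<?n}. \<eta> * real ?n \<le> \<bar>real (histogram \<sigma> ar r (carve D c) \<tau>) - expected r D \<tau>\<bar>}"
  have "0 \<le> real (card (types r)) * ?B\<^sup>2 / \<eta>\<^sup>2" by simp
  then have n0: "real ?n > 0" using n by linarith
  have "Pow {..<?n} \<subseteq> (\<Union>\<tau>\<in>types r. ?bad \<tau>)"
  proof
    fix c assume c: "c \<in> Pow {..<?n}"
    obtain \<tau> where "\<tau> \<in> types r" "\<not> \<bar>real (histogram \<sigma> ar r (carve D c) \<tau>) - expected r D \<tau>\<bar> \<le> \<eta> * real ?n"
      using none by blast
    then show "c \<in> (\<Union>\<tau>\<in>types r. ?bad \<tau>)" using c by (intro UN_I[of \<tau>]) auto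
  qed
  then have "card (Pow {..<?n}) \<le> card (\<Union>\<tau>\<in>types r. ?bad \<tau>)"
    by (rule card_mono[rotated]) (use finite_types in auto)
  also have "\<dots> \<le> (\<Sum>\<tau>\<in>types r. card (?bad \<tau>))" by (rule card_UN_le[OF finite_types])
  finally have "real (2 ^ ?n) \<le> real (\<Sum>\<tau>\<in>types r. card (?bad \<tau>))"
    by (simp only: card_Pow finite_lessThan card_lessThan of_nat_le_iff)
  then have 1: "2 ^ ?n * (\<eta> * real ?n)\<^sup>2 \<le> (\<Sum>\<tau>\<in>types r. real (card (?bad \<tau>))) * (\<eta> * real ?n)\<^sup>2"
    by (intro mult_right_mono) auto
  have "(\<Sum>\<tau>\<in>types r. real (card (?bad \<tau>))) * (\<eta> * real ?n)\<^sup>2 = (\<Sum>\<tau>\<in>types r. real (card (?bad \<tau>)) * (\<eta> * real ?n)\<^sup>2)"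
    by (rule sum_distrib_right)
  also have "\<dots> \<le> (\<Sum>\<tau>\<in>types r. 2 ^ ?n * (real ?n * ?B\<^sup>2))"
  proof (rule sum_mono)
    fix \<tau>
    have "real (card (?bad \<tau>)) * (\<eta> * real ?n)\<^sup>2 \<le> 2 ^ card {..<?n} * (real (card {..<?n}) * ?B\<^sup>2)"
      by (rule chebyshev_Pow[where g = "\<lambda>c. real (histogram \<sigma> ar r (carve D c) \<tau>)" and \<mu> = "expected r D \<tau>", OF _ _ expected_eq[OF D]])
        (use histogram_carve_diff[OF D] \<eta> in auto)
    then show "real (card (?bad \<tau>)) * (\<eta> * real ?n)\<^sup>2 \<le> 2 ^ ?n * (real ?n * ?B\<^sup>2)" by simp
  qed
  also have "\<dots> = 2 ^ ?n * (real (card (types r)) * (real ?n * ?B\<^sup>2))" by simp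
  finally have "2 ^ ?n * (\<eta> * real ?n)\<^sup>2 \<le> 2 ^ ?n * (real (card (types r)) * (real ?n * ?B\<^sup>2))"
    by (rule order_trans[OF 1])
  then have "(\<eta> * real ?n)\<^sup>2 \<le> real (card (types r)) * (real ?n * ?B\<^sup>2)"
    by (rule mult_left_le_imp_le) simp
  then have "real ?n * (\<eta>\<^sup>2 * real ?n) \<le> real ?n * (real (card (types r)) * ?B\<^sup>2)"
    by (simp add: power2_eq_square algebra_simps)
  then have "\<eta>\<^sup>2 * real ?n \<le> real (card (types r)) * ?B\<^sup>2"
    using n0 by (rule mult_left_le_imp_le)
  moreover have "real (card (types r)) * ?B\<^sup>2 < \<eta>\<^sup>2 * real ?n"
    using n \<eta> by (simp add: field_simps)
  ultimately show False by linarith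
qed

text \<open>For \<open>k \<le> r\<close> the \<open>r\<close>-type of an element reveals whether it
  is undone. The number of undone elements is thus a sum of histogram entries and is concentrated
  along with them.\<close>

definition undone_types :: "nat \<Rightarrow> ('r db \<times> nat) set set" where
  "undone_types r = {rtype \<sigma> ar r D a | D a. bdb D \<and> a < db_size D \<and> k < card (nbhd k D a)}"

lemma undone_iff_type:
  assumes D: "bdb D" "a < db_size D" and "k \<le> r"
  shows "a \<in> undone D \<longleftrightarrow> rtype \<sigma> ar r D a \<in> undone_types r"
proof
  assume "a \<in> undone D" then show "rtype \<sigma> ar r D a \<in> undone_types r" using D unfolding undone_types_def undone_def by blast
next
  assume "rtype \<sigma> ar r D a \<in> undone_types r"
  then obtain D' a' where D': "bdb D'" "a' < db_size D'" "k < card (nbhd k D' a')" "rtype \<sigma> ar r D a = rtype \<sigma> ar r D' a'"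
    unfolding undone_types_def by blast
  then obtain f where f: "ball_iso r D a D' a' f" using rtype_eq_iff[OF D D'(1,2)] by (auto simp: same_rtype_iff)
  have "nbhd k D' a' = f ` nbhd k D a" by (rule ball_iso_nbhd_centre[OF D D'(1,2) f \<open>k \<le> r\<close>])
  then have "card (nbhd k D' a') \<le> card (nbhd k D a)" by (simp add: card_image_le)
  then show "a \<in> undone D" using D'(3) D by (simp add: undone_def)
qed

lemma card_undone:
  assumes D: "bdb D" and "k \<le> r"
  shows "real (card (undone D)) = (\<Sum>\<tau>\<in>types r \<inter> undone_types r. real (histogram \<sigma> ar r D \<tau>))"
proof -
  have U: "{..<db_size D} \<inter> undone D = undone D" by (auto simp: undone_def)
  have "real (card (undone D)) = (\<Sum>v\<in>{..<db_size D} \<inter> undone D. 1)" unfolding U by simp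
  also have "\<dots> = (\<Sum>v<db_size D. if v \<in> undone D then 1 else 0)" by (rule sum.inter_restrict) simp
  also have "\<dots> = (\<Sum>v<db_size D. if rtype \<sigma> ar r D v \<in> undone_types r then 1 else 0)"
    by (rule sum.cong) (use undone_iff_type[OF D _ \<open>k \<le> r\<close>] in auto)
  also have "\<dots> = (\<Sum>\<tau>\<in>types r. real (histogram \<sigma> ar r D \<tau>) * (if \<tau> \<in> undone_types r then 1 else 0))"
    by (rule sum_by_type[OF D])
  also have "\<dots> = (\<Sum>\<tau>\<in>types r \<inter> undone_types r. real (histogram \<sigma> ar r D \<tau>))"
    unfolding sum.inter_restrict[OF finite_types] by (rule sum.cong) auto
  finally show ?thesis .
qed

text \<open>The common bound \<open>M\<close> on both sizes is the unit in which all errors are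
  measured; carving preserves sizes, so it can stay fixed through the rounds.\<close>

definition sized :: "nat \<Rightarrow> real \<Rightarrow> 'r db \<Rightarrow> 'r db \<Rightarrow> bool" where
  "sized N0 M D D' \<longleftrightarrow> bdb D \<and> bdb D' \<and> N0 \<le> db_size D \<and> N0 \<le> db_size D' \<and>
     real (db_size D) \<le> M \<and> real (db_size D') \<le> M"

definition round_ok :: "nat \<Rightarrow> real \<Rightarrow> 'r db \<Rightarrow> 'r db \<Rightarrow> nat set \<Rightarrow> nat set \<Rightarrow> bool" where
  "round_ok r \<theta> D D' c c' \<longleftrightarrow> close r \<theta> (carve D c) (carve D' c') \<and>
      real (card (undone (carve D c))) \<le>
        (\<Sum>c\<in>Pow {..<db_size D}. real (card (undone (carve D c)))) / 2 ^ db_size D + \<theta>"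

text \<open>Three errors of at most \<open>\<eta> / 3 * M\<close> add up: the deviations of the two
  histograms from their expectations, and the difference of the expectations.\<close>

lemma round_step:
  assumes "k \<le> r" "\<eta> > 0"
  shows "\<exists>\<eta>'>0. \<exists>N0. \<forall>D D' M. sized N0 M D D' \<longrightarrow> close (r + k + 3) (\<eta>' * M) D D' \<longrightarrow>
    (\<exists>c c'. round_ok r (\<eta> * M) D D' c c')"
proof -
  \<comment> \<open>The factor \<open>1 + card (types r)\<close> allows the deviations of all undone
    types to be summed. In \<open>\<eta>'\<close> the number of types of the larger radius appears,
    because an expectation is a sum over those, with coefficients between \<open>0\<close> and
    \<open>1\<close>.\<close>
  define \<eta>1 where "\<eta>1 = \<eta> / (3 * (1 + real (card (types r))))"
  define \<eta>' where "\<eta>' = \<eta> / (3 * (1 + real (card (types (r + k + 3)))))"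
  have pos: "\<eta>1 > 0" "\<eta>' > 0" using \<open>\<eta> > 0\<close> by (auto simp: \<eta>1_def \<eta>'_def intro!: divide_pos_pos add_pos_nonneg)
  have b: "\<eta>1 \<le> \<eta> / 3" "real (card (types r)) * \<eta>1 \<le> \<eta>" "real (card (types (r + k + 3))) * \<eta>' \<le> \<eta> / 3"
    using \<open>\<eta> > 0\<close> unfolding \<eta>1_def \<eta>'_def by (auto simp: field_simps add_pos_nonneg)
  define X where "X = real (card (types r)) * (real (ballmax (r + k + 3)))\<^sup>2 / \<eta>1\<^sup>2"
  define N0 where "N0 = Suc (nat \<lceil>X\<rceil>)"
  have N0: "X < real n" if "N0 \<le> n" for n using that unfolding N0_def by linarith
  show ?thesis
  proof (intro exI[of _ \<eta>'] conjI exI[of _ N0] allI impI)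
    fix D D' M
    assume sz: "sized N0 M D D'" and cl: "close (r + k + 3) (\<eta>' * M) D D'"
    have D: "bdb D" "bdb D'" and n: "N0 \<le> db_size D" "N0 \<le> db_size D'"
      and M: "real (db_size D) \<le> M" "real (db_size D') \<le> M" using sz by (auto simp: sized_def)
    have M0: "M \<ge> 0" using M(1) by linarith
    obtain c where c: "\<forall>\<tau>\<in>types r. \<bar>real (histogram \<sigma> ar r (carve D c) \<tau>) - expected r D \<tau>\<bar> \<le> \<eta>1 * real (db_size D)"
      using concentrated_colouring[OF D(1) pos(1)] N0[OF n(1)] unfolding X_def by blast
    obtain c' where c': "\<forall>\<tau>\<in>types r. \<bar>real (histogram \<sigma> ar r (carve D' c') \<tau>) - expected r D' \<tau>\<bar> \<le> \<eta>1 * real (db_size D')"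
      using concentrated_colouring[OF D(2) pos(1)] N0[OF n(2)] unfolding X_def by blast
    have m: "\<eta>1 * real (db_size D) \<le> \<eta>1 * M" "\<eta>1 * real (db_size D') \<le> \<eta>1 * M" using M pos by auto
    have third: "\<eta> * M = 3 * (\<eta> / 3 * M)" by simp
    have m3: "\<eta>1 * M \<le> \<eta> / 3 * M" using b(1) M0 by (rule mult_right_mono)
    have ex: "\<bar>expected r D \<tau> - expected r D' \<tau>\<bar> \<le> \<eta> / 3 * M" for \<tau>
    proof -
      have eq: "expected r D \<tau> - expected r D' \<tau> = (\<Sum>\<tau>'\<in>types (r + k + 3).
          (real (histogram \<sigma> ar (r + k + 3) D \<tau>') - real (histogram \<sigma> ar (r + k + 3) D' \<tau>')) * type_freq r \<tau>' \<tau>)"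
        unfolding expected_def by (simp add: sum_subtractf left_diff_distrib)
      have "\<bar>expected r D \<tau> - expected r D' \<tau>\<bar> \<le> (\<Sum>\<tau>'\<in>types (r + k + 3).
          \<bar>(real (histogram \<sigma> ar (r + k + 3) D \<tau>') - real (histogram \<sigma> ar (r + k + 3) D' \<tau>')) * type_freq r \<tau>' \<tau>\<bar>)"
        unfolding eq by (rule sum_abs)
      also have "\<dots> \<le> (\<Sum>\<tau>'\<in>types (r + k + 3). \<eta>' * M)"
      proof (rule sum_mono)
        fix \<tau>' assume t: "\<tau>' \<in> types (r + k + 3)"
        have "\<bar>real (histogram \<sigma> ar (r + k + 3) D \<tau>') - real (histogram \<sigma> ar (r + k + 3) D' \<tau>')\<bar> * \<bar>type_freq r \<tau>' \<tau>\<bar> \<le> \<eta>' * M * 1"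
        proof (rule mult_mono)
          show "\<bar>real (histogram \<sigma> ar (r + k + 3) D \<tau>') - real (histogram \<sigma> ar (r + k + 3) D' \<tau>')\<bar> \<le> \<eta>' * M"
            by (rule bspec[OF cl[unfolded close_def] t])
          show "\<bar>type_freq r \<tau>' \<tau>\<bar> \<le> 1" using type_freq_bounds[OF t, of \<tau>] by linarith
          show "0 \<le> \<eta>' * M" using pos M0 by simp
        qed simp
        then show "\<bar>(real (histogram \<sigma> ar (r + k + 3) D \<tau>') - real (histogram \<sigma> ar (r + k + 3) D' \<tau>')) * type_freq r \<tau>' \<tau>\<bar> \<le> \<eta>' * M"
          by (simp add: abs_mult)
      qed
      also have "\<dots> = real (card (types (r + k + 3))) * \<eta>' * M" by simp
      also have "\<dots> \<le> \<eta> / 3 * M" using b(3) M0 by (rule mult_right_mono)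
      finally show ?thesis .
    qed
    have "close r (\<eta> * M) (carve D c) (carve D' c')"
      unfolding close_def
    proof
      fix \<tau> assume t: "\<tau> \<in> types r"
      have 1: "\<bar>real (histogram \<sigma> ar r (carve D c) \<tau>) - expected r D \<tau>\<bar> \<le> \<eta> / 3 * M" using bspec[OF c t] m m3 by linarith
      have 2: "\<bar>real (histogram \<sigma> ar r (carve D' c') \<tau>) - expected r D' \<tau>\<bar> \<le> \<eta> / 3 * M" using bspec[OF c' t] m m3 by linarith
      show "\<bar>real (histogram \<sigma> ar r (carve D c) \<tau>) - real (histogram \<sigma> ar r (carve D' c') \<tau>)\<bar> \<le> \<eta> * M"
        using 1 2 ex[of \<tau>] third by linarith
    qed
    moreover have "real (card (undone (carve D c))) \<le>
        (\<Sum>c\<in>Pow {..<db_size D}. real (card (undone (carve D c)))) / 2 ^ db_size D + \<eta> * M"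
    proof -
      let ?U = "types r \<inter> undone_types r"
      have "(\<Sum>c\<in>Pow {..<db_size D}. real (card (undone (carve D c)))) =
          (\<Sum>c\<in>Pow {..<db_size D}. \<Sum>\<tau>\<in>?U. real (histogram \<sigma> ar r (carve D c) \<tau>))"
        by (rule sum.cong) (use card_undone[OF bdb_carve[OF D(1)] \<open>k \<le> r\<close>] in auto)
      also have "\<dots> = (\<Sum>\<tau>\<in>?U. \<Sum>c\<in>Pow {..<db_size D}. real (histogram \<sigma> ar r (carve D c) \<tau>))"
        by (rule sum.swap)
      also have "\<dots> = (\<Sum>\<tau>\<in>?U. expected r D \<tau> * 2 ^ db_size D)"
        using expected_eq[OF D(1), of r] by simp
      finally have avg: "(\<Sum>c\<in>Pow {..<db_size D}. real (card (undone (carve D c)))) / 2 ^ db_size D = (\<Sum>\<tau>\<in>?U. expected r D \<tau>)"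
        by (simp add: sum_distrib_right[symmetric])
      have 1: "real (card (undone (carve D c))) = (\<Sum>\<tau>\<in>?U. real (histogram \<sigma> ar r (carve D c) \<tau>))"
        by (rule card_undone[OF bdb_carve[OF D(1)] \<open>k \<le> r\<close>])
      have 2: "(\<Sum>\<tau>\<in>?U. real (histogram \<sigma> ar r (carve D c) \<tau>)) \<le> (\<Sum>\<tau>\<in>?U. expected r D \<tau> + \<eta>1 * M)"
      proof (rule sum_mono)
        fix \<tau> assume "\<tau> \<in> ?U"
        then have "\<tau> \<in> types r" by simp
        from bspec[OF c this] show "real (histogram \<sigma> ar r (carve D c) \<tau>) \<le> expected r D \<tau> + \<eta>1 * M"
          using m by linarith
      qed
      have 3: "(\<Sum>\<tau>\<in>?U. expected r D \<tau> + \<eta>1 * M) = (\<Sum>\<tau>\<in>?U. expected r D \<tau>) + real (card ?U) * (\<eta>1 * M)"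
        by (simp only: sum.distrib sum_constant)
      have "real (card ?U) * (\<eta>1 * M) \<le> real (card (types r)) * (\<eta>1 * M)"
      proof (rule mult_right_mono)
        show "real (card ?U) \<le> real (card (types r))" unfolding of_nat_le_iff by (rule card_mono[OF finite_types]) blast
        show "0 \<le> \<eta>1 * M" using M0 pos by simp
      qed
      also have "\<dots> \<le> \<eta> * M" using mult_right_mono[OF b(2) M0] by (simp only: mult.assoc)
      finally show ?thesis unfolding avg using 1 2 3 by linarith
    qed
    ultimately have "round_ok r (\<eta> * M) D D' c c'" by (simp only: round_ok_def simp_thms)
    then show "\<exists>c c'. round_ok r (\<eta> * M) D D' c c'" by blast
  qed (rule pos(2))
qed

section \<open>Iteration of the rounds\<close>

definition carve_prob :: real where "carve_prob = 1 / 2 ^ (k + k * (d * amax))"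

lemma carve_prob: "0 < carve_prob" "carve_prob \<le> 1"
  unfolding carve_prob_def by (auto simp: divide_le_eq_1)

text \<open>The partition is of a database \<open>D0\<close> containing \<open>D\<close>, so the
  property survives carving with the same bound \<open>m\<close>.\<close>

definition partitioned :: "real \<Rightarrow> 'r db \<Rightarrow> bool" where
  "partitioned m D \<longleftrightarrow> (\<exists>D0 F. bdb D0 \<and> sub_db D D0 \<and> sub_db F D0 \<and> components_le F k \<and>
     real (card (tuples D0 - tuples F)) \<le> m)"

lemma partitioned_sub: "partitioned m D \<Longrightarrow> sub_db E D \<Longrightarrow> partitioned m E"
  unfolding partitioned_def using sub_db_trans by blast

definition cost_ok :: "'r db \<Rightarrow> 'r db \<Rightarrow> bool" where
  "cost_ok D E \<longleftrightarrow> sub_db E D \<and>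
     real (card (tuples D - tuples E)) \<le> \<delta> * (real (card (undone D)) - real (card (undone E)))"

lemma cost_ok_refl: "cost_ok D D"
  by (simp add: cost_ok_def)

lemma cost_ok_carve:
  assumes D: "bdb D" and "\<delta> > 0" and E: "cost_ok (carve D c) E" shows "cost_ok D E"
proof -
  have "card (tuples D - tuples E) \<le> card ((tuples D - tuples (carve D c)) \<union> (tuples (carve D c) - tuples E))"
    by (rule card_mono) (use finite_tuples[OF D] finite_tuples[OF bdb_carve[OF D]] in auto)
  also have "\<dots> \<le> card (tuples D - tuples (carve D c)) + card (tuples (carve D c) - tuples E)"
    by (rule card_Un_le)
  finally have "real (card (tuples D - tuples E)) \<le> \<delta> * (real (card (undone D)) - real (card (undone E)))"
    using E carve_cost[OF D, of c] assms(2) by (simp add: cost_ok_def algebra_simps)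
  then show ?thesis using E sub_db_trans[OF _ carve_sub] by (auto simp: cost_ok_def)
qed

text \<open>The number \<open>\<beta>\<close> is the floor below which the expected progress of a
  round is not guaranteed. The excess over it shrinks by the factor \<open>1 - carve_prob\<close>
  per round, and \<open>\<theta>\<close> is the additive error of one round.\<close>

definition rounds_ok :: "nat \<Rightarrow> nat \<Rightarrow> real \<Rightarrow> real \<Rightarrow> 'r db \<Rightarrow> 'r db \<Rightarrow> 'r db \<Rightarrow> 'r db \<Rightarrow> bool" where
  "rounds_ok L r \<theta> \<beta> D D' E E' \<longleftrightarrow> cost_ok D E \<and> cost_ok D' E' \<and> close r \<theta> E E' \<and>
     real (card (undone E)) - \<beta> \<le> (1 - carve_prob) ^ L * (real (card (undone D)) - \<beta>) + real L * \<theta>"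

text \<open>The additional round is put in front of the \<open>L\<close> rounds of the induction
  hypothesis. The radius and accuracy required of the input grow backwards in this way, while those
  of the final result remain \<open>r\<close> and \<open>\<eta>\<close>.\<close>

lemma carving_rounds:
  assumes "k \<le> r" "\<eta> > 0" "\<delta> > 0"
  shows "\<exists>r'\<ge>k. \<exists>\<eta>'>0. \<exists>N0. \<forall>D D' m M. sized N0 M D D' \<longrightarrow> partitioned m D \<longrightarrow> close r' (\<eta>' * M) D D' \<longrightarrow>
    (\<exists>E E'. rounds_ok L r (\<eta> * M) (real amax * m / \<delta>) D D' E E')"
proof (induction L)
  case 0
  have "\<forall>D D' m M. sized 0 M D D' \<longrightarrow> partitioned m D \<longrightarrow> close r (\<eta> * M) D D' \<longrightarrow>
    (\<exists>E E'. rounds_ok 0 r (\<eta> * M) (real amax * m / \<delta>) D D' E E')"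
    using cost_ok_refl unfolding rounds_ok_def by (metis mult_1 mult_zero_left of_nat_0 order_refl power_0 add.right_neutral)
  then show ?case using assms by blast
next
  case (Suc L)
  then obtain r' \<eta>' N0 where r': "k \<le> r'" and \<eta>': "\<eta>' > 0"
    and IH: "\<And>D D' m M. sized N0 M D D' \<Longrightarrow> partitioned m D \<Longrightarrow> close r' (\<eta>' * M) D D' \<Longrightarrow>
      \<exists>E E'. rounds_ok L r (\<eta> * M) (real amax * m / \<delta>) D D' E E'"
    by blast
  \<comment> \<open>The outcome of the first round has to meet the input accuracy
    \<open>\<eta>'\<close> of the remaining rounds, and its contribution to the undone elements has
    to be at most \<open>\<eta> * M\<close>.\<close>
  have "min \<eta> \<eta>' > 0" using \<eta>' assms by simp
  from round_step[OF r' this] obtain \<eta>'' N1 where \<eta>'': "\<eta>'' > 0"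
    and step: "\<And>D D' M. sized N1 M D D' \<Longrightarrow> close (r' + k + 3) (\<eta>'' * M) D D' \<Longrightarrow>
      \<exists>c c'. round_ok r' (min \<eta> \<eta>' * M) D D' c c'"
    by blast
  have "\<exists>E E'. rounds_ok (Suc L) r (\<eta> * M) (real amax * m / \<delta>) D D' E E'"
    if sz: "sized (max N0 N1) M D D'" and part: "partitioned m D" and cl: "close (r' + k + 3) (\<eta>'' * M) D D'" for D D' m M
  proof -
    define \<beta> where "\<beta> = real amax * m / \<delta>"
    have D: "bdb D" "bdb D'" and M0: "M \<ge> 0" using sz by (auto simp: sized_def)
    have sz1: "sized N1 M D D'" using sz by (simp add: sized_def)
    obtain c c' where c: "close r' (min \<eta> \<eta>' * M) (carve D c) (carve D' c')"
      "real (card (undone (carve D c))) \<le>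
        (\<Sum>c\<in>Pow {..<db_size D}. real (card (undone (carve D c)))) / 2 ^ db_size D + min \<eta> \<eta>' * M"
      using step[OF sz1 cl] unfolding round_ok_def by blast
    obtain D0 F where F: "bdb D0" "sub_db D D0" "sub_db F D0" "components_le F k" "real (card (tuples D0 - tuples F)) \<le> m"
      using part unfolding partitioned_def by blast
    have "(\<Sum>c\<in>Pow {..<db_size D}. real (card (undone (carve D c)))) \<le>
      2 ^ db_size D * (real (card (undone D)) - carve_prob * (real (card (undone D)) - \<beta>))"
      using carve_expected_progress[OF F(1-4) assms(3) F(5)] by (simp only: carve_prob_def \<beta>_def)
    then have "(\<Sum>c\<in>Pow {..<db_size D}. real (card (undone (carve D c)))) / 2 ^ db_size D \<le>
      real (card (undone D)) - carve_prob * (real (card (undone D)) - \<beta>)"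
      by (simp add: divide_le_eq mult.commute)
    moreover have "min \<eta> \<eta>' * M \<le> \<eta> * M" using M0 by (intro mult_right_mono) auto
    ultimately have u1: "real (card (undone (carve D c))) - \<beta> \<le> (1 - carve_prob) * (real (card (undone D)) - \<beta>) + \<eta> * M"
      using c(2) by (simp add: left_diff_distrib)
    have mm: "min \<eta> \<eta>' * M \<le> \<eta>' * M" using M0 by (intro mult_right_mono) auto
    have cl': "close r' (\<eta>' * M) (carve D c) (carve D' c')"
      unfolding close_def by (intro ballI order_trans[OF bspec[OF c(1)[unfolded close_def]] mm])
    have sz2: "sized N0 M (carve D c) (carve D' c')" using sz bdb_carve by (simp add: sized_def)
    obtain E E' where E: "rounds_ok L r (\<eta> * M) \<beta> (carve D c) (carve D' c') E E'"
      using IH[OF sz2 partitioned_sub[OF part carve_sub] cl'] unfolding \<beta>_def by blast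
    have p01: "0 \<le> 1 - carve_prob" "1 - carve_prob \<le> 1" using carve_prob by auto
    have "(1 - carve_prob) ^ L * (real (card (undone (carve D c))) - \<beta>) \<le>
        (1 - carve_prob) ^ L * ((1 - carve_prob) * (real (card (undone D)) - \<beta>) + \<eta> * M)"
      by (rule mult_left_mono[OF u1]) (use p01 in simp)
    \<comment> \<open>Later rounds contract the error of this round as well; bounding the factor by
      \<open>1\<close> gives the additive term \<open>real L * \<theta>\<close>.\<close>
    moreover have "(1 - carve_prob) ^ L * (\<eta> * M) \<le> 1 * (\<eta> * M)"
      by (rule mult_right_mono) (use p01 M0 assms in \<open>auto intro: power_le_one\<close>)
    ultimately have "real (card (undone E)) - \<beta> \<le> (1 - carve_prob) ^ Suc L * (real (card (undone D)) - \<beta>) + real (Suc L) * (\<eta> * M)"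
      using E by (simp add: rounds_ok_def algebra_simps)
    then have "rounds_ok (Suc L) r (\<eta> * M) \<beta> D D' E E'"
      using E cost_ok_carve[OF D(1) assms(3)] cost_ok_carve[OF D(2) assms(3)] unfolding rounds_ok_def by blast
    then show ?thesis unfolding \<beta>_def by blast
  qed
  moreover have "k \<le> r' + k + 3" by simp
  ultimately show ?case using \<eta>'' by blast
qed

end

section \<open>Modification distance and matchings of components\<close>

lemma mod_steps_delete_tuples:
  assumes "finite (tuples D)" "sub_db E D"
  shows "(mod_step \<sigma> ar ^^ card (tuples D - tuples E)) D E"
  using assms
proof (induction "card (tuples D - tuples E)" arbitrary: D)
  case 0
  then have "tuples D - tuples E = {}" by (metis card_0_eq finite_Diff)
  then have "db_rel D R \<subseteq> db_rel E R" for R by (auto simp: tuples_def)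
  then have "db_rel D = db_rel E" using 0 by (intro ext subset_antisym) (auto simp: sub_db_def)
  then have "D = E" using 0 by (intro db.expand) (auto simp: sub_db_def)
  then show ?case by simp
next
  case (Suc m)
  have "tuples D - tuples E \<noteq> {}" using Suc.hyps(2) by (metis card.empty nat.distinct(1))
  then obtain R t where Rt: "t \<in> db_rel D R" "t \<notin> db_rel E R" by (auto simp: tuples_def)
  define D1 where "D1 = DB (db_size D) ((db_rel D)(R := db_rel D R - {t}))"
  have st: "mod_step \<sigma> ar D D1" unfolding mod_step_def D1_def using Rt(1) by blast
  have tD1: "tuples D1 = tuples D - {(R, t)}" by (auto simp: tuples_def D1_def split: if_splits)
  have sub: "sub_db E D1" using Suc.prems(2) Rt by (auto simp: sub_db_def D1_def)
  have "tuples D - tuples E = insert (R, t) (tuples D1 - tuples E)" using Rt tD1 by (auto simp: tuples_def)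
  moreover have "(R, t) \<notin> tuples D1 - tuples E" using tD1 by simp
  moreover have fin: "finite (tuples D1)" using tD1 Suc.prems(1) by simp
  ultimately have m: "m = card (tuples D1 - tuples E)" using Suc.hyps(2) by simp
  have "(mod_step \<sigma> ar ^^ card (tuples D1 - tuples E)) D1 E" by (rule Suc.hyps(1)[OF m fin sub])
  then have "(mod_step \<sigma> ar ^^ Suc m) D E" using relpowp_Suc_I2[of "mod_step \<sigma> ar" D D1 m E] st m by simp
  then show ?case using Suc.hyps(2) by simp
qed

text \<open>Deleting elements renumbers the rest, so the outcome is not literally the induced
  sub-database on \<open>V\<close>; the map \<open>g\<close> recovers the original names.\<close>

definition induced_copy :: "'r db \<Rightarrow> nat set \<Rightarrow> 'r db \<Rightarrow> (nat \<Rightarrow> nat) \<Rightarrow> bool" where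
  "induced_copy D V E g \<longleftrightarrow> bij_betw g {0..<db_size E} V \<and>
    (\<forall>R. map g ` db_rel E R = {t \<in> db_rel D R. set t \<subseteq> V}) \<and>
    (\<forall>R. \<forall>t\<in>db_rel E R. set t \<subseteq> {0..<db_size E})"

text \<open>Elements outside \<open>V\<close> are deleted one by one. Each deletion shifts the
  larger elements down by \<open>s\<close>, so the induction continues with the image of
  \<open>V\<close> under \<open>s\<close>, and \<open>h\<close> undoes the shift.\<close>

lemma mod_steps_delete_elements:
  assumes "\<forall>R. \<forall>t\<in>db_rel D R. set t \<subseteq> {0..<db_size D}" "V \<subseteq> {0..<db_size D}"
  shows "\<exists>E g. (mod_step \<sigma> ar ^^ (db_size D - card V)) D E \<and> induced_copy D V E g"
  using assms
proof (induction "db_size D - card V" arbitrary: D V)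
  case 0
  have "card V \<le> db_size D" using 0(3) card_mono[of "{0..<db_size D}" V] by simp
  then have "card V = card {0..<db_size D}" using 0(1) by simp
  then have V: "V = {0..<db_size D}" using card_subset_eq[OF _ 0(3)] by simp
  show ?case
    by (rule exI[of _ D], rule exI[of _ id]) (use V 0 in \<open>auto simp: bij_betw_def induced_copy_def\<close>)
next
  case (Suc m)
  have "V \<noteq> {0..<db_size D}" using Suc.hyps(2) by auto
  then have "{0..<db_size D} - V \<noteq> {}" using Suc.prems(2) by blast
  then obtain i where i: "i < db_size D" "i \<notin> V" by (metis DiffE atLeastLessThan_iff ex_in_conv)
  define s where "s x = (if x < i then x else x - 1)" for x
  define h where "h x = (if x < i then x else x + 1)" for x
  have hs: "h (s x) = x" if "x \<noteq> i" for x using that by (auto simp: h_def s_def)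
  have hsm: "map h (map s t) = t" if it: "i \<notin> set t" for t
    unfolding map_map comp_def
  proof (rule map_idI)
    fix x assume "x \<in> set t"
    then have "x \<noteq> i" using it by blast
    then show "h (s x) = x" by (rule hs)
  qed
  define D1 where "D1 = del_elem i D"
  have rel1: "db_rel D1 R = map s ` {t \<in> db_rel D R. i \<notin> set t}" for R
    unfolding D1_def del_elem_def s_def by simp
  have size1: "db_size D1 = db_size D - 1" by (simp add: D1_def del_elem_def)
  have st: "mod_step \<sigma> ar D D1" unfolding mod_step_def D1_def using i(1) by blast
  have iV: "x \<noteq> i" if "x \<in> V" for x using that i by blast
  have injV: "inj_on s (- {i})" by (rule inj_on_inverseI[where g = h]) (use hs in auto)
  have cV: "card (s ` V) = card V" by (rule card_image[OF inj_on_subset[OF injV]]) (use iV in auto)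
  have s_less: "s x < db_size D - 1" if "x < db_size D" "x \<noteq> i" for x
    using that i(1) by (auto simp: s_def)
  have m: "m = db_size D1 - card (s ` V)" using Suc.hyps(2) cV size1 by simp
  have "set t \<subseteq> {0..<db_size D1}" if t: "t \<in> db_rel D1 R" for R t
  proof -
    obtain t0 where t0: "t0 \<in> db_rel D R" "i \<notin> set t0" "t = map s t0" using t rel1 by auto
    have "s x < db_size D - 1" if "x \<in> set t0" for x
      by (rule s_less) (use bspec[OF spec[OF Suc.prems(1)] t0(1)] that t0(2) in auto)
    then show ?thesis unfolding t0(3) size1 by auto
  qed
  then have wf1: "\<forall>R. \<forall>t\<in>db_rel D1 R. set t \<subseteq> {0..<db_size D1}" by blast
  have V1: "s ` V \<subseteq> {0..<db_size D1}" unfolding size1 using s_less iV Suc.prems(2) by auto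
  obtain E g where EM: "(mod_step \<sigma> ar ^^ m) D1 E" and Eg: "induced_copy D1 (s ` V) E g"
    using Suc.hyps(1)[OF m wf1 V1, folded m] by blast
  note E = EM Eg[unfolded induced_copy_def, THEN conjunct1] Eg[unfolded induced_copy_def, THEN conjunct2, THEN conjunct1, THEN spec]
    Eg[unfolded induced_copy_def, THEN conjunct2, THEN conjunct2]
  have "(mod_step \<sigma> ar ^^ Suc m) D E" using relpowp_Suc_I2[of "mod_step \<sigma> ar" D D1 m E] st E(1) by simp
  moreover have "bij_betw (h \<circ> g) {0..<db_size E} V"
  proof (rule bij_betw_trans[OF E(2)])
    show "bij_betw h (s ` V) V"
      by (rule bij_betwI[where g = s]) (use hs iV in auto)
  qed
  moreover have "map (h \<circ> g) ` db_rel E R = {t \<in> db_rel D R. set t \<subseteq> V}" for R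
  proof -
    have "map (h \<circ> g) ` db_rel E R = map h ` (map g ` db_rel E R)" by (simp add: image_image)
    also have "\<dots> = map h ` {t \<in> map s ` {t \<in> db_rel D R. i \<notin> set t}. set t \<subseteq> s ` V}" unfolding E(3) rel1 ..
    also have "\<dots> = {t \<in> db_rel D R. set t \<subseteq> V}"
    proof (intro equalityI subsetI)
      fix t assume "t \<in> map h ` {t \<in> map s ` {t \<in> db_rel D R. i \<notin> set t}. set t \<subseteq> s ` V}"
      then obtain t0 where t0: "t0 \<in> db_rel D R" "i \<notin> set t0" "set (map s t0) \<subseteq> s ` V" "t = map h (map s t0)" by blast
      have tt: "t = t0" unfolding t0(4) by (rule hsm[OF t0(2)])
      have "x \<in> V" if x: "x \<in> set t0" for x
      proof -
        have "s x \<in> s ` V" using t0(3) x by auto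
        then obtain y where "y \<in> V" "s x = s y" by blast
        moreover have "x \<noteq> i" "y \<noteq> i" using x t0(2) iV \<open>y \<in> V\<close> by auto
        ultimately show ?thesis using hs by metis
      qed
      then show "t \<in> {t \<in> db_rel D R. set t \<subseteq> V}" using tt t0 by auto
    next
      fix t assume t: "t \<in> {t \<in> db_rel D R. set t \<subseteq> V}"
      then have it: "i \<notin> set t" using i by auto
      have "t = map h (map s t)" by (rule hsm[OF it, symmetric])
      moreover have "map s t \<in> {t \<in> map s ` {t \<in> db_rel D R. i \<notin> set t}. set t \<subseteq> s ` V}" using t it by auto
      ultimately show "t \<in> map h ` {t \<in> map s ` {t \<in> db_rel D R. i \<notin> set t}. set t \<subseteq> s ` V}" by (rule image_eqI)
    qed
    finally show ?thesis .
  qed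
  ultimately have "induced_copy D V E (h \<circ> g)" using E(4) by (simp add: induced_copy_def)
  then show ?case using \<open>(mod_step \<sigma> ar ^^ Suc m) D E\<close> unfolding Suc.hyps(2)[symmetric] by blast
qed

definition part_iso :: "'r db \<Rightarrow> nat set \<Rightarrow> 'r db \<Rightarrow> nat set \<Rightarrow> (nat \<Rightarrow> nat) \<Rightarrow> bool" where
  "part_iso D V D' V' f \<longleftrightarrow> V \<subseteq> {0..<db_size D} \<and> V' \<subseteq> {0..<db_size D'} \<and> bij_betw f V V' \<and>
     (\<forall>R t. set t \<subseteq> V \<longrightarrow> (t \<in> db_rel D R \<longleftrightarrow> map f t \<in> db_rel D' R))"

lemma part_iso_image:
  assumes "part_iso D V D' V' f"
  shows "map f ` {t \<in> db_rel D R. set t \<subseteq> V} = {t \<in> db_rel D' R. set t \<subseteq> V'}"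
proof (intro equalityI subsetI)
  fix t' assume "t' \<in> map f ` {t \<in> db_rel D R. set t \<subseteq> V}"
  then obtain t where t: "t \<in> db_rel D R" "set t \<subseteq> V" "t' = map f t" by blast
  then have "set t' \<subseteq> V'" using assms image_mono[OF t(2), of f] by (auto simp: part_iso_def bij_betw_def)
  then show "t' \<in> {t \<in> db_rel D' R. set t \<subseteq> V'}" using assms t by (simp add: part_iso_def)
next
  fix t' assume t': "t' \<in> {t \<in> db_rel D' R. set t \<subseteq> V'}"
  then have "t' \<in> lists (f ` V)" using assms by (auto simp: part_iso_def bij_betw_def)
  then obtain t where t: "t' = map f t" "set t \<subseteq> V" by (auto simp: lists_image)
  then have "t \<in> db_rel D R" using assms t' by (auto simp: part_iso_def)
  then show "t' \<in> map f ` {t \<in> db_rel D R. set t \<subseteq> V}" using t by blast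
qed

text \<open>Both databases are reduced to their matched parts: deleting tuples leads to
  \<open>E\<close> and \<open>E'\<close>, deleting elements to copies of the parts on
  \<open>V\<close> and \<open>V'\<close>. A deleted element takes its tuples with it in a single
  modification.\<close>

lemma dist_pm_part_iso:
  assumes D: "finite (tuples D)" "finite (tuples D')" and E: "sub_db E D" "sub_db E' D'"
    and wf: "\<forall>R. \<forall>t\<in>db_rel E R. set t \<subseteq> {0..<db_size E}" "\<forall>R. \<forall>t\<in>db_rel E' R. set t \<subseteq> {0..<db_size E'}"
    and iso: "part_iso E V E' V' f"
  shows "dist_pm \<sigma> ar D D' \<le> card (tuples D - tuples E) + card (tuples D' - tuples E') +
    (db_size E - card V) + (db_size E' - card V')"
proof -
  have V: "V \<subseteq> {0..<db_size E}" "V' \<subseteq> {0..<db_size E'}" "bij_betw f V V'" using iso by (auto simp: part_iso_def)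
  obtain A g where AM: "(mod_step \<sigma> ar ^^ (db_size E - card V)) E A" and AI: "induced_copy E V A g"
    using mod_steps_delete_elements[where \<sigma> = \<sigma> and ar = ar, OF wf(1) V(1)] by blast
  note A = AM AI[unfolded induced_copy_def, THEN conjunct1] AI[unfolded induced_copy_def, THEN conjunct2, THEN conjunct1, THEN spec]
    AI[unfolded induced_copy_def, THEN conjunct2, THEN conjunct2]
  obtain A' g' where A'M: "(mod_step \<sigma> ar ^^ (db_size E' - card V')) E' A'" and A'I: "induced_copy E' V' A' g'"
    using mod_steps_delete_elements[where \<sigma> = \<sigma> and ar = ar, OF wf(2) V(2)] by blast
  note A' = A'M A'I[unfolded induced_copy_def, THEN conjunct1] A'I[unfolded induced_copy_def, THEN conjunct2, THEN conjunct1, THEN spec]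
    A'I[unfolded induced_copy_def, THEN conjunct2, THEN conjunct2]
  define i where "i = the_inv_into {0..<db_size A'} g'"
  have "bij_betw (i \<circ> (f \<circ> g)) {0..<db_size A} {0..<db_size A'}"
    unfolding i_def by (rule bij_betw_trans[OF bij_betw_trans[OF A(2) V(3)] bij_betw_the_inv_into[OF A'(2)]])
  moreover have "db_rel A' R = map (i \<circ> (f \<circ> g)) ` db_rel A R" for R
  proof -
    have "map (i \<circ> (f \<circ> g)) ` db_rel A R = map i ` map f ` map g ` db_rel A R" by (simp add: image_image)
    also have "\<dots> = map i ` map g' ` db_rel A' R" unfolding A(3) A'(3) part_iso_image[OF iso] ..
    also have "\<dots> = (\<lambda>t. t) ` db_rel A' R" unfolding image_image
    proof (rule image_cong[OF refl])
      fix t assume t: "t \<in> db_rel A' R"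
      show "map i (map g' t) = t" unfolding map_map
      proof (rule map_idI)
        fix x assume "x \<in> set t"
        then have "x \<in> {0..<db_size A'}" using A'(4) t by blast
        then show "(i \<circ> g') x = x" using A'(2) unfolding i_def bij_betw_def by (simp add: the_inv_into_f_f)
      qed
    qed
    finally show ?thesis by simp
  qed
  ultimately have isoA: "db_iso A A'" unfolding db_iso_def by blast
  have 1: "(mod_step \<sigma> ar ^^ (card (tuples D - tuples E) + (db_size E - card V))) D A"
    by (rule relpowp_trans[OF mod_steps_delete_tuples[OF D(1) E(1)] A(1)])
  have 2: "(mod_step \<sigma> ar ^^ (card (tuples D' - tuples E') + (db_size E' - card V'))) D' A'"
    by (rule relpowp_trans[OF mod_steps_delete_tuples[OF D(2) E(2)] A'(1)])
  have "dist_pm \<sigma> ar D D' \<le> (card (tuples D - tuples E) + (db_size E - card V)) + (card (tuples D' - tuples E') + (db_size E' - card V'))"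
    unfolding dist_pm_def by (rule Least_le) (use 1 2 isoA in blast)
  then show ?thesis by simp
qed

section \<open>Matching isomorphic small components\<close>

context carving begin

text \<open>Unions of connected components; a tuple meeting such a set lies inside it.\<close>

definition closed_set :: "'r db \<Rightarrow> nat set \<Rightarrow> bool" where
  "closed_set D V \<longleftrightarrow> (\<forall>x\<in>V. \<forall>y. gadj D x y \<longrightarrow> y \<in> V)"

lemma closed_set_tuple: "closed_set D V \<Longrightarrow> t \<in> db_rel D R \<Longrightarrow> x \<in> set t \<Longrightarrow> x \<in> V \<Longrightarrow> set t \<subseteq> V"
  unfolding closed_set_def gadj_def by (metis subsetI)

lemma small_component:
  assumes D: "bdb D" "v < db_size D" and v: "card (nbhd k D v) \<le> k" and "k \<le> r"
  shows "closed_set D (nbhd k D v)" "nbhd r D v = nbhd k D v"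
    "u \<in> nbhd k D v \<Longrightarrow> nbhd r D u = nbhd k D v"
proof -
  have e: "nbhd k D v = reach k (gadj D) v" using nbhd_reach[OF D] .
  have cl: "y \<in> nbhd k D v" if "x \<in> nbhd k D v" "gadj D x y" for x y
    using reach_small_closed[of k "gadj D" v x y] that v finite_nbhd[of k D v] unfolding e by blast
  then show "closed_set D (nbhd k D v)" by (simp add: closed_set_def)
  have up: "nbhd r D u = nbhd k D v" if u: "u \<in> nbhd k D v" for u
  proof
    have ul: "u < db_size D" using u nbhd_less by blast
    show "nbhd r D u \<subseteq> nbhd k D v"
      unfolding nbhd_reach[OF D(1) ul] by (rule reach_closed_subset[OF u]) (use cl in blast)
    have "reach k (gadj D) u = reach k (gadj D) v"
      by (rule small_reach_eq[OF gadj_sym]) (use u v finite_nbhd[of k D v] in \<open>auto simp: e\<close>)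
    then have "nbhd k D u = nbhd k D v" using e nbhd_reach[OF D(1) ul] by simp
    then show "nbhd k D v \<subseteq> nbhd r D u" using nbhd_mono[OF \<open>k \<le> r\<close>, of D u] by simp
  qed
  show "nbhd r D v = nbhd k D v" by (rule up[OF nbhd_self[OF D(2)]])
  show "u \<in> nbhd k D v \<Longrightarrow> nbhd r D u = nbhd k D v" by (rule up)
qed

lemma closed_set_disjoint:
  assumes D: "bdb D" "v < db_size D" and V: "closed_set D V" "v \<notin> V" shows "nbhd r D v \<inter> V = {}"
proof -
  have "reach r (gadj D) v \<subseteq> - V"
  proof (rule reach_closed_subset)
    fix x y assume "x \<in> - V" "gadj D x y"
    then show "y \<in> - V" using V(1) gadj_sym[of D x y] unfolding closed_set_def by blast
  qed (use V in simp)
  then show ?thesis using nbhd_reach[OF D] by auto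
qed

text \<open>Preserving types ensures that the matched parts contribute equally to both histograms,
  so the unmatched elements inherit the difference of the histograms.\<close>

definition matching :: "nat \<Rightarrow> 'r db \<Rightarrow> 'r db \<Rightarrow> nat set \<Rightarrow> nat set \<Rightarrow> (nat \<Rightarrow> nat) \<Rightarrow> bool" where
  "matching r D D' V V' f \<longleftrightarrow> part_iso D V D' V' f \<and> closed_set D V \<and> closed_set D' V' \<and>
     (\<forall>v\<in>V. rtype \<sigma> ar r D v = rtype \<sigma> ar r D' (f v))"

text \<open>The ball of a done element is its whole component, so equal types yield isomorphic
  components around \<open>v\<close> and \<open>v'\<close>. They are disjoint from the matched
  parts, which are closed, so the two isomorphisms can be glued.\<close>

lemma matching_extend:
  assumes D: "bdb D" "bdb D'" and "k \<le> r" and m: "matching r D D' V V' f"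
    and v: "v < db_size D" "v \<notin> V" "v \<notin> undone D" and v': "v' < db_size D'" "v' \<notin> V'"
    and ty: "rtype \<sigma> ar r D v = rtype \<sigma> ar r D' v'"
  shows "\<exists>W W' g. matching r D D' W W' g \<and> card V < card W"
proof -
  define K where "K = nbhd k D v"
  define K' where "K' = nbhd k D' v'"
  obtain f0 where f0: "ball_iso r D v D' v' f0" using ty rtype_eq_iff[OF D(1) v(1) D(2) v'(1)] by (auto simp: same_rtype_iff)
  have Kk: "card (nbhd k D v) \<le> k" using v by (auto simp: undone_def)
  note K = small_component[OF D(1) v(1) Kk \<open>k \<le> r\<close>, folded K_def]
  have K'img: "K' = f0 ` K" unfolding K_def K'_def by (rule ball_iso_nbhd_centre[OF D(1) v(1) D(2) v'(1) f0 \<open>k \<le> r\<close>])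
  then have K'k: "card (nbhd k D' v') \<le> k" using Kk card_image_le[of K f0] unfolding K_def K'_def by simp
  note K' = small_component[OF D(2) v'(1) K'k \<open>k \<le> r\<close>, folded K'_def]
  have bij0: "bij_betw f0 K K'" and tup0: "\<And>R t. set t \<subseteq> K \<Longrightarrow> t \<in> db_rel D R \<longleftrightarrow> map f0 t \<in> db_rel D' R"
    using f0 unfolding ball_iso_def K(2) K'(2) by auto
  have bij: "bij_betw f V V'" and tup: "\<And>R t. set t \<subseteq> V \<Longrightarrow> t \<in> db_rel D R \<longleftrightarrow> map f t \<in> db_rel D' R"
    and cl: "closed_set D V" "closed_set D' V'" and Vs: "V \<subseteq> {0..<db_size D}" "V' \<subseteq> {0..<db_size D'}"
    and tyV: "\<And>v. v \<in> V \<Longrightarrow> rtype \<sigma> ar r D v = rtype \<sigma> ar r D' (f v)"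
    using m by (auto simp: matching_def part_iso_def)
  have dj: "K \<inter> V = {}" "K' \<inter> V' = {}"
    using closed_set_disjoint[OF D(1) v(1) cl(1) v(2)] closed_set_disjoint[OF D(2) v'(1) cl(2) v'(2)]
    by (auto simp: K_def K'_def)
  define g where "g x = (if x \<in> V then f x else f0 x)" for x
  have gV: "map g t = map f t" if "set t \<subseteq> V" for t using that by (auto simp: g_def)
  have gK: "map g t = map f0 t" if "set t \<subseteq> K" for t using that dj by (auto simp: g_def)
  have bijg: "bij_betw g (V \<union> K) (V' \<union> K')"
  proof (rule bij_betw_combine)
    show "bij_betw g V V'" using bij by (rule bij_betw_cong[THEN iffD1, rotated]) (simp add: g_def)
    show "bij_betw g K K'" using bij0 by (rule bij_betw_cong[THEN iffD1, rotated]) (use dj in \<open>auto simp: g_def\<close>)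
    show "V' \<inter> K' = {}" using dj by auto
  qed
  have gin: "g y \<in> V' \<longleftrightarrow> y \<in> V" "g y \<in> K' \<longleftrightarrow> y \<in> K" if "y \<in> V \<union> K" for y
  proof -
    have 1: "g y \<in> V'" if "y \<in> V" for y using bij that by (auto simp: g_def bij_betw_def)
    have 2: "g y \<in> K'" if "y \<in> K" for y using bij0 that dj by (auto simp: g_def bij_betw_def)
    show "g y \<in> V' \<longleftrightarrow> y \<in> V" "g y \<in> K' \<longleftrightarrow> y \<in> K" using that 1 2 dj by blast+
  qed
  have tupg: "t \<in> db_rel D R \<longleftrightarrow> map g t \<in> db_rel D' R" if s: "set t \<subseteq> V \<union> K" for R t
  proof
    assume t: "t \<in> db_rel D R"
    obtain x where x: "x \<in> set t" using bdb_tupleD(4)[OF D(1) t] by (metis ex_in_conv)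
    have "set t \<subseteq> V \<or> set t \<subseteq> K"
      using closed_set_tuple[OF cl(1) t x] closed_set_tuple[OF K(1) t x] s x by blast
    then show "map g t \<in> db_rel D' R" using t tup tup0 gV gK by metis
  next
    assume t: "map g t \<in> db_rel D' R"
    obtain x where x: "x \<in> set t" using bdb_tupleD(4)[OF D(2) t] by fastforce
    have gx: "g x \<in> set (map g t)" using x by simp
    have "set (map g t) \<subseteq> V' \<or> set (map g t) \<subseteq> K'"
      using closed_set_tuple[OF cl(2) t gx] closed_set_tuple[OF K'(1) t gx] gin[of x] s x by blast
    then have "set t \<subseteq> V \<or> set t \<subseteq> K"
    proof
      assume a: "set (map g t) \<subseteq> V'"
      have "y \<in> V" if "y \<in> set t" for y using a gin(1)[of y] that s by auto
      then show ?thesis by blast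
    next
      assume a: "set (map g t) \<subseteq> K'"
      have "y \<in> K" if "y \<in> set t" for y using a gin(2)[of y] that s by auto
      then show ?thesis by blast
    qed
    then show "t \<in> db_rel D R" using t tup tup0 gV gK by metis
  qed
  have "rtype \<sigma> ar r D x = rtype \<sigma> ar r D' (g x)" if x: "x \<in> V \<union> K" for x
  proof (cases "x \<in> V")
    case True then show ?thesis using tyV by (simp add: g_def)
  next
    case False
    then have xK: "x \<in> K" using x by blast
    then have gx: "g x = f0 x" "f0 x \<in> K'" using False bij0 by (auto simp: g_def bij_betw_def)
    have "ball_iso r D x D' (f0 x) f0"
      unfolding ball_iso_def K(3)[OF xK] K'(3)[OF gx(2)] using bij0 tup0 by simp
    then have "same_rtype r D x D' (f0 x)" by (auto simp: same_rtype_iff)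
    moreover have "x < db_size D" "f0 x < db_size D'" using xK gx(2) nbhd_less unfolding K_def K'_def by blast+
    ultimately show ?thesis using rtype_eq_iff[OF D(1) _ D(2)] gx(1) by simp
  qed
  moreover have "closed_set D (V \<union> K)" "closed_set D' (V' \<union> K')" using cl K(1) K'(1) by (auto simp: closed_set_def)
  moreover have sub: "V \<union> K \<subseteq> {0..<db_size D}" "V' \<union> K' \<subseteq> {0..<db_size D'}"
    using Vs nbhd_less unfolding K_def K'_def by fastforce+
  ultimately have mm: "matching r D D' (V \<union> K) (V' \<union> K') g"
    using bijg tupg by (simp add: matching_def part_iso_def)
  have "V \<subset> V \<union> K" using v nbhd_self[OF v(1), of k] by (auto simp: K_def)
  then have "card V < card (V \<union> K)" using sub(1) finite_subset psubset_card_mono by (metis finite_atLeastLessThan)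
  then show ?thesis using mm by blast
qed

text \<open>In a matching of maximal size, each type of done elements is exhausted on one side, so
  at most \<open>\<theta>\<close> elements of that type are left in \<open>D\<close>. Elements of
  the other types are undone and are simply counted.\<close>

lemma maximal_matching:
  assumes D: "bdb D" "bdb D'" and "k \<le> r" and cl: "close r \<theta> D D'" and "\<theta> \<ge> 0"
  shows "\<exists>V V' f. part_iso D V D' V' f \<and>
    real (db_size D) - real (card V) \<le> real (card (undone D)) + real (card (types r)) * \<theta>"
proof -
  let ?P = "\<lambda>c. \<exists>V V' f. matching r D D' V V' f \<and> card V = c"
  have b: "c \<le> db_size D" if "?P c" for c
    using that card_mono[of "{0..<db_size D}"] by (auto simp: matching_def part_iso_def)
  have "matching r D D' {} {} id" using bdb_tupleD(4)[OF D(1)] bdb_tupleD(4)[OF D(2)]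
    by (fastforce simp: matching_def part_iso_def closed_set_def)
  then have "?P 0" by (metis card.empty)
  then have "?P (Greatest ?P)" by (rule GreatestI_nat) (use b in blast)
  then obtain V V' f where m: "matching r D D' V V' f" and c: "card V = Greatest ?P" by blast
  have mx: "card W \<le> card V" if "matching r D D' W W' g" for W W' g
    unfolding c by (rule Greatest_le_nat[where b = "db_size D"]) (use that b in blast)+
  define h where "h = (\<lambda>\<tau>. {v. v < db_size D \<and> v \<notin> V \<and> rtype \<sigma> ar r D v = \<tau>})"
  define h' where "h' = (\<lambda>\<tau>. {v. v < db_size D' \<and> v \<notin> V' \<and> rtype \<sigma> ar r D' v = \<tau>})"
  have bij: "bij_betw f V V'" and Vs: "V \<subseteq> {0..<db_size D}" "V' \<subseteq> {0..<db_size D'}"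
    and tyV: "\<And>v. v \<in> V \<Longrightarrow> rtype \<sigma> ar r D v = rtype \<sigma> ar r D' (f v)" and pi: "part_iso D V D' V' f"
    using m by (auto simp: matching_def part_iso_def)
  have finh: "finite (h \<tau>)" "finite (h' \<tau>)" for \<tau> unfolding h_def h'_def by auto
  have finV: "finite V" "finite V'" using Vs finite_subset by blast+
  have one: "h \<tau> = {} \<or> h' \<tau> = {}" if "\<tau> \<notin> undone_types r" for \<tau>
  proof (rule ccontr)
    assume "\<not> ?thesis"
    then obtain v v' where v: "v < db_size D" "v \<notin> V" "rtype \<sigma> ar r D v = \<tau>" and v': "v' < db_size D'" "v' \<notin> V'" "rtype \<sigma> ar r D' v' = \<tau>"
      by (auto simp: h_def h'_def)
    have "v \<notin> undone D" using undone_iff_type[OF D(1) v(1) \<open>k \<le> r\<close>] v(3) that by simp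
    then obtain W W' g where "matching r D D' W W' g" "card V < card W"
      using matching_extend[OF D \<open>k \<le> r\<close> m v(1,2) _ v'(1,2)] v(3) v'(3) by auto
    then show False using mx by (meson not_le)
  qed
  have H: "histogram \<sigma> ar r D \<tau> = card {v\<in>V. rtype \<sigma> ar r D v = \<tau>} + card (h \<tau>)" for \<tau>
  proof -
    have "{v. v < db_size D \<and> rtype \<sigma> ar r D v = \<tau>} = {v\<in>V. rtype \<sigma> ar r D v = \<tau>} \<union> h \<tau>"
      using Vs by (auto simp: h_def)
    moreover have "{v\<in>V. rtype \<sigma> ar r D v = \<tau>} \<inter> h \<tau> = {}" by (auto simp: h_def)
    ultimately show ?thesis using finV finh by (simp add: histogram_def card_Un_disjoint)
  qed
  have H': "histogram \<sigma> ar r D' \<tau> = card {v\<in>V'. rtype \<sigma> ar r D' v = \<tau>} + card (h' \<tau>)" for \<tau>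
  proof -
    have "{v. v < db_size D' \<and> rtype \<sigma> ar r D' v = \<tau>} = {v\<in>V'. rtype \<sigma> ar r D' v = \<tau>} \<union> h' \<tau>"
      using Vs by (auto simp: h'_def)
    moreover have "{v\<in>V'. rtype \<sigma> ar r D' v = \<tau>} \<inter> h' \<tau> = {}" by (auto simp: h'_def)
    ultimately show ?thesis using finV finh by (simp add: histogram_def card_Un_disjoint)
  qed
  have eq: "card {v\<in>V. rtype \<sigma> ar r D v = \<tau>} = card {v\<in>V'. rtype \<sigma> ar r D' v = \<tau>}" for \<tau>
  proof (rule bij_betw_same_card[of f])
    have "f ` {v\<in>V. rtype \<sigma> ar r D v = \<tau>} = {v\<in>V'. rtype \<sigma> ar r D' v = \<tau>}"
      using bij tyV unfolding bij_betw_def by auto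
    then show "bij_betw f {v\<in>V. rtype \<sigma> ar r D v = \<tau>} {v\<in>V'. rtype \<sigma> ar r D' v = \<tau>}"
      using bij unfolding bij_betw_def by (auto intro: inj_on_subset)
  qed
  have bound: "real (card (h \<tau>)) \<le> (if \<tau> \<in> undone_types r then real (histogram \<sigma> ar r D \<tau>) else 0) + \<theta>" if t: "\<tau> \<in> types r" for \<tau>
  proof (cases "\<tau> \<in> undone_types r")
    case True then show ?thesis using H[of \<tau>] \<open>\<theta> \<ge> 0\<close> by simp
  next
    case False
    have "\<bar>real (histogram \<sigma> ar r D \<tau>) - real (histogram \<sigma> ar r D' \<tau>)\<bar> \<le> \<theta>" using cl t unfolding close_def by blast
    then show ?thesis using one[OF False] H[of \<tau>] H'[of \<tau>] eq[of \<tau>] False \<open>\<theta> \<ge> 0\<close> by auto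
  qed
  have "real (db_size D) - real (card V) = (\<Sum>\<tau>\<in>types r. real (card (h \<tau>)))"
  proof -
    have "(\<Sum>v\<in>{..<db_size D} - V. 1::nat) =
        (\<Sum>\<tau>\<in>types r. \<Sum>v\<in>{v\<in>{..<db_size D} - V. rtype \<sigma> ar r D v = \<tau>}. 1)"
      by (rule sum.group[symmetric]) (use finite_types rtype_in_types[OF D(1)] in auto)
    then have "card ({..<db_size D} - V) = (\<Sum>\<tau>\<in>types r. card {v\<in>{..<db_size D} - V. rtype \<sigma> ar r D v = \<tau>})"
      by (simp only: card_eq_sum)
    also have "\<dots> = (\<Sum>\<tau>\<in>types r. card (h \<tau>))" by (rule sum.cong) (auto simp: h_def intro!: arg_cong[of _ _ card])
    finally have "card ({..<db_size D} - V) = (\<Sum>\<tau>\<in>types r. card (h \<tau>))" .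
    moreover have "card ({..<db_size D} - V) = db_size D - card V" "card V \<le> db_size D"
      using Vs(1) finV card_mono[OF _ Vs(1)] by (auto simp: card_Diff_subset lessThan_atLeast0)
    ultimately show ?thesis by (simp add: of_nat_diff flip: of_nat_sum)
  qed
  also have "\<dots> \<le> (\<Sum>\<tau>\<in>types r. (if \<tau> \<in> undone_types r then real (histogram \<sigma> ar r D \<tau>) else 0) + \<theta>)"
    by (rule sum_mono[OF bound])
  also have "\<dots> = real (card (undone D)) + real (card (types r)) * \<theta>"
    unfolding card_undone[OF D(1) \<open>k \<le> r\<close>] sum.inter_restrict[OF finite_types] by (simp add: sum.distrib)
  finally show ?thesis using pi by blast
qed

end

lemma part_iso_sym:
  assumes "part_iso D V D' V' f" shows "part_iso D' V' D V (the_inv_into V f)"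
proof -
  let ?g = "the_inv_into V f"
  have b: "bij_betw f V V'" using assms by (simp add: part_iso_def)
  have g: "bij_betw ?g V' V" using b bij_betw_the_inv_into by blast
  have "t \<in> db_rel D' R \<longleftrightarrow> map ?g t \<in> db_rel D R" if "set t \<subseteq> V'" for R t
  proof -
    have "map f (map ?g t) = t" using that b
      by (simp add: bij_betw_def f_the_inv_into_f map_idI subset_iff)
    moreover have "set (map ?g t) \<subseteq> V" using that g by (auto simp: bij_betw_def)
    ultimately show ?thesis using assms unfolding part_iso_def by metis
  qed
  then show ?thesis using g assms by (simp add: part_iso_def)
qed

section \<open>From similar histograms to small distance, and scaling in semilinear sets\<close>

context bounded_schema begin

lemma close_size:
  assumes "bdb D" "bdb D'" "close r \<theta> D D'"
  shows "\<bar>real (db_size D) - real (db_size D')\<bar> \<le> real (card (types r)) * \<theta>"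
proof -
  have "\<bar>real (db_size D) - real (db_size D')\<bar> =
      \<bar>\<Sum>\<tau>\<in>types r. real (histogram \<sigma> ar r D \<tau>) - real (histogram \<sigma> ar r D' \<tau>)\<bar>"
    using sum_histogram[OF assms(1), of r] sum_histogram[OF assms(2), of r] by (simp add: sum_subtractf)
  also have "\<dots> \<le> (\<Sum>\<tau>\<in>types r. \<bar>real (histogram \<sigma> ar r D \<tau>) - real (histogram \<sigma> ar r D' \<tau>)\<bar>)" by (rule sum_abs)
  also have "\<dots> \<le> (\<Sum>\<tau>\<in>types r. \<theta>)" by (rule sum_mono) (use assms(3) in \<open>simp add: close_def\<close>)
  finally show ?thesis by simp
qed

text \<open>A version of a theorem of Newman and Sohler.\<close>
lemma close_histograms_imp_close:
  assumes H: "\<forall>D\<in>H. bdb D"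
    and hyper: "\<forall>e. 0 < e \<and> e \<le> 1 \<longrightarrow> (\<exists>k. \<forall>D\<in>H. \<exists>F. sub_db F D \<and> components_le F k \<and>
      real (card (tuples D - tuples F)) \<le> e * real (db_size D))"
    and \<epsilon>: "\<epsilon> > 0"
  shows "\<exists>r. \<exists>\<eta>>0. \<exists>N0. \<forall>D\<in>H. \<forall>D'. bdb D' \<longrightarrow> N0 \<le> db_size D \<longrightarrow> N0 \<le> db_size D' \<longrightarrow>
    close r (\<eta> * (real (db_size D) + real (db_size D'))) D D' \<longrightarrow>
    real (dist_pm \<sigma> ar D' D) \<le> \<epsilon> * (real (db_size D) + real (db_size D'))"
proof -
  \<comment> \<open>The tuples cut from both databases number at most \<open>\<delta>\<close> times
    the sum of the sizes.\<close>
  define \<delta> where "\<delta> = \<epsilon> / 8"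
  have \<delta>: "\<delta> > 0" using \<epsilon> by (simp add: \<delta>_def)
  \<comment> \<open>Chosen to push the floor \<open>amax * (e * n) / \<delta>\<close> down to
    \<open>\<epsilon> / 16 * n\<close>. It must precede the choice of \<open>k\<close>, which in
    turn determines the probability of carving.\<close>
  define e where "e = min 1 (\<epsilon> * \<delta> / (16 * (1 + real amax)))"
  have e: "0 < e" "e \<le> 1" using \<epsilon> \<delta> by (auto simp: e_def intro!: divide_pos_pos mult_pos_pos add_pos_nonneg)
  have "real amax * e \<le> real amax * (\<epsilon> * \<delta> / (16 * (1 + real amax)))" by (rule mult_left_mono) (auto simp: e_def)
  also have "\<dots> = (real amax / (1 + real amax)) * (\<epsilon> * \<delta> / 16)" by simp
  also have "\<dots> \<le> 1 * (\<epsilon> * \<delta> / 16)" by (rule mult_right_mono) (use \<epsilon> \<delta> in auto)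
  finally have ae: "real amax * e / \<delta> \<le> \<epsilon> / 16" using \<delta> by (simp add: field_simps)
  obtain k where k: "\<forall>D\<in>H. \<exists>F. sub_db F D \<and> components_le F k \<and> real (card (tuples D - tuples F)) \<le> e * real (db_size D)"
    using hyper e by blast
  interpret c: carving \<sigma> ar d k \<delta> by unfold_locales
  have "\<bar>1 - c.carve_prob\<bar> < 1" using c.carve_prob by auto
  \<comment> \<open>With this many rounds the contracted excess is at most
    \<open>\<epsilon> / 16 * n\<close>; together with the floor, an \<open>\<epsilon> / 8\<close>
    share of undone elements remains, up to the concentration errors.\<close>
  then obtain L where L: "(1 - c.carve_prob) ^ L < \<epsilon> / 16"
    using real_arch_pow_inv[of "\<epsilon> / 16" "1 - c.carve_prob"] \<epsilon> c.carve_prob by auto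
  have L0: "0 \<le> (1 - c.carve_prob) ^ L" using c.carve_prob by simp
  define T where "T = real (card (types k))"
  \<comment> \<open>The undone elements enter the final bound twice, each time with \<open>L\<close>
    round errors. The term \<open>T\<close> enters twice through the matching and once through the
    difference of sizes. The summand \<open>1\<close> keeps \<open>X\<close> positive.\<close>
  define X where "X = 2 * real L + 3 * T + 1"
  define \<eta> where "\<eta> = \<epsilon> / (4 * X)"
  have den: "X > 0" by (simp add: X_def T_def add_nonneg_pos)
  have \<eta>: "\<eta> > 0" using \<epsilon> den by (simp add: \<eta>_def)
  have "(2 * real L + 3 * T) * \<eta> \<le> X * \<eta>" using \<eta> by (intro mult_right_mono) (auto simp: X_def)
  also have "\<dots> = \<epsilon> / 4" using den by (simp add: \<eta>_def)
  finally have \<eta>b: "(2 * real L + 3 * T) * \<eta> \<le> \<epsilon> / 4" .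
  obtain r' \<eta>' N0 where \<eta>': "\<eta>' > 0" and rounds: "\<forall>D D' m M. c.sized N0 M D D' \<longrightarrow> c.partitioned m D \<longrightarrow> close r' (\<eta>' * M) D D' \<longrightarrow>
    (\<exists>E E'. c.rounds_ok L k (\<eta> * M) (real amax * m / \<delta>) D D' E E')"
    using c.carving_rounds[OF order_refl \<eta> \<delta>, of L] by (elim exE conjE) (rule that; assumption)
  have "real (dist_pm \<sigma> ar D' D) \<le> \<epsilon> * (real (db_size D) + real (db_size D'))"
    if D: "D \<in> H" and D': "bdb D'" and n: "N0 \<le> db_size D" "N0 \<le> db_size D'"
      and cl: "close r' (\<eta>' * (real (db_size D) + real (db_size D'))) D D'" for D D'
  proof -
    have bD: "bdb D" using H D by blast
    define n where "n = real (db_size D)"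
    define n' where "n' = real (db_size D')"
    define M where "M = n + n'"
    have nn: "n \<ge> 0" "n' \<ge> 0" "M \<ge> 0" by (auto simp: n_def n'_def M_def)
    have sz: "c.sized N0 M D D'" using bD D' n by (simp add: c.sized_def M_def n_def n'_def)
    have pt: "c.partitioned (e * n) D" unfolding c.partitioned_def n_def using k D bD sub_db_refl by blast
    define \<beta> where "\<beta> = real amax * (e * n) / \<delta>"
    obtain E E' where EE: "c.rounds_ok L k (\<eta> * M) \<beta> D D' E E'"
      using rounds[rule_format, OF sz pt] cl unfolding \<beta>_def M_def n_def n'_def by blast
    have co: "c.cost_ok D E" "c.cost_ok D' E'" and clE: "close k (\<eta> * M) E E'"
      and uE: "real (card (c.undone E)) - \<beta> \<le> (1 - c.carve_prob) ^ L * (real (card (c.undone D)) - \<beta>) + real L * (\<eta> * M)"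
      using EE unfolding c.rounds_ok_def by auto
    have sub: "sub_db E D" "sub_db E' D'" using co by (auto simp: c.cost_ok_def)
    have bE: "bdb E" "bdb E'" using bdb_sub sub bD D' by auto
    have szE: "db_size E = db_size D" "db_size E' = db_size D'" using sub by (auto simp: sub_db_def)
    have ud: "card (c.undone D) \<le> db_size D" for D
      using card_mono[of "{..<db_size D}" "c.undone D"] by (auto simp: c.undone_def)
    have cost: "real (card (tuples D - tuples E)) \<le> \<delta> * real (db_size D)" if "c.cost_ok D E" for D E
    proof -
      have "\<delta> * (real (card (c.undone D)) - real (card (c.undone E))) \<le> \<delta> * real (db_size D)"
        by (rule mult_left_mono) (use ud[of D] \<delta> in auto)
      then show ?thesis using that by (simp add: c.cost_ok_def)
    qed
    have \<beta>0: "\<beta> \<ge> 0" using nn \<delta> e by (simp add: \<beta>_def)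
    have "\<beta> = (real amax * e / \<delta>) * n" by (simp add: \<beta>_def)
    also have "\<dots> \<le> \<epsilon> / 16 * n" using ae nn(1) by (rule mult_right_mono)
    finally have \<beta>1: "\<beta> \<le> \<epsilon> / 16 * n" .
    have "(1 - c.carve_prob) ^ L * (real (card (c.undone D)) - \<beta>) \<le> (1 - c.carve_prob) ^ L * n"
      by (rule mult_left_mono[OF _ L0]) (use ud[of D] \<beta>0 in \<open>simp add: n_def\<close>)
    also have "\<dots> \<le> \<epsilon> / 16 * n" by (rule mult_right_mono) (use L nn in auto)
    finally have u1: "real (card (c.undone E)) \<le> \<epsilon> / 8 * n + real L * (\<eta> * M)" using uE \<beta>1 by simp
    have nM: "\<epsilon> / 8 * n \<le> \<epsilon> / 8 * M" by (rule mult_left_mono) (use nn \<epsilon> in \<open>auto simp: M_def\<close>)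
    have \<eta>M: "\<eta> * M \<ge> 0" using \<eta> nn by simp
    obtain V V' f where iso: "part_iso E V E' V' f"
      and V: "real (db_size E) - real (card V) \<le> real (card (c.undone E)) + T * (\<eta> * M)"
      using c.maximal_matching[OF bE order_refl clE \<eta>M] unfolding T_def by blast
    have cV: "card V' = card V" using iso bij_betw_same_card by (metis part_iso_def)
    have le: "card V \<le> db_size D" "card V' \<le> db_size D'"
      using iso szE card_mono[of "{0..<db_size D}" V] card_mono[of "{0..<db_size D'}" V'] by (auto simp: part_iso_def)
    have sizes: "\<bar>n - n'\<bar> \<le> T * (\<eta> * M)"
      using close_size[OF bE clE] szE by (simp add: n_def n'_def T_def)
    have "dist_pm \<sigma> ar D' D \<le> card (tuples D' - tuples E') + card (tuples D - tuples E) + (db_size E' - card V') + (db_size E - card V)"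
      by (rule dist_pm_part_iso[OF finite_tuples[OF D'] finite_tuples[OF bD] sub(2,1) _ _ part_iso_sym[OF iso]])
        (use bdb_tupleD(3)[OF bE(1)] bdb_tupleD(3)[OF bE(2)] in blast)+
    then have "real (dist_pm \<sigma> ar D' D) \<le> real (card (tuples D' - tuples E')) + real (card (tuples D - tuples E)) + (n' - real (card V)) + (n - real (card V))"
      using le cV szE unfolding n_def n'_def by linarith
    \<comment> \<open>The unmatched part of \<open>D'\<close> is written as the difference of sizes
      plus the unmatched part of \<open>D\<close>, so only the undone elements of \<open>D\<close>
      have to be bounded.\<close>
    also have "\<dots> \<le> \<delta> * n' + \<delta> * n + (n' - n) + 2 * (n - real (card V))"
      using cost[OF co(1)] cost[OF co(2)] by (simp add: n_def n'_def)
    also have "\<dots> \<le> \<delta> * M + T * (\<eta> * M) + 2 * (real (card (c.undone E)) + T * (\<eta> * M))"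
    proof -
      have 1: "\<delta> * n' + \<delta> * n \<le> \<delta> * M" by (simp add: M_def distrib_left)
      have 2: "n' - n \<le> T * (\<eta> * M)" using sizes by linarith
      have 3: "n - real (card V) \<le> real (card (c.undone E)) + T * (\<eta> * M)" using V szE by (simp add: n_def)
      show ?thesis by (rule add_mono[OF add_mono[OF 1 2] mult_left_mono[OF 3]]) simp
    qed
    also have "\<dots> \<le> \<epsilon> / 8 * M + T * (\<eta> * M) + 2 * (\<epsilon> / 8 * M + real L * (\<eta> * M) + T * (\<eta> * M))"
    proof -
      have 1: "\<delta> * M + T * (\<eta> * M) \<le> \<epsilon> / 8 * M + T * (\<eta> * M)" by (simp add: \<delta>_def)
      have 2: "real (card (c.undone E)) \<le> \<epsilon> / 8 * M + real L * (\<eta> * M)" using u1 nM by (rule order_trans[OF _ add_right_mono])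
      show ?thesis by (rule add_mono[OF 1 mult_left_mono[OF add_right_mono[OF 2]]]) simp
    qed
    also have "\<dots> = 3 * (\<epsilon> / 8 * M) + (2 * real L + 3 * T) * \<eta> * M" by (simp add: algebra_simps)
    also have "\<dots> \<le> 3 * (\<epsilon> / 8 * M) + \<epsilon> / 4 * M" by (rule add_left_mono[OF mult_right_mono[OF \<eta>b nn(3)]])
    also have "\<dots> = 5 / 8 * (\<epsilon> * M)" by simp
    also have "\<dots> \<le> 1 * (\<epsilon> * M)" by (rule mult_right_mono) (use \<epsilon> nn(3) in auto)
    finally show ?thesis by (simp add: M_def n_def n'_def)
  qed
  then show ?thesis
    by (intro exI[of _ r'] exI[of _ \<eta>'] exI[of _ N0] conjI ballI allI impI \<eta>')
qed

text \<open>Multiplying the coefficients of the periods by \<open>q\<close> and rounding down stays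
  in the linear set. The result misses the \<open>q\<close>-fold vector by at most one copy of each
  period and \<open>\<bar>1 - q\<bar>\<close> copies of the base vector. For fixed \<open>q\<close>
  this error does not grow with the database.\<close>

lemma semilinear_scaling:
  assumes "semilinear_set (histogram \<sigma> ar r ` P)"
  shows "\<exists>K\<ge>0. \<forall>D\<in>P. \<forall>q\<ge>0. \<exists>D'\<in>P. \<forall>\<tau>\<in>types r.
    \<bar>real (histogram \<sigma> ar r D' \<tau>) - q * real (histogram \<sigma> ar r D \<tau>)\<bar> \<le> K * (1 + q)"
proof -
  obtain \<L> where \<L>: "finite \<L>" "\<forall>M\<in>\<L>. linear_set M" "histogram \<sigma> ar r ` P = \<Union>\<L>"
    using assms unfolding semilinear_set_def by (elim exE conjE) (rule that; assumption)
  have "\<exists>K\<ge>0. \<forall>v\<in>M. \<forall>q\<ge>0. \<exists>v'\<in>M. \<forall>\<tau>\<in>types r. \<bar>real (v' \<tau>) - q * real (v \<tau>)\<bar> \<le> K * (1 + q)" if "M \<in> \<L>" for M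
  proof -
    have "linear_set M" using that \<L>(2) by blast
    then obtain v0 vs where M: "M = {(\<lambda>x. v0 x + (\<Sum>i<length vs. c i * (vs ! i) x)) | c. True}"
      unfolding linear_set_def by (elim exE) (rule that)
    \<comment> \<open>Base vector plus one copy of each period: the error in coordinate
      \<open>\<tau>\<close> is at most \<open>1 + q\<close> times this. Summing over the types gives
      a constant that serves all coordinates.\<close>
    define w where "w \<tau> = real (v0 \<tau>) + (\<Sum>i<length vs. real ((vs ! i) \<tau>))" for \<tau>
    define K where "K = (\<Sum>\<tau>\<in>types r. w \<tau>)"
    have w0: "w \<tau> \<ge> 0" for \<tau> by (simp add: w_def sum_nonneg)
    have wK: "w \<tau> \<le> K" if "\<tau> \<in> types r" for \<tau>
      unfolding K_def using that finite_types w0 by (simp add: member_le_sum)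
    have "\<exists>v'\<in>M. \<forall>\<tau>\<in>types r. \<bar>real (v' \<tau>) - q * real (v \<tau>)\<bar> \<le> K * (1 + q)" if v: "v \<in> M" and q: "q \<ge> 0" for v q
    proof -
      obtain c where c: "v = (\<lambda>x. v0 x + (\<Sum>i<length vs. c i * (vs ! i) x))" 
        using v unfolding M mem_Collect_eq by (elim exE conjE) (rule that)
      define c' where "c' i = nat \<lfloor>q * real (c i)\<rfloor>" for i
      have c'b: "\<bar>real (c' i) - q * real (c i)\<bar> \<le> 1" for i
      proof -
        have "0 \<le> q * real (c i)" using q by simp
        then show ?thesis unfolding c'_def by (simp add: abs_le_iff) linarith
      qed
      define v' where "v' = (\<lambda>x. v0 x + (\<Sum>i<length vs. c' i * (vs ! i) x))"
      have "v' \<in> M" unfolding M v'_def mem_Collect_eq by (rule exI[of _ c']) simp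
      moreover have "\<bar>real (v' \<tau>) - q * real (v \<tau>)\<bar> \<le> K * (1 + q)" if t: "\<tau> \<in> types r" for \<tau>
      proof -
        have eq: "real (v' \<tau>) - q * real (v \<tau>) = (1 - q) * real (v0 \<tau>) + (\<Sum>i<length vs. (real (c' i) - q * real (c i)) * real ((vs ! i) \<tau>))"
          unfolding v'_def c by (simp add: left_diff_distrib sum_subtractf sum_distrib_left distrib_left mult.assoc)
        have "\<bar>real (v' \<tau>) - q * real (v \<tau>)\<bar> \<le> \<bar>(1 - q) * real (v0 \<tau>)\<bar> + \<bar>\<Sum>i<length vs. (real (c' i) - q * real (c i)) * real ((vs ! i) \<tau>)\<bar>"
          unfolding eq by (rule abs_triangle_ineq)
        also have "\<dots> \<le> (1 + q) * real (v0 \<tau>) + (\<Sum>i<length vs. 1 * real ((vs ! i) \<tau>))"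
        proof (rule add_mono)
          show "\<bar>(1 - q) * real (v0 \<tau>)\<bar> \<le> (1 + q) * real (v0 \<tau>)"
            unfolding abs_mult using q by (intro mult_mono) auto
          have "\<bar>\<Sum>i<length vs. (real (c' i) - q * real (c i)) * real ((vs ! i) \<tau>)\<bar> \<le> (\<Sum>i<length vs. \<bar>(real (c' i) - q * real (c i)) * real ((vs ! i) \<tau>)\<bar>)"
            by (rule sum_abs)
          also have "\<dots> \<le> (\<Sum>i<length vs. 1 * real ((vs ! i) \<tau>))"
          proof (rule sum_mono)
            fix i show "\<bar>(real (c' i) - q * real (c i)) * real ((vs ! i) \<tau>)\<bar> \<le> 1 * real ((vs ! i) \<tau>)"
              unfolding abs_mult using c'b[of i] by (intro mult_mono) auto
          qed
          finally show "\<bar>\<Sum>i<length vs. (real (c' i) - q * real (c i)) * real ((vs ! i) \<tau>)\<bar> \<le> (\<Sum>i<length vs. 1 * real ((vs ! i) \<tau>))" .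
        qed
        also have "\<dots> \<le> (1 + q) * real (v0 \<tau>) + (1 + q) * (\<Sum>i<length vs. real ((vs ! i) \<tau>))"
          using q mult_right_mono[of 1 "1 + q" "\<Sum>i<length vs. real ((vs ! i) \<tau>)"] by (simp add: sum_nonneg)
        also have "\<dots> = w \<tau> * (1 + q)" by (simp add: w_def algebra_simps)
        also have "\<dots> \<le> K * (1 + q)" using wK[OF t] q by (intro mult_right_mono) auto
        finally show ?thesis .
      qed
      ultimately show ?thesis by blast
    qed
    moreover have "K \<ge> 0" unfolding K_def by (rule sum_nonneg) (use w0 in blast)
    ultimately show ?thesis by blast
  qed
  then obtain Kf where Kf: "\<And>M. M \<in> \<L> \<Longrightarrow> Kf M \<ge> 0 \<and> (\<forall>v\<in>M. \<forall>q\<ge>0. \<exists>v'\<in>M. \<forall>\<tau>\<in>types r. \<bar>real (v' \<tau>) - q * real (v \<tau>)\<bar> \<le> Kf M * (1 + q))"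
    by metis
  define K where "K = (\<Sum>M\<in>\<L>. Kf M)"
  have K0: "K \<ge> 0" unfolding K_def by (rule sum_nonneg) (use Kf in blast)
  have "\<exists>D'\<in>P. \<forall>\<tau>\<in>types r. \<bar>real (histogram \<sigma> ar r D' \<tau>) - q * real (histogram \<sigma> ar r D \<tau>)\<bar> \<le> K * (1 + q)"
    if D: "D \<in> P" and q: "q \<ge> 0" for D q
  proof -
    have "histogram \<sigma> ar r D \<in> \<Union>\<L>" using D unfolding \<L>(3)[symmetric] by (rule imageI)
    then obtain M where M: "M \<in> \<L>" "histogram \<sigma> ar r D \<in> M" by blast
    obtain v' where v': "v' \<in> M" "\<forall>\<tau>\<in>types r. \<bar>real (v' \<tau>) - q * real (histogram \<sigma> ar r D \<tau>)\<bar> \<le> Kf M * (1 + q)"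
      using Kf[OF M(1)] M(2) q by blast
    have "v' \<in> histogram \<sigma> ar r ` P" unfolding \<L>(3) using v'(1) M(1) by blast
    then obtain D' where D': "D' \<in> P" "v' = histogram \<sigma> ar r D'" by blast
    have "Kf M \<le> K" unfolding K_def by (rule member_le_sum[OF M(1) _ \<L>(1)]) (use Kf in blast)
    then have le: "Kf M * (1 + q) \<le> K * (1 + q)" using q by (intro mult_right_mono) auto
    have "\<bar>real (histogram \<sigma> ar r D' \<tau>) - q * real (histogram \<sigma> ar r D \<tau>)\<bar> \<le> K * (1 + q)" if "\<tau> \<in> types r" for \<tau>
      using order_trans[OF bspec[OF v'(2) that] le] unfolding D'(2) .
    then show ?thesis using D'(1) by blast
  qed
  then show ?thesis using K0 by blast
qed

end

section \<open>Sampling\<close>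

lemma finite_set_unif: "finite (set_pmf (unif n))"
  by (simp add: unif_def)

lemma finite_set_replicate_unif: "finite (set_pmf (replicate_pmf s (unif n)))"
  unfolding set_replicate_pmf lists_eq_set
  using finite_lists_length_eq[OF finite_set_unif[of n], of s] by (rule rev_finite_subset) auto

lemma expectation_replicate_Suc:
  fixes h :: "nat list \<Rightarrow> real"
  assumes "n > 0"
  shows "measure_pmf.expectation (replicate_pmf (Suc s) (unif n)) h =
    (\<Sum>a<n. measure_pmf.expectation (replicate_pmf s (unif n)) (\<lambda>xs. h (a # xs))) / real n"
proof -
  have "replicate_pmf (Suc s) (unif n) = bind_pmf (unif n) (\<lambda>a. map_pmf (Cons a) (replicate_pmf s (unif n)))"
    by (simp add: map_pmf_def)
  then have "measure_pmf.expectation (replicate_pmf (Suc s) (unif n)) h =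
     (\<Sum>a\<in>{0..<n}. pmf (unif n) a *\<^sub>R measure_pmf.expectation (map_pmf (Cons a) (replicate_pmf s (unif n))) h)"
    using pmf_expectation_bind[of "{0..<n}" "\<lambda>a. map_pmf (Cons a) (replicate_pmf s (unif n))" "unif n" h]
      finite_set_replicate_unif[of s n] assms by (simp add: unif_def)
  also have "\<dots> = (\<Sum>a\<in>{0..<n}. measure_pmf.expectation (replicate_pmf s (unif n)) (\<lambda>xs. h (a # xs)) / real n)"
    by (rule sum.cong) (use assms in \<open>auto simp: unif_def\<close>)
  finally show ?thesis by (simp add: sum_divide_distrib lessThan_atLeast0)
qed

text \<open>Splitting off the first sample, the mixed term is its value times the mean of the
  remaining sum, which vanishes; so each sample adds at most \<open>1\<close> to the second
  moment.\<close>

lemma sample_moments: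
  fixes y :: "nat \<Rightarrow> real"
  assumes n: "n > 0" and y: "(\<Sum>a<n. y a) = 0" "\<And>a. \<bar>y a\<bar> \<le> 1"
  shows "measure_pmf.expectation (replicate_pmf s (unif n)) (\<lambda>xs. sum_list (map y xs)) = 0 \<and>
    measure_pmf.expectation (replicate_pmf s (unif n)) (\<lambda>xs. (sum_list (map y xs))\<^sup>2) \<le> real s"
proof (induction s)
  case (Suc s)
  let ?E = "measure_pmf.expectation (replicate_pmf s (unif n))"
  let ?Z = "\<lambda>xs. sum_list (map y xs)"
  have int: "integrable (measure_pmf (replicate_pmf s (unif n))) f" for f :: "nat list \<Rightarrow> real"
    by (rule integrable_measure_pmf_finite[OF finite_set_replicate_unif])
  have "?E (\<lambda>xs. ?Z (a # xs)) = y a + ?E ?Z" for a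
    using int by (simp add: measure_pmf.prob_space)
  then have 1: "measure_pmf.expectation (replicate_pmf (Suc s) (unif n)) ?Z = 0"
    unfolding expectation_replicate_Suc[OF n] using Suc y(1) by simp
  have e2: "?E (\<lambda>xs. (?Z (a # xs))\<^sup>2) = (y a)\<^sup>2 + 2 * y a * ?E ?Z + ?E (\<lambda>xs. (?Z xs)\<^sup>2)" for a
  proof -
    have "?E (\<lambda>xs. (?Z (a # xs))\<^sup>2) = ?E (\<lambda>xs. (y a)\<^sup>2 + 2 * y a * ?Z xs + (?Z xs)\<^sup>2)"
      by (simp add: power2_sum algebra_simps)
    also have "\<dots> = ?E (\<lambda>xs. (y a)\<^sup>2 + 2 * y a * ?Z xs) + ?E (\<lambda>xs. (?Z xs)\<^sup>2)"
      by (rule Bochner_Integration.integral_add[OF int int])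
    also have "?E (\<lambda>xs. (y a)\<^sup>2 + 2 * y a * ?Z xs) = ?E (\<lambda>xs. (y a)\<^sup>2) + ?E (\<lambda>xs. 2 * y a * ?Z xs)"
      by (rule Bochner_Integration.integral_add[OF int int])
    finally show ?thesis by (simp add: measure_pmf.prob_space)
  qed
  have "(\<Sum>a<n. ?E (\<lambda>xs. (?Z (a # xs))\<^sup>2)) \<le> (\<Sum>a<n. 1 + real s)"
  proof (rule sum_mono)
    fix a
    have "(y a)\<^sup>2 \<le> 1" using y(2)[of a] by (simp add: abs_square_le_1)
    then show "?E (\<lambda>xs. (?Z (a # xs))\<^sup>2) \<le> 1 + real s" unfolding e2 using Suc by simp
  qed
  then have "measure_pmf.expectation (replicate_pmf (Suc s) (unif n)) (\<lambda>xs. (?Z xs)\<^sup>2) \<le> real (Suc s)"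
    unfolding expectation_replicate_Suc[OF n] using n by (simp add: divide_le_eq mult.commute)
  then show ?case using 1 by blast
qed simp

lemma sample_chebyshev:
  fixes y :: "nat \<Rightarrow> real"
  assumes n: "n > 0" and y: "(\<Sum>a<n. y a) = 0" "\<And>a. \<bar>y a\<bar> \<le> 1" and \<theta>: "\<theta> > 0"
  shows "measure_pmf.prob (replicate_pmf s (unif n)) {xs. \<theta> < \<bar>sum_list (map y xs)\<bar>} * \<theta>\<^sup>2 \<le> real s"
proof -
  let ?p = "replicate_pmf s (unif n)"
  let ?A = "{xs. \<theta> < \<bar>sum_list (map y xs)\<bar>}"
  have int: "integrable (measure_pmf ?p) f" for f :: "nat list \<Rightarrow> real"
    by (rule integrable_measure_pmf_finite[OF finite_set_replicate_unif])
  have "measure_pmf.prob ?p ?A * \<theta>\<^sup>2 = measure_pmf.expectation ?p (\<lambda>xs. indicator ?A xs * \<theta>\<^sup>2)"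
    by simp
  also have "\<dots> \<le> measure_pmf.expectation ?p (\<lambda>xs. (sum_list (map y xs))\<^sup>2)"
  proof (rule integral_mono[OF int int])
    fix xs
    show "indicator ?A xs * \<theta>\<^sup>2 \<le> (sum_list (map y xs))\<^sup>2"
      using \<theta> power_mono[of \<theta> "\<bar>sum_list (map y xs)\<bar>" 2] by (auto simp: indicator_def)
  qed
  also have "\<dots> \<le> real s" using sample_moments[OF n y] by blast
  finally show ?thesis .
qed

text \<open>For each type, Chebyshev's inequality bounds the chance of a deviation by
  \<open>1 / (s * \<theta>\<^sup>2)\<close>, as the variance of the count is at most
  \<open>s\<close>. The hypothesis on \<open>s\<close> makes the sum over \<open>\<T>\<close> at
  most one third.\<close>

lemma sampling_concentration:
  assumes n: "n > 0" and \<T>: "finite \<T>" and \<theta>: "\<theta> > 0" and s: "s > 0" "3 * real (card \<T>) \<le> real s * \<theta>\<^sup>2"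
  shows "2 / 3 \<le> measure_pmf.prob (replicate_pmf s (unif n))
    {xs. \<forall>\<tau>\<in>\<T>. \<bar>real (count_list (map T xs) \<tau>) / real s - real (card {a. a < n \<and> T a = \<tau>}) / real n\<bar> \<le> \<theta>}"
proof -
  let ?p = "replicate_pmf s (unif n)"
  define q where "q \<tau> = real (card {a. a < n \<and> T a = \<tau>}) / real n" for \<tau>
  \<comment> \<open>Centred indicators, whose sum over a sample is the deviation of the count from
    its mean.\<close>
  define y where "y \<tau> a = (if T a = \<tau> then 1 else 0) - q \<tau>" for \<tau> a
  define B where "B \<tau> = {xs. real s * \<theta> < \<bar>sum_list (map (y \<tau>) xs)\<bar>}" for \<tau>
  have "card {a. a < n \<and> T a = \<tau>} \<le> n" for \<tau> using card_mono[of "{..<n}" "{a. a < n \<and> T a = \<tau>}"] by auto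
  then have q: "0 \<le> q \<tau>" "q \<tau> \<le> 1" for \<tau> using n by (auto simp: q_def divide_le_eq_1)
  have y1: "\<bar>y \<tau> a\<bar> \<le> 1" for \<tau> a using q[of \<tau>] by (auto simp: y_def)
  have "(\<Sum>a<n. (if T a = \<tau> then 1 else 0 :: real)) = real (card {a. a < n \<and> T a = \<tau>})" for \<tau>
  proof -
    have "{..<n} \<inter> {a. T a = \<tau>} = {a. a < n \<and> T a = \<tau>}" by auto
    then show ?thesis by (simp add: sum.If_cases)
  qed
  then have y0: "(\<Sum>a<n. y \<tau> a) = 0" for \<tau>
    using n by (simp add: y_def sum_subtractf q_def)
  have sl: "sum_list (map (y \<tau>) xs) = real (count_list (map T xs) \<tau>) - real (length xs) * q \<tau>" for xs \<tau>
    by (induction xs) (auto simp: y_def algebra_simps)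
  have s\<theta>: "real s * \<theta> > 0" using s \<theta> by simp
  have PB: "measure_pmf.prob ?p (B \<tau>) \<le> 1 / (real s * \<theta>\<^sup>2)" for \<tau>
  proof -
    have "measure_pmf.prob ?p (B \<tau>) * (real s * \<theta>)\<^sup>2 \<le> real s"
      unfolding B_def by (rule sample_chebyshev[OF n y0 y1 s\<theta>])
    then have "real s * (measure_pmf.prob ?p (B \<tau>) * (real s * \<theta>\<^sup>2)) \<le> real s * 1"
      by (simp add: power2_eq_square algebra_simps)
    then have "measure_pmf.prob ?p (B \<tau>) * (real s * \<theta>\<^sup>2) \<le> 1" using s(1) by (simp add: mult_le_cancel_left)
    then show ?thesis using s \<theta> by (simp add: pos_le_divide_eq)
  qed
  have "measure_pmf.prob ?p (\<Union>\<tau>\<in>\<T>. B \<tau>) \<le> (\<Sum>\<tau>\<in>\<T>. measure_pmf.prob ?p (B \<tau>))"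
    by (rule measure_pmf.finite_measure_subadditive_finite[OF \<T>]) auto
  also have "\<dots> \<le> (\<Sum>\<tau>\<in>\<T>. 1 / (real s * \<theta>\<^sup>2))" by (rule sum_mono[OF PB])
  also have "\<dots> = real (card \<T>) / (real s * \<theta>\<^sup>2)" by simp
  also have "\<dots> \<le> 1 / 3" using s \<theta> by (simp add: divide_le_eq)
  finally have U: "measure_pmf.prob ?p (\<Union>\<tau>\<in>\<T>. B \<tau>) \<le> 1 / 3" .
  have "measure_pmf.prob ?p (UNIV - (\<Union>\<tau>\<in>\<T>. B \<tau>)) = 1 - measure_pmf.prob ?p (\<Union>\<tau>\<in>\<T>. B \<tau>)"
    using measure_pmf.prob_compl[of "\<Union>\<tau>\<in>\<T>. B \<tau>" ?p] by simp
  then have "2 / 3 \<le> measure_pmf.prob ?p (UNIV - (\<Union>\<tau>\<in>\<T>. B \<tau>))" using U by simp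
  \<comment> \<open>Passing to the support guarantees samples of length \<open>s\<close>, by which
    the counts are divided.\<close>
  also have "\<dots> = measure_pmf.prob ?p ((UNIV - (\<Union>\<tau>\<in>\<T>. B \<tau>)) \<inter> set_pmf ?p)" by (rule measure_Int_set_pmf[symmetric])
  also have "\<dots> \<le> measure_pmf.prob ?p {xs. \<forall>\<tau>\<in>\<T>. \<bar>real (count_list (map T xs) \<tau>) / real s - q \<tau>\<bar> \<le> \<theta>}"
  proof (rule measure_pmf.finite_measure_mono)
    show "(UNIV - (\<Union>\<tau>\<in>\<T>. B \<tau>)) \<inter> set_pmf ?p \<subseteq> {xs. \<forall>\<tau>\<in>\<T>. \<bar>real (count_list (map T xs) \<tau>) / real s - q \<tau>\<bar> \<le> \<theta>}"
    proof
      fix xs assume xs: "xs \<in> (UNIV - (\<Union>\<tau>\<in>\<T>. B \<tau>)) \<inter> set_pmf ?p"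
      then have len: "length xs = s" by (auto simp: set_replicate_pmf)
      have "\<bar>real (count_list (map T xs) \<tau>) / real s - q \<tau>\<bar> \<le> \<theta>" if t: "\<tau> \<in> \<T>" for \<tau>
      proof -
        have "xs \<notin> B \<tau>" using xs t by blast
        then have "\<bar>real (count_list (map T xs) \<tau>) - real s * q \<tau>\<bar> \<le> real s * \<theta>" by (simp add: B_def sl len)
        moreover have "real (count_list (map T xs) \<tau>) / real s - q \<tau> = (real (count_list (map T xs) \<tau>) - real s * q \<tau>) / real s"
          using s(1) by (simp add: diff_divide_distrib)
        ultimately show ?thesis using s(1) by (simp add: abs_divide divide_le_eq mult.commute)
      qed
      then show "xs \<in> {xs. \<forall>\<tau>\<in>\<T>. \<bar>real (count_list (map T xs) \<tau>) / real s - q \<tau>\<bar> \<le> \<theta>}" by blast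
    qed
  qed simp
  finally show ?thesis unfolding q_def .
qed

section \<open>The tester\<close>

lemma dist_pm_self: "dist_pm \<sigma> ar D D = 0"
proof -
  have "db_iso D D" unfolding db_iso_def by (rule exI[of _ "\<lambda>x. x"]) (simp add: bij_betw_def)
  then have "\<exists>k1 k2 E E'. 0 = k1 + k2 \<and> (mod_step \<sigma> ar ^^ k1) D E \<and> (mod_step \<sigma> ar ^^ k2) D E' \<and> db_iso E E'"
    by (intro exI[of _ "0::nat"] exI[of _ D]) simp
  then show ?thesis unfolding dist_pm_def by (rule Least_eq_0)
qed

text \<open>Justifies the exact answer on small databases: what is far from \<open>P\<close> is not
  in \<open>P\<close>.\<close>

lemma not_eps_far_from_self:
  assumes "D \<in> P" "\<epsilon> > 0" shows "\<not> eps_far_from \<sigma> ar d \<epsilon> D P"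
proof
  assume "eps_far_from \<sigma> ar d \<epsilon> D P"
  then have "eps_far \<sigma> ar d \<epsilon> D D" using assms(1) by (simp add: eps_far_from_def)
  moreover have "0 \<le> \<epsilon> * real d * real (min (db_size D) (db_size D))" using assms(2) by simp
  ultimately show False unfolding eps_far_def dist_pm_self by simp
qed

context bounded_schema begin

lemma eps_k_partition_tuples:
  assumes D: "bdb D" and p: "eps_k_partition \<sigma> e k D F"
  shows "sub_db F D" "components_le F k" "real (card (tuples D - tuples F)) \<le> e * real (db_size D)"
proof -
  show "sub_db F D" "components_le F k" using p by (auto simp: eps_k_partition_def sub_db_def)
  have eq: "tuples D - tuples F = Sigma \<sigma> (\<lambda>R. db_rel D R - db_rel F R)"
    using bdb_tupleD(1)[OF D] by (auto simp: tuples_def)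
  have "finite (db_rel D R - db_rel F R)" for R
  proof -
    have "finite (Pair R ` (db_rel D R - db_rel F R))"
      by (rule finite_subset[OF _ finite_tuples[OF D]]) (auto simp: tuples_def)
    then show ?thesis by (rule finite_imageD) (auto simp: inj_on_def)
  qed
  then have "card (tuples D - tuples F) = (\<Sum>R\<in>\<sigma>. card (db_rel D R - db_rel F R))"
    unfolding eq using finite_sigma by (simp add: card_SigmaI)
  then show "real (card (tuples D - tuples F)) \<le> e * real (db_size D)"
    using p by (simp add: eps_k_partition_def)
qed

text \<open>The factor \<open>q = n / n'\<close> brings \<open>D'\<close> to about the size
  \<open>n\<close> of \<open>D\<close>. Frequencies contribute an error of at most
  \<open>2 * \<kappa> * n\<close>; the scaling error \<open>K * (1 + n / n')\<close> is at most
  \<open>\<kappa> * n\<close>, because both sizes are at least \<open>n0\<close>.\<close>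

lemma frequency_close_imp_close_member:
  assumes K: "\<forall>q\<ge>0. \<exists>D''\<in>P. \<forall>\<tau>\<in>types r.
      \<bar>real (histogram \<sigma> ar r D'' \<tau>) - q * real (histogram \<sigma> ar r D' \<tau>)\<bar> \<le> K * (1 + q)"
    and n0: "n0 > 0" "2 * K \<le> \<kappa> * n0" "n0 \<le> real (db_size D)" "n0 \<le> real (db_size D')" and \<kappa>: "\<kappa> > 0"
    and fr: "\<forall>\<tau>\<in>types r. \<bar>real (histogram \<sigma> ar r D \<tau>) / real (db_size D) -
      real (histogram \<sigma> ar r D' \<tau>) / real (db_size D')\<bar> \<le> 2 * \<kappa>"
  shows "\<exists>D''\<in>P. close r (3 * \<kappa> * real (db_size D)) D'' D"
proof -
  define n where "n = real (db_size D)"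
  define n' where "n' = real (db_size D')"
  have n: "n > 0" "n' > 0" using n0 by (auto simp: n_def n'_def)
  obtain D'' where D'': "D'' \<in> P" "\<forall>\<tau>\<in>types r.
      \<bar>real (histogram \<sigma> ar r D'' \<tau>) - n / n' * real (histogram \<sigma> ar r D' \<tau>)\<bar> \<le> K * (1 + n / n')"
    using K[rule_format, of "n / n'"] n by auto
  have "\<kappa> * n0 \<le> \<kappa> * n" "\<kappa> * n0 \<le> \<kappa> * n'"
    by (rule mult_left_mono; use n0 \<kappa> in \<open>simp add: n_def n'_def\<close>)+
  then have K1: "K \<le> \<kappa> * n / 2" and K2: "K \<le> \<kappa> * n' / 2" using n0(2) by linarith+
  have "K * (n / n') \<le> \<kappa> * n' / 2 * (n / n')" by (rule mult_right_mono[OF K2]) (use n in simp)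
  also have "\<dots> = \<kappa> * n / 2" using n by simp
  finally have "K * (n / n') \<le> \<kappa> * n / 2" .
  then have Kb: "K * (1 + n / n') \<le> \<kappa> * n" unfolding distrib_left mult_1_right using K1 by linarith
  have "close r (3 * \<kappa> * n) D'' D"
    unfolding close_def
  proof
    fix \<tau> assume t: "\<tau> \<in> types r"
    let ?h = "real (histogram \<sigma> ar r D \<tau>)" and ?h' = "real (histogram \<sigma> ar r D' \<tau>)" and ?h'' = "real (histogram \<sigma> ar r D'' \<tau>)"
    have 1: "\<bar>?h'' - n / n' * ?h'\<bar> \<le> \<kappa> * n" by (rule order_trans[OF bspec[OF D''(2) t] Kb])
    have "n / n' * ?h' - ?h = - (n * (?h / n - ?h' / n'))" using n by (simp add: field_simps)
    then have "\<bar>n / n' * ?h' - ?h\<bar> = n * \<bar>?h / n - ?h' / n'\<bar>" using n by (simp add: abs_mult)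
    also have "\<dots> \<le> n * (2 * \<kappa>)" using bspec[OF fr t] n by (intro mult_left_mono) (auto simp: n_def n'_def)
    finally have 2: "\<bar>n / n' * ?h' - ?h\<bar> \<le> 2 * (\<kappa> * n)" by (simp add: mult_ac)
    show "\<bar>?h'' - ?h\<bar> \<le> 3 * \<kappa> * n" using 1 2 by (simp add: abs_le_iff)
  qed
  then show ?thesis using D''(1) unfolding n_def by blast
qed

end

theorem theorem12:
  fixes \<sigma> :: "'r set" and ar :: "'r \<Rightarrow> nat" and d :: nat and C P :: "'r db set"
  assumes "schema \<sigma> ar"
    and "d \<ge> 2"
    and "\<forall>D\<in>C. wf_db \<sigma> ar D \<and> db_degree_le D d"
    and "iso_closed \<sigma> ar C"
    and "closed_under_tuple_removal C"
    and "P \<subseteq> C"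
    and "iso_closed \<sigma> ar P"
    and "hyperfinite_on \<sigma> P C"
    and "\<forall>r. semilinear_set (histogram \<sigma> ar r ` P)"
  shows "uniformly_testable_const_time \<sigma> ar d P C"
  unfolding uniformly_testable_const_time_def
proof (intro allI impI)
  fix \<epsilon> :: real assume \<epsilon>: "0 < \<epsilon> \<and> \<epsilon> \<le> 1"
  interpret bounded_schema \<sigma> ar d by unfold_locales (rule assms(1))
  have C: "bdb D" if "D \<in> C" for D using assms(3) that by (simp add: bdb_def)
  have P: "bdb D" if "D \<in> P" for D using C assms(6) that by blast
  obtain \<rho> where \<rho>: "rho_hyperfinite_on \<sigma> \<rho> P C" using assms(8) unfolding hyperfinite_on_def by blast
  have PH: "\<forall>D\<in>P. bdb D" and CB: "\<forall>D\<in>C. bdb D" using P C by auto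
  have "\<exists>k. \<forall>D\<in>P. \<exists>F. sub_db F D \<and> components_le F k \<and> real (card (tuples D - tuples F)) \<le> e * real (db_size D)"
    if e: "0 < e" "e \<le> 1" for e
  proof (intro exI[of _ "\<rho> e"] ballI)
    fix D assume D: "D \<in> P"
    obtain F where "eps_k_partition \<sigma> e (\<rho> e) D F" 
      using \<rho> D e unfolding rho_hyperfinite_on_def by blast
    then show "\<exists>F. sub_db F D \<and> components_le F (\<rho> e) \<and> real (card (tuples D - tuples F)) \<le> e * real (db_size D)"
      using eps_k_partition_tuples[OF P[OF D]] by blast
  qed
  then have hyper: "\<forall>e. 0 < e \<and> e \<le> 1 \<longrightarrow> (\<exists>k. \<forall>D\<in>P. \<exists>F. sub_db F D \<and> components_le F k \<and>
      real (card (tuples D - tuples F)) \<le> e * real (db_size D))"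
    by blast
  \<comment> \<open>The member found will have at most \<open>3 / 2\<close> and at least
    \<open>1 / 2\<close> times the \<open>n\<close> elements of the input. The distance is then at
    most \<open>\<epsilon> / 5 * (5 / 2 * n)\<close>, which is \<open>\<epsilon> * n / 2\<close> and
    hence at most \<open>\<epsilon>\<close> times the smaller size.\<close>
  have "\<epsilon> / 5 > 0" using \<epsilon> by simp
  from close_histograms_imp_close[OF PH hyper this]
  obtain r \<eta> N0 where \<eta>: "\<eta> > 0" and NS: "\<forall>D\<in>P. \<forall>D'. bdb D' \<longrightarrow> N0 \<le> db_size D \<longrightarrow> N0 \<le> db_size D' \<longrightarrow>
    close r (\<eta> * (real (db_size D) + real (db_size D'))) D D' \<longrightarrow>
    real (dist_pm \<sigma> ar D' D) \<le> \<epsilon> / 5 * (real (db_size D) + real (db_size D'))"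
    by (elim exE conjE) (rule that; assumption)
  obtain K where K: "K \<ge> 0" and scal: "\<forall>D\<in>P. \<forall>q\<ge>0. \<exists>D'\<in>P. \<forall>\<tau>\<in>types r.
    \<bar>real (histogram \<sigma> ar r D' \<tau>) - q * real (histogram \<sigma> ar r D \<tau>)\<bar> \<le> K * (1 + q)"
    using semilinear_scaling[OF spec[OF assms(9)], of r] by (elim exE conjE) (rule that; assumption)
  define T where "T = real (card (types r))"
  \<comment> \<open>The total error \<open>3 * \<kappa>\<close> has to be below
    \<open>\<eta>\<close>, and summed over all types it may change the size by at most one
    half.\<close>
  define \<kappa> where "\<kappa> = min (\<eta> / 3) (1 / (6 * (T + 1)))"
  have T0: "T \<ge> 0" by (simp add: T_def)
  have \<kappa>: "\<kappa> > 0" "3 * \<kappa> \<le> \<eta>" using \<eta> T0 by (auto simp: \<kappa>_def)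
  have "T * (3 * \<kappa>) \<le> T * (3 * (1 / (6 * (T + 1))))" using T0 by (intro mult_left_mono) (auto simp: \<kappa>_def)
  also have "\<dots> \<le> 1 / 2" using T0 by (simp add: field_simps)
  finally have T\<kappa>: "T * (3 * \<kappa>) \<le> 1 / 2" .
  \<comment> \<open>The summand \<open>Suc d\<close> provides the index registers,
    \<open>2 * N0\<close> leaves \<open>N0\<close> elements even in a member of half the size, and
    the last summand makes the scaling error small relative to the size.\<close>
  define m where "m = Suc d + 2 * N0 + nat \<lceil>2 * K / \<kappa>\<rceil>"
  have m: "1 \<le> m" "d \<le> m" by (auto simp: m_def)
  have "2 * K / \<kappa> \<le> real m" unfolding m_def by linarith
  then have mK: "2 * K \<le> \<kappa> * real m" using \<kappa> by (simp add: field_simps)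
  define s where "s = Suc (nat \<lceil>3 * T / \<kappa>\<^sup>2\<rceil>)"
  have "3 * T / \<kappa>\<^sup>2 \<le> real s" unfolding s_def by linarith
  then have s: "0 < s" "3 * real (card (types r)) \<le> real s * \<kappa>\<^sup>2" using \<kappa> by (auto simp: s_def T_def field_simps)
  \<comment> \<open>Only frequencies of members occur, so the condition can be fixed in the program
    for all input sizes. The bound \<open>m\<close> on the members ensures that they can be scaled
    with small relative error.\<close>
  define \<Phi> where "\<Phi> ts \<longleftrightarrow> (\<exists>D'\<in>P. m \<le> db_size D' \<and> (\<forall>\<tau>\<in>types r.
    \<bar>real (count_list ts \<tau>) / real s - real (histogram \<sigma> ar r D' \<tau>) / real (db_size D')\<bar> \<le> \<kappa>))" for ts
  obtain prog Tm where prog: "\<forall>D orc. D \<in> C \<longrightarrow> valid_oracle D orc \<longrightarrow>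
    run prog orc Tm (init (db_size D)) =
      map_pmf (\<lambda>xs. if (if db_size D < m then D \<in> P else \<Phi> (map (rtype \<sigma> ar r D) xs)) then Acc else Rej)
        (replicate_pmf s (unif (db_size D)))"
    using tester_program[OF CB m, of P \<Phi> r s] by (elim exE) (rule that)
  have "eps_tester \<sigma> ar d P C \<epsilon> prog Tm"
    unfolding eps_tester_def Let_def
  proof (intro allI impI)
    fix D orc assume D: "D \<in> C" and orc: "valid_oracle D orc"
    let ?n = "db_size D"
    let ?\<nu> = "replicate_pmf s (unif ?n)"
    let ?acc = "\<lambda>xs. if ?n < m then D \<in> P else \<Phi> (map (rtype \<sigma> ar r D) xs)"
    define \<mu> where "\<mu> = run prog orc Tm (init ?n)"
    have \<mu>: "\<mu> = map_pmf (\<lambda>xs. if ?acc xs then Acc else Rej) ?\<nu>" unfolding \<mu>_def using prog D orc by blast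
    have set: "set_pmf \<mu> \<subseteq> {Acc, Rej}" unfolding \<mu> by auto
    have Acc: "pmf \<mu> Acc = measure_pmf.prob ?\<nu> {xs. ?acc xs}"
      unfolding \<mu> pmf_map by (rule arg_cong[where f = "measure_pmf.prob ?\<nu>"]) (auto split: if_splits)
    have Rej: "pmf \<mu> Rej = measure_pmf.prob ?\<nu> {xs. \<not> ?acc xs}"
      unfolding \<mu> pmf_map by (rule arg_cong[where f = "measure_pmf.prob ?\<nu>"]) (auto split: if_splits)
    define good where "good = {xs. \<forall>\<tau>\<in>types r. \<bar>real (count_list (map (rtype \<sigma> ar r D) xs) \<tau>) / real s -
      real (histogram \<sigma> ar r D \<tau>) / real ?n\<bar> \<le> \<kappa>}"
    have good: "2 / 3 \<le> measure_pmf.prob ?\<nu> good" if "\<not> ?n < m"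
      using sampling_concentration[OF _ finite_types \<kappa>(1) s, of ?n "rtype \<sigma> ar r D"] that m
      by (simp add: good_def histogram_def)
    have complete: "2 / 3 \<le> pmf \<mu> Acc" if DP: "D \<in> P"
    proof (cases "?n < m")
      case True
      then show ?thesis unfolding Acc using DP by simp
    next
      case False
      have "good \<subseteq> {xs. ?acc xs}"
      proof
        fix xs assume "xs \<in> good"
        then have "\<Phi> (map (rtype \<sigma> ar r D) xs)"
          unfolding \<Phi>_def good_def using False by (intro bexI[OF _ DP]) auto
        then show "xs \<in> {xs. ?acc xs}" using False by simp
      qed
      then have "measure_pmf.prob ?\<nu> good \<le> measure_pmf.prob ?\<nu> {xs. ?acc xs}"
        by (rule measure_pmf.finite_measure_mono) simp
      then show ?thesis unfolding Acc using good[OF False] by linarith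
    qed
    have sound: "2 / 3 \<le> pmf \<mu> Rej" if far: "eps_far_from \<sigma> ar d \<epsilon> D P"
    proof (cases "?n < m")
      case True
      have "D \<notin> P" using not_eps_far_from_self far \<epsilon> by metis
      then show ?thesis unfolding Rej using True by simp
    next
      case False
      have "good \<subseteq> {xs. \<not> ?acc xs}"
      proof
        fix xs assume xs: "xs \<in> good"
        have "\<not> \<Phi> (map (rtype \<sigma> ar r D) xs)"
        proof
          assume "\<Phi> (map (rtype \<sigma> ar r D) xs)"
          then obtain D' where D': "D' \<in> P" "m \<le> db_size D'" and f': "\<forall>\<tau>\<in>types r.
            \<bar>real (count_list (map (rtype \<sigma> ar r D) xs) \<tau>) / real s - real (histogram \<sigma> ar r D' \<tau>) / real (db_size D')\<bar> \<le> \<kappa>"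
            unfolding \<Phi>_def by blast
          have fr: "\<bar>real (histogram \<sigma> ar r D \<tau>) / real ?n - real (histogram \<sigma> ar r D' \<tau>) / real (db_size D')\<bar> \<le> 2 * \<kappa>"
            if t: "\<tau> \<in> types r" for \<tau>
          proof -
            have "\<bar>real (count_list (map (rtype \<sigma> ar r D) xs) \<tau>) / real s - real (histogram \<sigma> ar r D \<tau>) / real ?n\<bar> \<le> \<kappa>"
              using xs t unfolding good_def by blast
            then show ?thesis using bspec[OF f' t] by linarith
          qed
          have "\<exists>D''\<in>P. close r (3 * \<kappa> * real ?n) D'' D"
            by (rule frequency_close_imp_close_member[OF bspec[OF scal D'(1)] _ mK _ _ \<kappa>(1)])
              (use m False D'(2) fr in auto)
          then obtain D'' where D'': "D'' \<in> P" "close r (3 * \<kappa> * real ?n) D'' D" by blast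
          have "\<bar>real (db_size D'') - real ?n\<bar> \<le> T * (3 * \<kappa> * real ?n)"
            using close_size[OF P[OF D''(1)] C[OF D] D''(2)] by (simp add: T_def)
          also have "\<dots> = T * (3 * \<kappa>) * real ?n" by simp
          also have "\<dots> \<le> 1 / 2 * real ?n" by (rule mult_right_mono[OF T\<kappa>]) simp
          finally have sz: "\<bar>real (db_size D'') - real ?n\<bar> \<le> 1 / 2 * real ?n" .
          have "2 * N0 \<le> ?n" using False by (simp add: m_def)
          then have "2 * real N0 \<le> real ?n" by linarith
          then have "real N0 \<le> real (db_size D'')" "real N0 \<le> real ?n" using sz by linarith+
          then have N: "N0 \<le> db_size D''" "N0 \<le> ?n" by auto
          have "3 * \<kappa> * real ?n \<le> \<eta> * (real (db_size D'') + real ?n)"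
            by (rule mult_mono) (use \<kappa> \<eta> in auto)
          then have cl: "close r (\<eta> * (real (db_size D'') + real ?n)) D'' D"
            using D''(2) unfolding close_def by (meson order_trans)
          have "real (dist_pm \<sigma> ar D D'') \<le> \<epsilon> / 5 * (real (db_size D'') + real ?n)"
            using NS D''(1) C[OF D] N cl by blast
          also have "\<dots> \<le> \<epsilon> / 5 * (5 / 2 * real ?n)"
          proof (rule mult_left_mono)
            show "real (db_size D'') + real ?n \<le> 5 / 2 * real ?n" using sz by linarith
          qed (use \<epsilon> in simp)
          also have "\<dots> = \<epsilon> * (real ?n / 2)" by simp
          also have "\<dots> \<le> \<epsilon> * (real d * real (min ?n (db_size D'')))"
          proof (rule mult_left_mono)
            have "real ?n / 2 \<le> real (min ?n (db_size D''))"
            proof (cases "?n \<le> db_size D''")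
              case False
              then have "real (min ?n (db_size D'')) = real (db_size D'')" by simp
              then show ?thesis using sz by linarith
            qed simp
            also have "\<dots> = 1 * real (min ?n (db_size D''))" by simp
            also have "\<dots> \<le> real d * real (min ?n (db_size D''))" by (rule mult_right_mono) (use assms(2) in auto)
            finally show "real ?n / 2 \<le> real d * real (min ?n (db_size D''))" .
          qed (use \<epsilon> in simp)
          finally have "\<not> eps_far \<sigma> ar d \<epsilon> D D''" unfolding eps_far_def by (simp add: mult.assoc)
          then show False using far D''(1) unfolding eps_far_from_def by blast
        qed
        then show "xs \<in> {xs. \<not> ?acc xs}" using False by simp
      qed
      then have "measure_pmf.prob ?\<nu> good \<le> measure_pmf.prob ?\<nu> {xs. \<not> ?acc xs}"
        by (rule measure_pmf.finite_measure_mono) simp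
      then show ?thesis unfolding Rej using good[OF False] by linarith
    qed
    show "set_pmf (run prog orc Tm (init ?n)) \<subseteq> {Acc, Rej} \<and>
      (D \<in> P \<longrightarrow> 2 / 3 \<le> pmf (run prog orc Tm (init ?n)) Acc) \<and>
      (eps_far_from \<sigma> ar d \<epsilon> D P \<longrightarrow> 2 / 3 \<le> pmf (run prog orc Tm (init ?n)) Rej)"
      using set complete sound unfolding \<mu>_def by blast
  qed
  then show "\<exists>prog T. eps_tester \<sigma> ar d P C \<epsilon> prog T" by blast
qed

end
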